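(* For any collection $\{Y_i\}_{i\in\underline n}$ of based spaces, $\underline n=\{1,\dots,n\}$, the formula $$J(F)(\Gamma,l)=\bigwedge_{i\in\underline n}F^{\{i\}}\big((T_{ih})_{h\in\underline n\setminus\{i\}}\big)\in\bigwedge_{i\in\underline n}Y_i,\qquad F=\{F^S\colon I^{\underline n\setminus S}\to Y_S\}\in\mathrm{tofib}(Y_{\underline n};\kappa),\ (\Gamma,l)\in\mathcal T_{\underline n},$$ where $T_{ih}=T_{hi}$ is the distance in $(\Gamma,l)$ from the root to the first common descendant $v_{ih}$ of the leaves $i$ and $h$ (the vertex at which the paths from $i$ and $h$ to the root first meet), defines a $\Sigma_n$-equivariant map $$J=J_{\underline n}\colon\mathrm{tofib}(Y_{\underline n};\kappa)\longrightarrow\mathrm{Map}_*\Big(\mathcal T_{\underline n},\bigwedge_{i\in\underline n}Y_i\Big)$$ (that is, $J(\sigma F)(\sigma(\Gamma,l))=\sigma(J(F)(\Gamma,l))$ for $\sigma\in\Sigma_n$ permuting the $Y_i$'s and the leaves), such that for any two sets $S_1,S_2$ with $S_1\sqcup S_2=\underline n$ the two maps $$[-,-]_{\mathrm{graft}}\circ(\Omega J_{S_1}\wedge\Omega J_{S_2}),\quad \Omega J_{\underline n}\circ[-,-]_{\mathrm{ext}}\colon\ \Omega\,\mathrm{tofib}(Y_{S_1};\kappa)\wedge\Omega\,\mathrm{tofib}(Y_{S_2};\kappa)\longrightarrow\Omega\,\mathrm{Map}_*\Big(\mathcal T_{\underline n},\bigwedge_{i\in\underline n}Y_i\Big)$$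 are homotopic.
   Context: **Smash product.** $Z_1\wedge Z_2$ is the mapping cone of $Z_1\vee Z_2\hookrightarrow Z_1\times Z_2$ (homotopy equivalent to the usual smash product); a map out of $Z_1\times Z_2$ with a nullhomotopy on $Z_1\vee Z_2$ gives a map out of $Z_1\wedge Z_2$. **Commutators.** For loops $\gamma_b\in\Omega Z_b$, $[\gamma_1,\gamma_2]=\gamma_1\gamma_2\gamma_1^{-1}\gamma_2^{-1}\in\Omega(Z_1\vee Z_2)$ (each of the four pieces on a quarter of $[0,1]$). Canonical nullhomotopies, from the constant loop ($t=0$) to the given loop ($t=1$): $[\gamma_1,*]^{\downarrow t}(\theta)=\gamma_1(4\theta t),\gamma_1(t),\gamma_1((3-4\theta)t),*$ and $[*,\gamma_2]^{\downarrow t}(\theta)=*,\gamma_2((4\theta-1)t),\gamma_2(t),\gamma_2((4-4\theta)t)$ on the four successive quarters. **Collapsing cubes.** Let $I=[0,1]$. For a finite set $S$ and based spaces $Y_i$, $i\in S$, put $Y_T=\bigvee_{i\in T}Y_i$ for $T\subseteq S$, $Y_\emptyset=*$, and let $\kappa_T^{T'}\colon Y_{T'}\to Y_T$ ($T\subseteq T'$) collapse the factors not in $T$. A point of $\mathrm{tofib}(Y_S;\kappa)$ is a collection $F=\{F^T\colon I^{S\setminus T}\to Y_T\}_{T\subseteq S}$ with $F^T(p)=*$ if some coordinate of $p$ is $0$, and $\kappa_T^{T'}F^{T'}(p)=F^T(p,1,\dots,1)$ for $T\subseteq T'$, $p\in I^{S\setminus T'}$. We have $\Omega\,\mathrm{tofib}(Y_S;\kappa)=\mathrm{tofib}(\Omega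 Y_S;\Omega\kappa)$. **External Samelson bracket.** For $S=S_1\sqcup S_2$, $[-,-]_{\mathrm{ext}}\colon\Omega\,\mathrm{tofib}(Y_{S_1};\kappa)\wedge\Omega\,\mathrm{tofib}(Y_{S_2};\kappa)\to\Omega\,\mathrm{tofib}(Y_S;\kappa)$ sends $(F_1,F_2)$ to $F$: for $T\subseteq S$, $T_b=T\cap S_b$, $t=(t^1,t^2)\in I^{S_1\setminus T_1}\times I^{S_2\setminus T_2}$, let $u(t^b)$ have coordinates $\max(0,\tfrac{3t_k-1}{2})$ and $m_b=\min_{k\in S_b\setminus T_b}t_k$ ($=1$ if the set is empty). Then $F^T(t)=[F_1^{T_1}(u(t^1)),F_2^{T_2}(u(t^2))]$ if all $t_k\ge\tfrac13$; $F^T(t)=[*,F_2^{T_2}(u(t^2))]^{\downarrow 3m_1}$ if $m_1\le\tfrac13$; $F^T(t)=[F_1^{T_1}(u(t^1)),*]^{\downarrow3m_2}$ if $m_2\le\tfrac13$. The canonical nullhomotopies make this descend to the smash product. **Goodwillie partition complexes.** $\mathcal T_S=S^1\wedge(S^0*|\Pi_S|)$, where $\Pi_S$ is the poset of partitions of $S$ other than the discrete and trivial ones and $S^0*-$ is unreduced suspension. Equivalently, $\mathcal T_S$ is the space of weighted rooted trees $(\Gamma,l)$ with leaf set $S$ (one root edge, internal vertices with at least two incoming edges), edges having lengths in $[0,1]$ so that the distance from root to every leaf is $1$; internal edges of length $0$ are contracted, and a tree with root or leaf edge of length zero is the basepoint. For $|S|=1$, $\mathcal T_S=S^0$; for $|S|=2$,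 $\mathcal T_2=S^1$ (length of root edge). $\Sigma_S$ acts by permuting leaves. For $S=S_1\sqcup S_2$, ungrafting $\mathcal T_S\to\mathcal T_2\wedge\mathcal T_{S_1}\wedge\mathcal T_{S_2}$ sends a grafting $([\Gamma_1,\Gamma_2],l)$ of trees with leaf sets $S_1,S_2$ and root edge $e_0$ to $(l(e_0),(\Gamma_1,l_1),(\Gamma_2,l_2))$, $l_b(e)=l(e)/(1-l(e_0))$, and all other trees to the basepoint. **Grafting bracket.** $[-,-]_{\mathrm{graft}}\colon\Omega\,\mathrm{Map}_*(\mathcal T_{S_1},Z_1)\wedge\Omega\,\mathrm{Map}_*(\mathcal T_{S_2},Z_2)\to\Omega\,\mathrm{Map}_*(\mathcal T_{S_1\sqcup S_2},Z_1\wedge Z_2)$ takes $\psi_b\colon S^1\wedge\mathcal T_{S_b}\to Z_b$ to the composite of $S^1\wedge\mathcal T_S\to S^1\wedge\mathcal T_2\wedge\mathcal T_{S_1}\wedge\mathcal T_{S_2}$ (ungrafting), $\phi\colon S^1\wedge\mathcal T_2\to S^1\wedge S^1$ and $\psi_1\wedge\psi_2$, where $\phi(\theta\wedge t)=t\wedge2\theta t$ for $\theta\in[0,\frac12]$ and $(2-2\theta)t\wedge t$ for $\theta\in[\frac12,1]$. Here $Z_b=\bigwedge_{i\in S_b}Y_i$, and $\bigwedge_{S_1}Y_i\wedge\bigwedge_{S_2}Y_i$ is identified with $\bigwedge_{\underline n}Y_i$. *)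

theory Defs
  imports "HOL-Analysis.Analysis" "HOL-Combinatorics.Permutations"
begin

section \<open>Based spaces, quotients and mapping spaces\<close>

type_synonym 'a based = "'a topology \<times> 'a"

abbreviation pts :: "'a based \<Rightarrow> 'a set" where
  "pts X \<equiv> topspace (fst X)"

definition based_space :: "'a based \<Rightarrow> bool" where
  "based_space X \<longleftrightarrow> snd X \<in> pts X"

definition based_map :: "'a based \<Rightarrow> 'b based \<Rightarrow> ('a \<Rightarrow> 'b) \<Rightarrow> bool" where
  "based_map X Y f \<longleftrightarrow> continuous_map (fst X) (fst Y) f \<and> f (snd X) = snd Y"

definition quotient_topology :: "'a topology \<Rightarrow> ('a \<Rightarrow> 'b) \<Rightarrow> 'b topology" where
  "quotient_topology X q =
     topology (\<lambda>U. U \<subseteq> q ` topspace X \<and> openin X {x \<in> topspace X. q x \<in> U})"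

lemma openin_quotient_topology:
  "openin (quotient_topology X q) U \<longleftrightarrow>
     U \<subseteq> q ` topspace X \<and> openin X {x \<in> topspace X. q x \<in> U}"
proof -
  have "istopology (\<lambda>U. U \<subseteq> q ` topspace X \<and> openin X {x \<in> topspace X. q x \<in> U})"
    unfolding istopology_def
  proof (intro conjI allI impI)
    fix \<K> assume K: "\<forall>K\<in>\<K>. K \<subseteq> q ` topspace X \<and> openin X {x \<in> topspace X. q x \<in> K}"
    have "{x \<in> topspace X. q x \<in> \<Union>\<K>} = (\<Union>K\<in>\<K>. {x \<in> topspace X. q x \<in> K})" by auto
    with K show "openin X {x \<in> topspace X. q x \<in> \<Union>\<K>}" by auto
  next
    fix S T
    assume S: "S \<subseteq> q ` topspace X \<and> openin X {x \<in> topspace X. q x \<in> S}"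
      and T: "T \<subseteq> q ` topspace X \<and> openin X {x \<in> topspace X. q x \<in> T}"
    have "{x \<in> topspace X. q x \<in> S \<inter> T} =
          {x \<in> topspace X. q x \<in> S} \<inter> {x \<in> topspace X. q x \<in> T}" by auto
    with S T show "openin X {x \<in> topspace X. q x \<in> S \<inter> T}" by (simp add: openin_Int)
  qed auto
  then show ?thesis by (simp add: quotient_topology_def topology_inverse')
qed

text \<open>
  The based space \<open>X/A\<close>: the value \<open>None\<close> is the class of \<open>A\<close>, and a point outside
  \<open>A\<close> is its own class. For empty \<open>A\<close> this is \<open>X\<close> with a disjoint basepoint.
\<close>

definition collapse_pt :: "'a set \<Rightarrow> 'a \<Rightarrow> 'a option" where
  "collapse_pt A x = (if x \<in> A then None else Some x)"

definition collapse :: "'a topology \<Rightarrow> 'a set \<Rightarrow> 'a option based" where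
  "collapse X A =
     (topology (\<lambda>U. U \<subseteq> insert None (Some ` (topspace X - A)) \<and>
                    openin X {x \<in> topspace X. collapse_pt A x \<in> U}), None)"

lemma openin_collapse:
  "openin (fst (collapse X A)) U \<longleftrightarrow>
     U \<subseteq> insert None (Some ` (topspace X - A)) \<and> openin X {x \<in> topspace X. collapse_pt A x \<in> U}"
proof -
  have "istopology (\<lambda>U. U \<subseteq> insert None (Some ` (topspace X - A)) \<and> openin X {x \<in> topspace X. collapse_pt A x \<in> U})"
    unfolding istopology_def
  proof (intro conjI allI impI)
    fix \<K> assume K: "\<forall>K\<in>\<K>. K \<subseteq> insert None (Some ` (topspace X - A)) \<and> openin X {x \<in> topspace X. collapse_pt A x \<in> K}"
    have "{x \<in> topspace X. collapse_pt A x \<in> \<Union>\<K>} = (\<Union>K\<in>\<K>. {x \<in> topspace X. collapse_pt A x \<in> K})" by auto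
    with K show "openin X {x \<in> topspace X. collapse_pt A x \<in> \<Union>\<K>}" by auto
  next
    fix S T
    assume S: "S \<subseteq> insert None (Some ` (topspace X - A)) \<and> openin X {x \<in> topspace X. collapse_pt A x \<in> S}"
      and T: "T \<subseteq> insert None (Some ` (topspace X - A)) \<and> openin X {x \<in> topspace X. collapse_pt A x \<in> T}"
    have "{x \<in> topspace X. collapse_pt A x \<in> S \<inter> T} =
          {x \<in> topspace X. collapse_pt A x \<in> S} \<inter> {x \<in> topspace X. collapse_pt A x \<in> T}" by auto
    with S T show "openin X {x \<in> topspace X. collapse_pt A x \<in> S \<inter> T}" by (simp add: openin_Int)
  qed auto
  then show ?thesis by (simp add: collapse_def topology_inverse')
qed

lemma topspace_collapse: "pts (collapse X A) = insert None (Some ` (topspace X - A))"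
proof
  show "pts (collapse X A) \<subseteq> insert None (Some ` (topspace X - A))"
    using openin_topspace[of "fst (collapse X A)"] unfolding openin_collapse by blast
  have "{x \<in> topspace X. collapse_pt A x \<in> insert None (Some ` (topspace X - A))} = topspace X"
    by (auto simp: collapse_pt_def)
  then have "openin (fst (collapse X A)) (insert None (Some ` (topspace X - A)))"
    by (simp add: openin_collapse)
  then show "insert None (Some ` (topspace X - A)) \<subseteq> pts (collapse X A)"
    by (rule openin_subset)
qed

definition disjoint_sum :: "'a topology \<Rightarrow> 'b topology \<Rightarrow> ('a + 'b) topology" where
  "disjoint_sum X Y = topology (\<lambda>U. openin X (Inl -` U) \<and> openin Y (Inr -` U))"

lemma openin_disjoint_sum:
  "openin (disjoint_sum X Y) U \<longleftrightarrow> openin X (Inl -` U) \<and> openin Y (Inr -` U)"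
proof -
  have "istopology (\<lambda>U. openin X (Inl -` U) \<and> openin Y (Inr -` U))"
    unfolding istopology_def by (auto simp: vimage_Union)
  then show ?thesis by (simp add: disjoint_sum_def topology_inverse')
qed

text \<open>Compact-open topology; maps are normalised to be \<open>undefined\<close> outside the domain.\<close>

definition map_space :: "'a topology \<Rightarrow> 'b topology \<Rightarrow> ('a \<Rightarrow> 'b) topology" where
  "map_space X Y =
     topology_generated_by
       {{f \<in> extensional (topspace X). continuous_map X Y f \<and> f ` K \<subseteq> U} | K U.
          compactin X K \<and> openin Y U}"

lemma topspace_map_space:
  "topspace (map_space X Y) = {f \<in> extensional (topspace X). continuous_map X Y f}"
proof -
  have "{f \<in> extensional (topspace X). continuous_map X Y f} \<in>
    {{f \<in> extensional (topspace X). continuous_map X Y f \<and> f ` K \<subseteq> U} | K U.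
          compactin X K \<and> openin Y U}"
    by (rule CollectI, rule exI[of _ "{}"], rule exI[of _ "{}"]) auto
  then show ?thesis unfolding map_space_def topology_generated_by_topspace by auto
qed

definition based_maps :: "'a based \<Rightarrow> 'b based \<Rightarrow> ('a \<Rightarrow> 'b) based" where
  "based_maps X Y =
     (subtopology (map_space (fst X) (fst Y)) {f. f (snd X) = snd Y}, \<lambda>x\<in>pts X. snd Y)"

abbreviation unit_interval :: "real topology" where
  "unit_interval \<equiv> top_of_set {0..1}"

definition loops :: "'a based \<Rightarrow> (real \<Rightarrow> 'a) based" where
  "loops X =
     (subtopology (map_space unit_interval (fst X)) {\<gamma>. \<gamma> 0 = snd X \<and> \<gamma> 1 = snd X},
      \<lambda>\<theta>\<in>{0..1}. snd X)"

definition loops_map :: "('a \<Rightarrow> 'b) \<Rightarrow> (real \<Rightarrow> 'a) \<Rightarrow> (real \<Rightarrow> 'b)" where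
  "loops_map f \<gamma> = (\<lambda>\<theta>\<in>{0..1}. f (\<gamma> \<theta>))"

definition bwedge :: "('i \<Rightarrow> 'a based) \<Rightarrow> 'i set \<Rightarrow> ('i \<times> 'a) option based" where
  "bwedge Y T = collapse (sum_topology (\<lambda>i. fst (Y i)) T) {(i, x). x = snd (Y i)}"

definition smash_pt :: "('i \<Rightarrow> 'a based) \<Rightarrow> 'i set \<Rightarrow> ('i \<Rightarrow> 'a) \<Rightarrow> ('i \<Rightarrow> 'a) option" where
  "smash_pt Y S = collapse_pt {f. \<exists>i\<in>S. f i = snd (Y i)}"

definition bsmash :: "('i \<Rightarrow> 'a based) \<Rightarrow> 'i set \<Rightarrow> ('i \<Rightarrow> 'a) option based" where
  "bsmash Y S =
     collapse (product_topology (\<lambda>i. fst (Y i)) S) {f. \<exists>i\<in>S. f i = snd (Y i)}"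


section \<open>The smash product as a mapping cone\<close>

text \<open>
  The reduced mapping cone of a based map \<open>f : A \<rightarrow> X\<close>: in \<open>A \<times> I\<close> the end at 1 is glued
  to \<open>X\<close> along \<open>f\<close>, while the end at 0 and the line over the basepoint go to the
  basepoint. Points of the cone are the canonical representatives chosen by \<open>cone_pt\<close>.
\<close>

fun cone_pt :: "'a based \<Rightarrow> 'b based \<Rightarrow> ('a \<Rightarrow> 'b) \<Rightarrow> 'b + 'a \<times> real \<Rightarrow> 'b + 'a \<times> real" where
  "cone_pt A X f (Inl x) = Inl x"
| "cone_pt A X f (Inr (a, s)) =
     (if s = 1 then Inl (f a)
      else if s = 0 \<or> a = snd A then Inl (snd X)
      else Inr (a, s))"

definition mapping_cone :: "'a based \<Rightarrow> 'b based \<Rightarrow> ('a \<Rightarrow> 'b) \<Rightarrow> ('b + 'a \<times> real) based" where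
  "mapping_cone A X f =
     (quotient_topology
        (disjoint_sum (fst X) (prod_topology (fst A) unit_interval)) (cone_pt A X f),
      Inl (snd X))"

definition prod2 :: "'a based \<Rightarrow> 'b based \<Rightarrow> ('a \<times> 'b) based" where
  "prod2 X Y = (prod_topology (fst X) (fst Y), (snd X, snd Y))"

text \<open>The binary wedge, as the subspace of the product that it is canonically homeomorphic to.\<close>

definition wedge2 :: "'a based \<Rightarrow> 'b based \<Rightarrow> ('a \<times> 'b) based" where
  "wedge2 X Y =
     (subtopology (prod_topology (fst X) (fst Y)) {(x, y). x = snd X \<or> y = snd Y},
      (snd X, snd Y))"

type_synonym ('a, 'b) cone_smash = "'a \<times> 'b + ('a \<times> 'b) \<times> real"

definition cone_smash :: "'a based \<Rightarrow> 'b based \<Rightarrow> ('a, 'b) cone_smash based" where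
  "cone_smash X Y = mapping_cone (wedge2 X Y) (prod2 X Y) (\<lambda>w. w)"

text \<open>
  The map out of the smash product given by a map \<open>f\<close> out of the product and a
  nullhomotopy \<open>N\<close> on the wedge, constant at time 0 and equal to \<open>f\<close> at time 1.
\<close>

definition from_cone_smash ::
  "('a \<times> 'b \<Rightarrow> 'c) \<Rightarrow> ('a \<times> 'b \<Rightarrow> real \<Rightarrow> 'c) \<Rightarrow> ('a, 'b) cone_smash \<Rightarrow> 'c" where
  "from_cone_smash f N z = (case z of Inl x \<Rightarrow> f x | Inr (w, s) \<Rightarrow> N w s)"

definition cone_smash_map ::
  "'c based \<Rightarrow> 'd based \<Rightarrow> ('a \<Rightarrow> 'c) \<Rightarrow> ('b \<Rightarrow> 'd) \<Rightarrow> ('a, 'b) cone_smash \<Rightarrow> ('c, 'd) cone_smash"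
  where
  "cone_smash_map X' Y' f g z =
     cone_pt (wedge2 X' Y') (prod2 X' Y') (\<lambda>w. w)
       (case z of
          Inl (x, y) \<Rightarrow> Inl (f x, g y)
        | Inr ((x, y), s) \<Rightarrow> Inr ((f x, g y), s))"


section \<open>Commutators of loops\<close>

definition commutator :: "(real \<Rightarrow> 'a) \<Rightarrow> (real \<Rightarrow> 'a) \<Rightarrow> real \<Rightarrow> 'a" where
  "commutator \<gamma>1 \<gamma>2 \<theta> =
     (if \<theta> \<le> 1/4 then \<gamma>1 (4 * \<theta>)
      else if \<theta> \<le> 1/2 then \<gamma>2 (4 * \<theta> - 1)
      else if \<theta> \<le> 3/4 then \<gamma>1 (3 - 4 * \<theta>)
      else \<gamma>2 (4 - 4 * \<theta>))"

text \<open>The canonical nullhomotopies of \<open>[\<gamma>1,*]\<close> and \<open>[*,\<gamma>2]\<close>, with \<open>b\<close> the basepoint.\<close>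

definition comm_null1 :: "'a \<Rightarrow> (real \<Rightarrow> 'a) \<Rightarrow> real \<Rightarrow> real \<Rightarrow> 'a" where
  "comm_null1 b \<gamma>1 t \<theta> =
     (if \<theta> \<le> 1/4 then \<gamma>1 (4 * \<theta> * t)
      else if \<theta> \<le> 1/2 then \<gamma>1 t
      else if \<theta> \<le> 3/4 then \<gamma>1 ((3 - 4 * \<theta>) * t)
      else b)"

definition comm_null2 :: "'a \<Rightarrow> (real \<Rightarrow> 'a) \<Rightarrow> real \<Rightarrow> real \<Rightarrow> 'a" where
  "comm_null2 b \<gamma>2 t \<theta> =
     (if \<theta> \<le> 1/4 then b
      else if \<theta> \<le> 1/2 then \<gamma>2 ((4 * \<theta> - 1) * t)
      else if \<theta> \<le> 3/4 then \<gamma>2 t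
      else \<gamma>2 ((4 - 4 * \<theta>) * t))"


section \<open>Total fibres of collapsing cubes\<close>

definition cube :: "'i set \<Rightarrow> ('i \<Rightarrow> real) topology" where
  "cube R = product_topology (\<lambda>_. unit_interval) R"

definition wedge_collapse :: "'i set \<Rightarrow> ('i \<times> 'a) option \<Rightarrow> ('i \<times> 'a) option" where
  "wedge_collapse T w =
     (case w of None \<Rightarrow> None | Some (i, x) \<Rightarrow> if i \<in> T then Some (i, x) else None)"

type_synonym ('i, 'a) tofib_pt = "'i set \<Rightarrow> ('i \<Rightarrow> real) \<Rightarrow> ('i \<times> 'a) option"

definition tofib :: "('i \<Rightarrow> 'a based) \<Rightarrow> 'i set \<Rightarrow> ('i, 'a) tofib_pt based" where
  "tofib Y S =
     (subtopology
        (product_topology (\<lambda>T. map_space (cube (S - T)) (fst (bwedge Y T))) (Pow S))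
        {F. (\<forall>T\<subseteq>S. \<forall>p\<in>topspace (cube (S - T)). (\<exists>k\<in>S - T. p k = 0) \<longrightarrow> F T p = None) \<and>
            (\<forall>T T'. T \<subseteq> T' \<and> T' \<subseteq> S \<longrightarrow>
               (\<forall>p\<in>topspace (cube (S - T')).
                  wedge_collapse T (F T' p) =
                  F T (\<lambda>k\<in>S - T. if k \<in> T' then 1 else p k)))},
      \<lambda>T\<in>Pow S. \<lambda>p\<in>topspace (cube (S - T)). None)"


section \<open>The external Samelson bracket\<close>

definition rescale :: "'i set \<Rightarrow> ('i \<Rightarrow> real) \<Rightarrow> ('i \<Rightarrow> real)" where
  "rescale R t = (\<lambda>k\<in>R. max 0 ((3 * t k - 1) / 2))"

definition min_coord :: "'i set \<Rightarrow> ('i \<Rightarrow> real) \<Rightarrow> real" where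
  "min_coord R t = (if R = {} then 1 else Min (t ` R))"

text \<open>
  The loop \<open>F\<^sup>T\<^sub>b(u(t\<^sup>b))\<close> in the wedge over \<open>T \<inter> S\<^sub>b\<close>, where \<open>F\<close> is a loop in the total
  fibre over \<open>S\<^sub>b = R\<close>. The inclusion of this wedge into the one over \<open>T\<close> is the identity
  on representatives, so commutators can be formed without further coercions.
\<close>

definition rescaled_loop ::
  "'i set \<Rightarrow> (real \<Rightarrow> ('i, 'a) tofib_pt) \<Rightarrow> 'i set \<Rightarrow> ('i \<Rightarrow> real) \<Rightarrow> real \<Rightarrow> ('i \<times> 'a) option"
  where
  "rescaled_loop R F T t \<theta> = F \<theta> (T \<inter> R) (rescale (R - T) t)"

definition samelson_prod ::
  "'i set \<Rightarrow> 'i set \<Rightarrow> (real \<Rightarrow> ('i, 'a) tofib_pt) \<times> (real \<Rightarrow> ('i, 'a) tofib_pt) \<Rightarrow>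
   real \<Rightarrow> ('i, 'a) tofib_pt" where
  "samelson_prod S1 S2 = (\<lambda>(F1, F2).
     \<lambda>\<theta>\<in>{0..1}. \<lambda>T\<in>Pow (S1 \<union> S2). \<lambda>t\<in>topspace (cube (S1 \<union> S2 - T)).
       (let \<gamma>1 = rescaled_loop S1 F1 T t;
            \<gamma>2 = rescaled_loop S2 F2 T t;
            m1 = min_coord (S1 - T) t;
            m2 = min_coord (S2 - T) t
        in if \<forall>k\<in>S1 \<union> S2 - T. t k \<ge> 1/3 then commutator \<gamma>1 \<gamma>2 \<theta>
           else if m1 \<le> 1/3 then comm_null2 None \<gamma>2 (3 * m1) \<theta>
           else comm_null1 None \<gamma>1 (3 * m2) \<theta>))"

text \<open>
  The canonical nullhomotopy of \<open>samelson_prod\<close> on the wedge: at time \<open>s\<close> the parameter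
  of the nullhomotopy of the commutator is scaled by \<open>s\<close>.
\<close>

definition samelson_null ::
  "('i \<Rightarrow> 'a based) \<Rightarrow> 'i set \<Rightarrow> 'i set \<Rightarrow>
   (real \<Rightarrow> ('i, 'a) tofib_pt) \<times> (real \<Rightarrow> ('i, 'a) tofib_pt) \<Rightarrow> real \<Rightarrow>
   real \<Rightarrow> ('i, 'a) tofib_pt" where
  "samelson_null Y S1 S2 = (\<lambda>(F1, F2) s.
     \<lambda>\<theta>\<in>{0..1}. \<lambda>T\<in>Pow (S1 \<union> S2). \<lambda>t\<in>topspace (cube (S1 \<union> S2 - T)).
       if F2 = snd (loops (tofib Y S2))
       then comm_null1 None (rescaled_loop S1 F1 T t)
              (s * min 1 (3 * min_coord (S2 - T) t)) \<theta>
       else comm_null2 None (rescaled_loop S2 F2 T t)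
              (s * min 1 (3 * min_coord (S1 - T) t)) \<theta>)"

definition samelson_ext ::
  "('i \<Rightarrow> 'a based) \<Rightarrow> 'i set \<Rightarrow> 'i set \<Rightarrow>
   (real \<Rightarrow> ('i, 'a) tofib_pt, real \<Rightarrow> ('i, 'a) tofib_pt) cone_smash \<Rightarrow>
   real \<Rightarrow> ('i, 'a) tofib_pt" where
  "samelson_ext Y S1 S2 = from_cone_smash (samelson_prod S1 S2) (samelson_null Y S1 S2)"


section \<open>Spaces of weighted trees\<close>

text \<open>
  Each edge of a rooted tree with leaf set \<open>S\<close> is encoded by the set of leaves whose path
  to the root uses it: \<open>S\<close> is the root edge, the singletons are the leaf edges (for one
  leaf they coincide). Since every internal vertex has at least two incoming edges,
  distinct edges have distinct leaf sets, and the trees are exactly the laminar families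
  of nonempty subsets that contain \<open>S\<close> and all singletons.
\<close>

definition rooted_tree :: "'i set \<Rightarrow> 'i set set \<Rightarrow> bool" where
  "rooted_tree S E \<longleftrightarrow>
     E \<subseteq> Pow S - {{}} \<and> S \<in> E \<and> (\<forall>i\<in>S. {i} \<in> E) \<and>
     (\<forall>A\<in>E. \<forall>B\<in>E. A \<subseteq> B \<or> B \<subseteq> A \<or> A \<inter> B = {})"

text \<open>
  A weighted tree is recorded by its edge lengths, extended by 0 to all sets that are not
  edges. This identifies precisely the trees that agree after contraction of the internal
  edges of length 0.
\<close>

definition weighted_tree :: "'i set \<Rightarrow> 'i set set \<Rightarrow> ('i set \<Rightarrow> real) \<Rightarrow> bool" where
  "weighted_tree S E l \<longleftrightarrow>
     rooted_tree S E \<and> (\<forall>A. A \<notin> E \<longrightarrow> l A = 0) \<and> (\<forall>A\<in>E. l A \<in> {0..1}) \<and>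
     (\<forall>i\<in>S. (\<Sum>A | A \<in> E \<and> i \<in> A. l A) = 1)"

definition degenerate :: "'i set \<Rightarrow> ('i set \<Rightarrow> real) \<Rightarrow> bool" where
  "degenerate S l \<longleftrightarrow> l S = 0 \<or> (\<exists>i\<in>S. l {i} = 0)"

type_synonym 'i tree_pt = "('i set \<Rightarrow> real) option"

definition tree_class :: "'i set \<Rightarrow> ('i set \<Rightarrow> real) \<Rightarrow> 'i tree_pt" where
  "tree_class S = collapse_pt {l. degenerate S l}"

definition tree_space :: "'i set \<Rightarrow> 'i tree_pt based" where
  "tree_space S = collapse (top_of_set {l. \<exists>E. weighted_tree S E l}) {l. degenerate S l}"

text \<open>
  The path from the root to the vertex at which the paths from \<open>i\<close> and \<open>h\<close> meet consists
  of the edges that lie on both of these paths.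
\<close>

definition meet_dist :: "'i set \<Rightarrow> ('i set \<Rightarrow> real) \<Rightarrow> 'i \<Rightarrow> 'i \<Rightarrow> real" where
  "meet_dist S l i h = (\<Sum>A | A \<subseteq> S \<and> i \<in> A \<and> h \<in> A. l A)"


section \<open>The grafting bracket\<close>

text \<open>
  A tree is a grafting of trees with leaf sets \<open>S1\<close> and \<open>S2\<close> iff \<open>S1\<close> and \<open>S2\<close> are edges;
  they become the root edges of the two trees.
\<close>

definition grafting :: "'i set \<Rightarrow> 'i set \<Rightarrow> ('i set \<Rightarrow> real) \<Rightarrow> bool" where
  "grafting S1 S2 l \<longleftrightarrow> (\<exists>E. weighted_tree (S1 \<union> S2) E l \<and> S1 \<in> E \<and> S2 \<in> E)"

definition branch :: "'i set \<Rightarrow> 'i set \<Rightarrow> ('i set \<Rightarrow> real) \<Rightarrow> ('i set \<Rightarrow> real)" where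
  "branch S R l = (\<lambda>A. if A \<subseteq> R then l A / (1 - l S) else 0)"

text \<open>
  Points of the circle are represented by numbers in the unit interval, with 0 and 1 the
  basepoint; this includes the tree space on two leaves, via the length of the root edge.
\<close>

definition ungraft :: "'i set \<Rightarrow> 'i set \<Rightarrow> 'i tree_pt \<Rightarrow> (real \<times> 'i tree_pt \<times> 'i tree_pt) option"
  where
  "ungraft S1 S2 \<tau> =
     (case \<tau> of
        None \<Rightarrow> None
      | Some l \<Rightarrow>
          if grafting S1 S2 l
          then collapse_pt {(r, \<tau>1, \<tau>2). r = 0 \<or> r = 1 \<or> \<tau>1 = None \<or> \<tau>2 = None}
                 (l (S1 \<union> S2),
                  tree_class S1 (branch (S1 \<union> S2) S1 l),
                  tree_class S2 (branch (S1 \<union> S2) S2 l))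
          else None)"

definition phi :: "real \<Rightarrow> real \<Rightarrow> real \<times> real" where
  "phi \<theta> t = (if \<theta> \<le> 1/2 then (t, 2 * \<theta> * t) else ((2 - 2 * \<theta>) * t, t))"

definition graft_prod ::
  "'z based \<Rightarrow> 'w based \<Rightarrow> 'i set \<Rightarrow> 'i set \<Rightarrow>
   (real \<Rightarrow> 'i tree_pt \<Rightarrow> 'z) \<times> (real \<Rightarrow> 'i tree_pt \<Rightarrow> 'w) \<Rightarrow>
   real \<Rightarrow> 'i tree_pt \<Rightarrow> ('z \<times> 'w) option" where
  "graft_prod Z1 Z2 S1 S2 = (\<lambda>(\<psi>1, \<psi>2).
     \<lambda>\<theta>\<in>{0..1}. \<lambda>\<tau>\<in>pts (tree_space (S1 \<union> S2)).
       (case ungraft S1 S2 \<tau> of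
          None \<Rightarrow> None
        | Some (r, \<tau>1, \<tau>2) \<Rightarrow>
            (let (\<theta>1, \<theta>2) = phi \<theta> r
             in collapse_pt {(z, w). z = snd Z1 \<or> w = snd Z2} (\<psi>1 \<theta>1 \<tau>1, \<psi>2 \<theta>2 \<tau>2))))"

text \<open>
  On the wedge \<open>graft_prod\<close> is constantly the basepoint, and it is extended over the cone
  by the constant nullhomotopy.
\<close>

definition graft_bracket ::
  "'z based \<Rightarrow> 'w based \<Rightarrow> 'i set \<Rightarrow> 'i set \<Rightarrow>
   (real \<Rightarrow> 'i tree_pt \<Rightarrow> 'z, real \<Rightarrow> 'i tree_pt \<Rightarrow> 'w) cone_smash \<Rightarrow>
   real \<Rightarrow> 'i tree_pt \<Rightarrow> ('z \<times> 'w) option" where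
  "graft_bracket Z1 Z2 S1 S2 =
     from_cone_smash (graft_prod Z1 Z2 S1 S2)
       (\<lambda>_ _. \<lambda>\<theta>\<in>{0..1}. \<lambda>\<tau>\<in>pts (tree_space (S1 \<union> S2)). None)"

text \<open>The identification of the smash of the smash products over \<open>S1\<close> and \<open>S2\<close> with the
  smash product over the union, and its effect on loops of maps.\<close>

definition smash_join ::
  "'i set \<Rightarrow> 'i set \<Rightarrow> (('i \<Rightarrow> 'a) option \<times> ('i \<Rightarrow> 'a) option) option \<Rightarrow> ('i \<Rightarrow> 'a) option" where
  "smash_join S1 S2 z =
     (case z of
        Some (Some f, Some g) \<Rightarrow> Some (\<lambda>i\<in>S1 \<union> S2. if i \<in> S1 then f i else g i)
      | _ \<Rightarrow> None)"

definition join_loops ::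
  "'i set \<Rightarrow> 'i set \<Rightarrow>
   (real \<Rightarrow> 'i tree_pt \<Rightarrow> (('i \<Rightarrow> 'a) option \<times> ('i \<Rightarrow> 'a) option) option) \<Rightarrow>
   real \<Rightarrow> 'i tree_pt \<Rightarrow> ('i \<Rightarrow> 'a) option" where
  "join_loops S1 S2 =
     loops_map (\<lambda>\<psi>. \<lambda>\<tau>\<in>pts (tree_space (S1 \<union> S2)). smash_join S1 S2 (\<psi> \<tau>))"


section \<open>The map from the total fibre\<close>

text \<open>The identification of the wedge of the single space \<open>Y i\<close> with \<open>Y i\<close>.\<close>

definition wedge_single :: "('i \<Rightarrow> 'a based) \<Rightarrow> 'i \<Rightarrow> ('i \<times> 'a) option \<Rightarrow> 'a" where
  "wedge_single Y i w = (case w of None \<Rightarrow> snd (Y i) | Some (j, x) \<Rightarrow> x)"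

definition J_formula ::
  "('i \<Rightarrow> 'a based) \<Rightarrow> 'i set \<Rightarrow> ('i, 'a) tofib_pt \<Rightarrow> ('i set \<Rightarrow> real) \<Rightarrow> ('i \<Rightarrow> 'a) option" where
  "J_formula Y S F l =
     smash_pt Y S (\<lambda>i\<in>S. wedge_single Y i (F {i} (\<lambda>h\<in>S - {i}. meet_dist S l i h)))"

definition J ::
  "('i \<Rightarrow> 'a based) \<Rightarrow> 'i set \<Rightarrow> ('i, 'a) tofib_pt \<Rightarrow> 'i tree_pt \<Rightarrow> ('i \<Rightarrow> 'a) option" where
  "J Y S F = (\<lambda>\<tau>\<in>pts (tree_space S). case \<tau> of None \<Rightarrow> None | Some l \<Rightarrow> J_formula Y S F l)"


section \<open>Action of permutations\<close>

definition perm_family :: "('i \<Rightarrow> 'i) \<Rightarrow> ('i \<Rightarrow> 'a based) \<Rightarrow> ('i \<Rightarrow> 'a based)" where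
  "perm_family \<sigma> Y = (\<lambda>i. Y (inv \<sigma> i))"

definition perm_tofib ::
  "('i \<Rightarrow> 'i) \<Rightarrow> 'i set \<Rightarrow> ('i, 'a) tofib_pt \<Rightarrow> ('i, 'a) tofib_pt" where
  "perm_tofib \<sigma> S F =
     (\<lambda>T\<in>Pow S. \<lambda>p\<in>topspace (cube (S - T)).
        map_option (\<lambda>(i, x). (\<sigma> i, x)) (F (\<sigma> -` T) (\<lambda>k\<in>S - \<sigma> -` T. p (\<sigma> k))))"

definition perm_tree :: "('i \<Rightarrow> 'i) \<Rightarrow> 'i tree_pt \<Rightarrow> 'i tree_pt" where
  "perm_tree \<sigma> = map_option (\<lambda>l A. l (\<sigma> -` A))"

definition perm_smash :: "('i \<Rightarrow> 'i) \<Rightarrow> ('i \<Rightarrow> 'a) option \<Rightarrow> ('i \<Rightarrow> 'a) option" where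
  "perm_smash \<sigma> = map_option (\<lambda>f. f \<circ> inv \<sigma>)"

end

theory Submission
  imports Defs
begin

text \<open>
  The value of \<open>J(F)\<close> at a tree depends only on the matrix \<open>T\<close> of meeting distances. This matrix is
  symmetric, has entries in \<open>[0, 1]\<close>, and satisfies \<open>min (T i h) (T h k) \<le> T i k\<close>, because the edges
  through \<open>h\<close> form a chain (\<open>meet_dist_ultrametric\<close>).

  \<^emph>\<open>The map \<open>J\<close>.\<close> A tree whose root edge has length 0 has two leaves with \<open>T i h = 0\<close>, and the
  \<open>i\<close>-th coordinate is then the basepoint, since \<open>F\<close> is trivial on points with a vanishing coordinate. A tree with a leaf
  edge of length 0 has two leaves with \<open>T i h = 1\<close>; these are equally far from every third leaf, so
  the coordinates at \<open>i\<close> and \<open>h\<close> are the two projections of a single point of the wedge of \<open>Y i\<close> and \<open>Y h\<close>, and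
  one of them is the basepoint. So \<open>J(F)\<close> is trivial on degenerate trees
  (\<open>J_formula_degenerate\<close>). Joint continuity in \<open>F\<close> and the tree holds because evaluation on a
  compact Hausdorff cube is continuous, and it passes to the quotient by the compact set of degenerate trees by a tube
  argument (\<open>continuous_map_prod_collapse\<close>).

  \<^emph>\<open>The homotopy.\<close> At a leaf \<open>i \<in> S1\<close> the factor \<open>F2\<close> enters the Samelson bracket only through the
  wedge over the empty set, which is a point. The commutator therefore reduces to \<open>F1\<close> alone: the coordinate at \<open>i\<close> is
  \<open>F1\<close>, evaluated at the rescaled distances \<open>max 0 ((3 T i h - 1) / 2)\<close> and at the loop time
  \<open>c * f(\<theta>)\<close>, where \<open>c = min 1 (3 * min T i h)\<close> with the minimum over \<open>h \<in> S2\<close>; at leaves of \<open>S2\<close> the loop time is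
  \<open>c * g(\<theta>)\<close>, and \<open>(f, g)\<close> runs once around the boundary of the unit square. The grafting bracket
  has the same shape: on a grafting with root edge of length \<open>r\<close> the distances are
  \<open>(T i h - r) / (1 - r)\<close>, the square has side \<open>r\<close>, and only the two sides of it away from the axes are traversed. On the
  other two sides one loop is at time 0 and the result is trivial.

  Let \<open>\<rho>\<close> be the greatest distance \<open>T i h\<close> with \<open>i \<in> S1\<close>, \<open>h \<in> S2\<close>, which is \<open>r\<close> on graftings. The
  homotopy \<open>interp\<close> uses, at time \<open>s\<close>, the square of side \<open>min 1 ((1 + 2 s) \<rho>)\<close> and the distances
  \<open>max 0 ((T i h - a) / (1 - a))\<close> with \<open>a = max \<rho> (s / 3)\<close>, and stretches the angle so that the two trivial sides
  are gradually swept in. This formula is given on all trees, graftings or not. It is trivial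
  unless every distance inside \<open>S1\<close> and inside \<open>S2\<close> exceeds \<open>\<rho>\<close>; off the graftings some such distance is at
  most \<open>\<rho>\<close> (\<open>not_grafting_meet_dist\<close>), as the grafting bracket at \<open>s = 0\<close> requires
  (\<open>interp_graft\<close>). If every such distance does exceed \<open>\<rho>\<close>, the ultrametric inequality makes all distances
  between \<open>S1\<close> and \<open>S2\<close> equal to \<open>\<rho>\<close>, which gives the Samelson bracket at \<open>s = 1\<close>
  (\<open>interp_samelson\<close>). The quotient \<open>(T i h - a) / (1 - a)\<close> need not extend continuously to \<open>\<rho> = 1\<close>, but there
  the square has side 1 and one of the two loops is at an end, whatever the distances are; by
  compactness of the cube of possible distances, \<open>interp\<close> is still continuous
  (\<open>continuous_map_blow_down\<close>). Over the cone on the wedge both maps are constant, and so is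
  the homotopy.
\<close>

section \<open>Mapping spaces and quotients by closed sets\<close>

text \<open>
  Continuity at each point, in the form in which tube arguments deliver it.
\<close>

lemma continuous_map_locallyI:
  assumes "\<And>x. x \<in> topspace X \<Longrightarrow> f x \<in> topspace Y"
    and "\<And>x U. x \<in> topspace X \<Longrightarrow> openin Y U \<Longrightarrow> f x \<in> U \<Longrightarrow>
           \<exists>V. openin X V \<and> x \<in> V \<and> f ` V \<subseteq> U"
  shows "continuous_map X Y f"
  unfolding continuous_map_def
proof (intro conjI allI impI)
  show "f \<in> topspace X \<rightarrow> topspace Y" using assms(1) by blast
next
  fix U assume U: "openin Y U"
  show "openin X {x \<in> topspace X. f x \<in> U}"
  proof (subst openin_subopen, intro ballI)
    fix x assume "x \<in> {x \<in> topspace X. f x \<in> U}"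
    then obtain V where "openin X V" "x \<in> V" "f ` V \<subseteq> U" using assms(2) U by blast
    then show "\<exists>V. openin X V \<and> x \<in> V \<and> V \<subseteq> {x \<in> topspace X. f x \<in> U}"
      using openin_subset by blast
  qed
qed

text \<open>
  One half of the exponential law. A compact \<open>K\<close> that \<open>f z\<close> sends into \<open>U\<close> is sent into \<open>U\<close> by all nearby
  \<open>f z'\<close>, by the tube lemma.
\<close>

lemma continuous_map_curry:
  assumes "continuous_map (prod_topology Z X) Y (\<lambda>(z, x). f z x)"
  shows "continuous_map Z (map_space X Y) (\<lambda>z. restrict (f z) (topspace X))"
proof -
  have cont: "continuous_map X Y (restrict (f z) (topspace X))" if "z \<in> topspace Z" for z
  proof -
    have "continuous_map X (prod_topology Z X) (\<lambda>x. (z, x))"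
      using that by (simp add: continuous_map_pairedI)
    from continuous_map_compose[OF this assms] have "continuous_map X Y (f z)"
      by (simp add: o_def)
    then show ?thesis by (rule continuous_map_eq) simp
  qed
  have sub: "openin Z ((\<lambda>z. restrict (f z) (topspace X)) -`
      {g \<in> extensional (topspace X). continuous_map X Y g \<and> g ` K \<subseteq> U} \<inter> topspace Z)"
    if K: "compactin X K" and U: "openin Y U" for K U
  proof (subst openin_subopen, intro ballI)
    fix z assume z: "z \<in> (\<lambda>z. restrict (f z) (topspace X)) -`
      {g \<in> extensional (topspace X). continuous_map X Y g \<and> g ` K \<subseteq> U} \<inter> topspace Z"
    have KX: "K \<subseteq> topspace X" using K compactin_subset_topspace by blast
    define W where "W = {p \<in> topspace (prod_topology Z X). (case p of (z, x) \<Rightarrow> f z x) \<in> U}"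
    have W: "openin (prod_topology Z X) W"
      using assms U unfolding W_def continuous_map_def by blast
    have "f z x \<in> U" if "x \<in> K" for x
    proof -
      have "restrict (f z) (topspace X) x \<in> U" using z that by blast
      then show ?thesis using that KX by (auto simp: subset_iff)
    qed
    moreover have zZ: "z \<in> topspace Z" using z by blast
    ultimately have "{z} \<times> K \<subseteq> W" using KX by (auto simp: W_def)
    then obtain A B where AB: "openin Z A" "openin X B" "z \<in> A" "K \<subseteq> B" "A \<times> B \<subseteq> W"
      using tube_lemma_right[OF W K zZ] by meson
    have AZ: "A \<subseteq> topspace Z" using AB openin_subset by blast
    have "restrict (f z') (topspace X) ` K \<subseteq> U" if "z' \<in> A" for z'
      using that AB KX by (force simp: W_def)
    then show "\<exists>T. openin Z T \<and> z \<in> T \<and> T \<subseteq> (\<lambda>z. restrict (f z) (topspace X)) -`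
      {g \<in> extensional (topspace X). continuous_map X Y g \<and> g ` K \<subseteq> U} \<inter> topspace Z"
      using AB AZ cont by (intro exI[of _ A]) auto
  qed
  have "(\<lambda>z. restrict (f z) (topspace X)) ` topspace Z \<subseteq> topspace (map_space X Y)"
    using cont by (auto simp: topspace_map_space)
  then show ?thesis
    using sub unfolding map_space_def topology_generated_by_topspace
    by (intro continuous_on_generated_topo) auto
qed

text \<open>
  The other half of the exponential law: \<open>x\<close> has a compact neighbourhood \<open>C\<close> with \<open>f ` C \<subseteq> U\<close>, and all maps \<open>g\<close> with
  \<open>g ` C \<subseteq> U\<close> form an open set.
\<close>

lemma continuous_map_eval:
  assumes "compact_space X" "Hausdorff_space X"
  shows "continuous_map (prod_topology (map_space X Y) X) Y (\<lambda>(f, x). f x)"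
proof (rule continuous_map_locallyI)
  fix p assume "p \<in> topspace (prod_topology (map_space X Y) X)"
  then show "(case p of (f, x) \<Rightarrow> f x) \<in> topspace Y"
    by (auto simp: topspace_map_space continuous_map_def)
next
  fix p U assume p: "p \<in> topspace (prod_topology (map_space X Y) X)"
    and U: "openin Y U" and pU: "(case p of (f, x) \<Rightarrow> f x) \<in> U"
  obtain f x where fx: "p = (f, x)" by force
  have f: "continuous_map X Y f" "f \<in> extensional (topspace X)" and x: "x \<in> topspace X"
    using p by (auto simp: fx topspace_map_space)
  have "locally_compact_space X \<and> regular_space X"
    using assms compact_Hausdorff_imp_regular_space compact_imp_locally_compact_space by blast
  then have nb: "neighbourhood_base_of (\<lambda>C. compactin X C \<and> closedin X C) X"
    using locally_compact_regular_space_neighbourhood_base by blast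
  have "openin X {x \<in> topspace X. f x \<in> U}" using f U unfolding continuous_map_def by blast
  then obtain V C where V: "openin X V" "x \<in> V" "V \<subseteq> C" "compactin X C" "C \<subseteq> {x \<in> topspace X. f x \<in> U}"
    using nb x pU unfolding neighbourhood_base_of fx by (smt (verit) case_prod_conv mem_Collect_eq)
  define N where "N = {g \<in> extensional (topspace X). continuous_map X Y g \<and> g ` C \<subseteq> U}"
  have "openin (map_space X Y) N"
    unfolding map_space_def N_def by (rule topology_generated_by_Basis) (use V U in blast)
  then have "openin (prod_topology (map_space X Y) X) (N \<times> V)"
    using V by (simp add: openin_prod_Times_iff)
  moreover have "p \<in> N \<times> V" using V f by (auto simp: fx N_def)
  moreover have "(\<lambda>(f, x). f x) ` (N \<times> V) \<subseteq> U" using V by (auto simp: N_def)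
  ultimately show "\<exists>V. openin (prod_topology (map_space X Y) X) V \<and> p \<in> V \<and> (\<lambda>(f, x). f x) ` V \<subseteq> U"
    by blast
qed

lemma compact_Hausdorff_unit_interval: "compact_space unit_interval" "Hausdorff_space unit_interval"
  by (auto simp: compact_space_subtopology Hausdorff_space_subtopology)

lemma compact_Hausdorff_cube: "compact_space (cube R)" "Hausdorff_space (cube R)"
  unfolding cube_def
  by (auto simp: compact_space_product_topology Hausdorff_space_product_topology
      compact_Hausdorff_unit_interval)

lemma topspace_cube: "topspace (cube R) = R \<rightarrow>\<^sub>E {0..1}"
  by (simp add: cube_def)

lemma continuous_map_collapse_pt: "continuous_map X (fst (collapse X A)) (collapse_pt A)"
  unfolding continuous_map_def topspace_collapse
  by (auto simp: openin_collapse collapse_pt_def)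

text \<open>
  The product of a quotient map with an identity need not be a quotient map. For the collapse of a compact closed set
  \<open>A\<close> it is: a neighbourhood of \<open>{w} \<times> A\<close> contains a tube \<open>V \<times> N\<close> with \<open>A \<subseteq> N\<close>, whose image
  is a neighbourhood of the collapsed point. This covers empty \<open>A\<close>, where that point is isolated.
\<close>

lemma continuous_map_prod_collapse:
  assumes f: "continuous_map (prod_topology W X) Z (\<lambda>(w, x). f w x)"
    and A: "compactin X (topspace X \<inter> A)" "closedin X (topspace X \<inter> A)"
    and z0: "z0 \<in> topspace Z" and fA: "\<And>w x. w \<in> topspace W \<Longrightarrow> x \<in> topspace X \<Longrightarrow> x \<in> A \<Longrightarrow> f w x = z0"
  shows "continuous_map (prod_topology W (fst (collapse X A))) Z
           (\<lambda>(w, \<tau>). case \<tau> of None \<Rightarrow> z0 | Some x \<Rightarrow> f w x)"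
    (is "continuous_map _ _ ?g")
proof (rule continuous_map_locallyI)
  fix p assume "p \<in> topspace (prod_topology W (fst (collapse X A)))"
  then show "?g p \<in> topspace Z"
    using f z0 by (force simp: topspace_collapse continuous_map_def Pi_iff)
next
  fix p U assume p: "p \<in> topspace (prod_topology W (fst (collapse X A)))" and U: "openin Z U" and pU: "?g p \<in> U"
  obtain w \<tau> where w\<tau>: "p = (w, \<tau>)" by force
  have w: "w \<in> topspace W" and \<tau>: "\<tau> \<in> pts (collapse X A)" using p by (auto simp: w\<tau>)
  define P where "P = {p \<in> topspace (prod_topology W X). (case p of (w, x) \<Rightarrow> f w x) \<in> U}"
  have P: "openin (prod_topology W X) P" using f U unfolding P_def continuous_map_def by blast
  have preim: "{x \<in> topspace X. collapse_pt A x \<in> Some ` (N - A)} = N - (topspace X \<inter> A)"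
    "{x \<in> topspace X. collapse_pt A x \<in> insert None (Some ` (N - A))} = N \<union> (topspace X \<inter> A)"
    if "N \<subseteq> topspace X" for N
    using that by (auto simp: collapse_pt_def)
  show "\<exists>V. openin (prod_topology W (fst (collapse X A))) V \<and> p \<in> V \<and> ?g ` V \<subseteq> U"
  proof (cases \<tau>)
    case (Some x)
    then have x: "x \<in> topspace X" "x \<notin> A" using \<tau> by (auto simp: topspace_collapse)
    have "(w, x) \<in> P" using pU w x by (simp add: P_def w\<tau> Some)
    then obtain V N where VN: "openin W V" "openin X N" "w \<in> V" "x \<in> N" "V \<times> N \<subseteq> P"
      using P unfolding openin_prod_topology_alt by meson
    have NX: "N \<subseteq> topspace X" using VN openin_subset by blast
    have "openin (fst (collapse X A)) (Some ` (N - A))"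
      unfolding openin_collapse preim[OF NX] using VN NX A(2) by (auto intro: openin_diff)
    then have "openin (prod_topology W (fst (collapse X A))) (V \<times> Some ` (N - A))"
      using VN by (simp add: openin_prod_Times_iff)
    moreover have "?g ` (V \<times> Some ` (N - A)) \<subseteq> U" using VN by (auto simp: P_def)
    ultimately show ?thesis using VN x by (intro exI[of _ "V \<times> Some ` (N - A)"]) (auto simp: w\<tau> Some)
  next
    case None
    have "z0 \<in> U" using pU by (simp add: w\<tau> None)
    then have "{w} \<times> (topspace X \<inter> A) \<subseteq> P" using w fA by (auto simp: P_def)
    then obtain V N where VN: "openin W V" "openin X N" "w \<in> V" "topspace X \<inter> A \<subseteq> N" "V \<times> N \<subseteq> P"
      using tube_lemma_right[OF P A(1) w] by blast
    have NX: "N \<subseteq> topspace X" using VN openin_subset by blast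
    have "N \<union> (topspace X \<inter> A) = N" using VN by blast
    then have "openin (fst (collapse X A)) (insert None (Some ` (N - A)))"
      unfolding openin_collapse preim[OF NX] using VN NX by auto
    then have "openin (prod_topology W (fst (collapse X A))) (V \<times> insert None (Some ` (N - A)))"
      using VN by (simp add: openin_prod_Times_iff)
    moreover have "?g ` (V \<times> insert None (Some ` (N - A))) \<subseteq> U" using VN \<open>z0 \<in> U\<close> by (auto simp: P_def)
    ultimately show ?thesis using VN by (intro exI[of _ "V \<times> insert None (Some ` (N - A))"]) (auto simp: w\<tau> None)
  qed
qed

text \<open>
  The function \<open>p\<close> may be discontinuous at points where \<open>\<Phi> x\<close> is constant: if \<open>\<Phi> x\<close> sends
  all of the compact space \<open>P\<close> into \<open>U\<close>, then so does \<open>\<Phi> x'\<close> for nearby \<open>x'\<close>, whatever point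
  of \<open>P\<close> is chosen by \<open>p x'\<close>.
\<close>

lemma continuous_map_blow_down:
  assumes \<Phi>: "continuous_map (prod_topology X P) Z (\<lambda>(x, y). \<Phi> x y)"
    and P: "compact_space P"
    and D: "openin X D" and p: "continuous_map (subtopology X D) P p"
    and pP: "\<And>x. x \<in> topspace X \<Longrightarrow> p x \<in> topspace P"
    and const: "\<And>x y. x \<in> topspace X \<Longrightarrow> x \<notin> D \<Longrightarrow> y \<in> topspace P \<Longrightarrow> \<Phi> x y = \<Phi> x (p x)"
  shows "continuous_map X Z (\<lambda>x. \<Phi> x (p x))"
proof (rule continuous_map_locallyI)
  fix x assume "x \<in> topspace X"
  then show "\<Phi> x (p x) \<in> topspace Z"
    using \<Phi> pP by (force simp: continuous_map_def Pi_iff)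
next
  fix x U assume x: "x \<in> topspace X" and U: "openin Z U" and xU: "\<Phi> x (p x) \<in> U"
  define W where "W = {q \<in> topspace (prod_topology X P). (case q of (x, y) \<Rightarrow> \<Phi> x y) \<in> U}"
  have W: "openin (prod_topology X P) W" using \<Phi> U unfolding W_def continuous_map_def by blast
  show "\<exists>V. openin X V \<and> x \<in> V \<and> (\<lambda>x. \<Phi> x (p x)) ` V \<subseteq> U"
  proof (cases "x \<in> D")
    case True
    have "(x, p x) \<in> W" using x xU pP by (simp add: W_def)
    then obtain A B where AB: "openin X A" "openin P B" "x \<in> A" "p x \<in> B" "A \<times> B \<subseteq> W"
      using W unfolding openin_prod_topology_alt by meson
    define V where "V = {x \<in> topspace (subtopology X D). p x \<in> B}"
    have "openin (subtopology X D) V" using p AB unfolding V_def continuous_map_def by blast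
    then have "openin X V" using D by (simp add: openin_open_subtopology)
    then have "openin X (A \<inter> V)" using AB by blast
    moreover have "(\<lambda>x. \<Phi> x (p x)) ` (A \<inter> V) \<subseteq> U" using AB by (auto simp: V_def W_def)
    ultimately show ?thesis using AB x True by (intro exI[of _ "A \<inter> V"]) (auto simp: V_def)
  next
    case False
    have "{x} \<times> topspace P \<subseteq> W" using x xU const[OF x False] by (auto simp: W_def)
    then obtain A B where AB: "openin X A" "x \<in> A" "topspace P \<subseteq> B" "A \<times> B \<subseteq> W"
      using tube_lemma_right[OF W P[unfolded compact_space_def] x] by meson
    have "\<Phi> y (p y) \<in> U" if "y \<in> A" for y
    proof -
      have "(y, p y) \<in> W" using that AB pP openin_subset[OF AB(1)] by blast
      then show ?thesis by (simp add: W_def)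
    qed
    then have "(\<lambda>x. \<Phi> x (p x)) ` A \<subseteq> U" by blast
    then show ?thesis using AB by blast
  qed
qed

lemma topspace_disjoint_sum: "topspace (disjoint_sum X Y) = topspace X <+> topspace Y"
proof
  have "Inl -` topspace (disjoint_sum X Y) \<subseteq> topspace X"
    "Inr -` topspace (disjoint_sum X Y) \<subseteq> topspace Y"
    using openin_topspace[of "disjoint_sum X Y"] unfolding openin_disjoint_sum
    by (auto dest: openin_subset)
  then show "topspace (disjoint_sum X Y) \<subseteq> topspace X <+> topspace Y"
  proof (intro subsetI)
    fix z assume "z \<in> topspace (disjoint_sum X Y)"
    with \<open>Inl -` _ \<subseteq> _\<close> \<open>Inr -` _ \<subseteq> _\<close> show "z \<in> topspace X <+> topspace Y"
      by (cases z) auto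
  qed
  have "Inl -` (topspace X <+> topspace Y) = topspace X" "Inr -` (topspace X <+> topspace Y) = topspace Y"
    by auto
  then have "openin (disjoint_sum X Y) (topspace X <+> topspace Y)"
    unfolding openin_disjoint_sum by simp
  then show "topspace X <+> topspace Y \<subseteq> topspace (disjoint_sum X Y)" by (rule openin_subset)
qed

lemma continuous_map_disjoint_sum:
  "continuous_map (disjoint_sum X Y) Z g \<longleftrightarrow>
     continuous_map X Z (\<lambda>x. g (Inl x)) \<and> continuous_map Y Z (\<lambda>y. g (Inr y))"
proof -
  have v: "Inl -` {x \<in> topspace X <+> topspace Y. g x \<in> U} = {x \<in> topspace X. g (Inl x) \<in> U}"
    "Inr -` {x \<in> topspace X <+> topspace Y. g x \<in> U} = {y \<in> topspace Y. g (Inr y) \<in> U}" for U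
    by auto
  have "g \<in> topspace X <+> topspace Y \<rightarrow> topspace Z \<longleftrightarrow>
      (\<lambda>x. g (Inl x)) \<in> topspace X \<rightarrow> topspace Z \<and> (\<lambda>y. g (Inr y)) \<in> topspace Y \<rightarrow> topspace Z"
    (is "?l \<longleftrightarrow> ?r")
  proof
    assume ?l then show ?r by (auto simp: Pi_iff)
  next
    assume r: ?r
    show ?l
    proof
      fix z assume "z \<in> topspace X <+> topspace Y"
      then show "g z \<in> topspace Z" using r by (cases z) (auto simp: Pi_iff)
    qed
  qed
  note Pi = this
  show ?thesis
    unfolding continuous_map_def openin_disjoint_sum topspace_disjoint_sum v Pi
    by (simp only: imp_conjR all_conj_distrib conj_ac)
qed

lemma topspace_quotient_topology: "topspace (quotient_topology X q) = q ` topspace X"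
proof
  show "topspace (quotient_topology X q) \<subseteq> q ` topspace X"
    using openin_topspace[of "quotient_topology X q"] unfolding openin_quotient_topology by blast
  have "{x \<in> topspace X. q x \<in> q ` topspace X} = topspace X" by auto
  then have "openin (quotient_topology X q) (q ` topspace X)" by (simp add: openin_quotient_topology)
  then show "q ` topspace X \<subseteq> topspace (quotient_topology X q)" by (rule openin_subset)
qed

lemma continuous_map_quotient_topology:
  "continuous_map (quotient_topology X q) Z g \<longleftrightarrow> continuous_map X Z (\<lambda>x. g (q x))"
proof -
  have "{x \<in> topspace X. q x \<in> {y \<in> q ` topspace X. g y \<in> U}} = {x \<in> topspace X. g (q x) \<in> U}" for U
    by auto
  then show ?thesis
    unfolding continuous_map_def openin_quotient_topology topspace_quotient_topology
    by (auto simp: Pi_iff)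
qed

section \<open>Meeting distances in weighted trees\<close>

lemma weighted_treeD:
  assumes "weighted_tree S E l"
  shows "E \<subseteq> Pow S - {{}}" "S \<in> E" "\<And>i. i \<in> S \<Longrightarrow> {i} \<in> E"
    "\<And>A B. A \<in> E \<Longrightarrow> B \<in> E \<Longrightarrow> A \<subseteq> B \<or> B \<subseteq> A \<or> A \<inter> B = {}"
    "\<And>A. A \<notin> E \<Longrightarrow> l A = 0" "\<And>A. 0 \<le> l A" "\<And>A. l A \<le> 1"
    "\<And>i. i \<in> S \<Longrightarrow> (\<Sum>A | A \<in> E \<and> i \<in> A. l A) = 1"
proof -
  have r: "rooted_tree S E" and z: "\<forall>A. A \<notin> E \<longrightarrow> l A = 0" and b: "\<forall>A\<in>E. l A \<in> {0..1}"
    and d: "\<forall>i\<in>S. (\<Sum>A | A \<in> E \<and> i \<in> A. l A) = 1"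
    using assms by (simp_all add: weighted_tree_def)
  show "E \<subseteq> Pow S - {{}}" "S \<in> E" using r by (simp_all add: rooted_tree_def)
  show "{i} \<in> E" if "i \<in> S" for i using r that by (simp add: rooted_tree_def)
  show "A \<subseteq> B \<or> B \<subseteq> A \<or> A \<inter> B = {}" if "A \<in> E" "B \<in> E" for A B
    using r that by (simp add: rooted_tree_def)
  show "l A = 0" if "A \<notin> E" for A using z that by simp
  show "0 \<le> l A" "l A \<le> 1" for A using z b by (cases "A \<in> E"; simp)+
  show "(\<Sum>A | A \<in> E \<and> i \<in> A. l A) = 1" if "i \<in> S" for i using d that by simp
qed

lemma finite_edges: "finite S \<Longrightarrow> weighted_tree S E l \<Longrightarrow> finite E"
  using weighted_treeD(1) finite_subset[of E "Pow S"] by blast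

lemma meet_dist_edges:
  assumes "finite S" "weighted_tree S E l"
  shows "meet_dist S l i h = (\<Sum>A | A \<in> E \<and> i \<in> A \<and> h \<in> A. l A)"
  unfolding meet_dist_def
  by (rule sum.mono_neutral_right)
    (use assms weighted_treeD(1)[OF assms(2)] weighted_treeD(5)[OF assms(2)] in \<open>auto intro: finite_subset[of _ "Pow S"]\<close>)

lemma meet_dist_commute: "meet_dist S l i h = meet_dist S l h i"
  unfolding meet_dist_def by (rule sum.cong) auto

lemma meet_dist_self:
  assumes "finite S" "weighted_tree S E l" "i \<in> S"
  shows "meet_dist S l i i = 1"
  using weighted_treeD(8)[OF assms(2,3)] meet_dist_edges[OF assms(1,2)] by simp

lemma meet_dist_bounds:
  assumes "finite S" "weighted_tree S E l" "i \<in> S"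
  shows "0 \<le> meet_dist S l i h" "meet_dist S l i h \<le> 1"
proof -
  note fin = finite_edges[OF assms(1,2)]
  show "0 \<le> meet_dist S l i h"
    unfolding meet_dist_def by (intro sum_nonneg weighted_treeD(6)[OF assms(2)])
  have "meet_dist S l i h \<le> meet_dist S l i i"
    unfolding meet_dist_edges[OF assms(1,2)]
    by (rule sum_mono2) (use fin weighted_treeD(6)[OF assms(2)] in auto)
  then show "meet_dist S l i h \<le> 1" using meet_dist_self[OF assms] by simp
qed

text \<open>
  Of the edges through \<open>h\<close>, those that contain \<open>i\<close> and those that contain \<open>k\<close> are two upper
  sections of a chain, so one of the two families lies in the other and consists of edges on the way to both \<open>i\<close> and \<open>k\<close>.
\<close>

lemma meet_dist_ultrametric:
  assumes "finite S" "weighted_tree S E l"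
  shows "min (meet_dist S l i h) (meet_dist S l h k) \<le> meet_dist S l i k"
proof -
  note fin = finite_edges[OF assms] and E = weighted_treeD[OF assms(2)]
  have le: "(\<Sum>A\<in>X. l A) \<le> (\<Sum>A | A \<in> E \<and> i \<in> A \<and> k \<in> A. l A)"
    if "X \<subseteq> {A. A \<in> E \<and> i \<in> A \<and> k \<in> A}" for X
    by (rule sum_mono2) (use fin E(6) that in auto)
  have "{A. A \<in> E \<and> i \<in> A \<and> h \<in> A} \<subseteq> {A. A \<in> E \<and> i \<in> A \<and> k \<in> A} \<or>
      {A. A \<in> E \<and> h \<in> A \<and> k \<in> A} \<subseteq> {A. A \<in> E \<and> i \<in> A \<and> k \<in> A}"
    using E(4) by blast
  then show ?thesis
    unfolding meet_dist_edges[OF assms] using le by (auto simp: min_le_iff_disj)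
qed

text \<open>
  If the root edge has length 0, two leaves on different branches at its upper vertex are at distance 0. If the edge of the
  leaf \<open>i\<close> has length 0, any other leaf whose path passes through the vertex where this edge ends shares with \<open>i\<close> all edges but \<open>{i}\<close>, so it is at
  distance 1. A tree with a single leaf is never degenerate.
\<close>

lemma degenerate_meet_dist:
  assumes "finite S" "weighted_tree S E l" "degenerate S l"
  obtains i h where "i \<in> S" "h \<in> S" "i \<noteq> h" "meet_dist S l i h = 0 \<or> meet_dist S l i h = 1"
proof -
  note fin = finite_edges[OF assms(1,2)] and E = weighted_treeD[OF assms(2)]
  have big: "S \<noteq> {i}" for i
  proof
    assume S: "S = {i}"
    then have "{A. A \<in> E \<and> i \<in> A} = {S}" using E(1,2) by auto
    then have "l S = 1" using E(8)[of i] S by simp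
    then show False using assms(3) S by (auto simp: degenerate_def)
  qed
  obtain i0 where i0: "i0 \<in> S" using E(1,2) by blast
  from assms(3) consider "l S = 0" | i where "i \<in> S" "l {i} = 0" by (auto simp: degenerate_def)
  then show ?thesis
  proof cases
    case 1
    \<comment> \<open>A maximal proper edge: no proper edge contains it together with a leaf outside it.\<close>
    have "finite (E - {S})" "{i0} \<in> E - {S}" using fin E(3)[OF i0] big[of i0] by auto
    then obtain A where A: "A \<in> E - {S}" "\<And>B. B \<in> E - {S} \<Longrightarrow> A \<subseteq> B \<Longrightarrow> A = B"
      using finite_has_maximal2[of "E - {S}" "{i0}"] by metis
    then obtain i h where ih: "i \<in> A" "h \<in> S" "h \<notin> A" using E(1) by blast
    have "{B. B \<in> E \<and> i \<in> B \<and> h \<in> B} \<subseteq> {S}"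
    proof
      fix B assume B: "B \<in> {B. B \<in> E \<and> i \<in> B \<and> h \<in> B}"
      then have "A \<subseteq> B" using E(4)[of A B] A(1) ih by blast
      then show "B \<in> {S}" using A(2)[of B] B ih by blast
    qed
    then have "(\<Sum>B | B \<in> E \<and> i \<in> B \<and> h \<in> B. l B) = 0"
      using 1 by (intro sum.neutral) auto
    then have "meet_dist S l i h = 0" by (simp add: meet_dist_edges[OF assms(1,2)])
    then show ?thesis using that ih A(1) E(1) by blast
  next
    case (2 i)
    \<comment> \<open>The edge just above the leaf edge of \<open>i\<close>.\<close>
    have "finite {B \<in> E. {i} \<subset> B}" "S \<in> {B \<in> E. {i} \<subset> B}" using fin E(2) big[of i] 2 by auto
    then obtain B where "B \<in> {B \<in> E. {i} \<subset> B}" "\<forall>A\<in>{B \<in> E. {i} \<subset> B}. A \<subseteq> B \<longrightarrow> B = A"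
      using finite_has_minimal2[of "{B \<in> E. {i} \<subset> B}" S] by meson
    then have B: "B \<in> E" "{i} \<subset> B" "\<And>A. A \<in> E \<Longrightarrow> {i} \<subset> A \<Longrightarrow> A \<subseteq> B \<Longrightarrow> B = A"
      by simp_all
    then obtain h where h: "h \<in> B" "h \<noteq> i" by blast
    have "{A. A \<in> E \<and> i \<in> A} = insert {i} {A. A \<in> E \<and> i \<in> A \<and> h \<in> A}"
    proof (intro equalityI subsetI)
      fix A assume A: "A \<in> {A. A \<in> E \<and> i \<in> A}"
      then have "A \<subseteq> B \<or> B \<subseteq> A" using E(4)[of A B] B by blast
      then show "A \<in> insert {i} {A. A \<in> E \<and> i \<in> A \<and> h \<in> A}" using A B(3)[of A] h by blast
    qed (use E(3) 2 in auto)
    moreover have "{i} \<notin> {A. A \<in> E \<and> i \<in> A \<and> h \<in> A}" using h by auto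
    moreover have "finite {A. A \<in> E \<and> i \<in> A \<and> h \<in> A}" using fin by auto
    ultimately have "meet_dist S l i h = 1"
      using E(8)[of i] 2 by (simp add: meet_dist_edges[OF assms(1,2)])
    then show ?thesis using that 2 h B(1) E(1) by blast
  qed
qed

lemma grafting_commute: "grafting S1 S2 l \<longleftrightarrow> grafting S2 S1 l"
  unfolding grafting_def by (metis Un_commute)

lemma grafting_edges:
  assumes "weighted_tree (S1 \<union> S2) E l" "S1 \<in> E" "S2 \<in> E" "A \<in> E"
  shows "A = S1 \<union> S2 \<or> A \<subseteq> S1 \<or> A \<subseteq> S2"
proof -
  note E = weighted_treeD[OF assms(1)]
  show ?thesis using E(1) E(4)[of A S1] E(4)[of A S2] assms(2-4) by blast
qed

lemma grafting_cross_dist: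
  assumes "finite (S1 \<union> S2)" "S1 \<inter> S2 = {}" "grafting S1 S2 l" "i \<in> S1" "h \<in> S2"
  shows "meet_dist (S1 \<union> S2) l i h = l (S1 \<union> S2)"
proof -
  obtain E where E: "weighted_tree (S1 \<union> S2) E l" "S1 \<in> E" "S2 \<in> E"
    using assms(3) by (auto simp: grafting_def)
  have "{A. A \<in> E \<and> i \<in> A \<and> h \<in> A} = {S1 \<union> S2}"
    using grafting_edges[OF E] weighted_treeD(2)[OF E(1)] assms(2,4,5) by blast
  then show ?thesis by (simp add: meet_dist_edges[OF assms(1) E(1)])
qed

text \<open>
  In a grafting an edge that meets \<open>S1\<close> is the root edge or an edge of the branch over \<open>S1\<close>, so
  cutting off the root edge subtracts its length from every distance within \<open>S1\<close>.
\<close>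

lemma grafting_branch:
  assumes fin: "finite (S1 \<union> S2)" and dis: "S1 \<inter> S2 = {}" "S2 \<noteq> {}" and g: "grafting S1 S2 l" and r: "l (S1 \<union> S2) < 1"
  shows "\<exists>E. weighted_tree S1 E (branch (S1 \<union> S2) S1 l)"
    and "i \<in> S1 \<Longrightarrow> h \<in> S1 \<Longrightarrow> meet_dist S1 (branch (S1 \<union> S2) S1 l) i h =
           (meet_dist (S1 \<union> S2) l i h - l (S1 \<union> S2)) / (1 - l (S1 \<union> S2))"
proof -
  define S where "S = S1 \<union> S2"
  obtain E where wt: "weighted_tree S E l" and S1: "S1 \<in> E" "S2 \<in> E"
    using g by (auto simp: grafting_def S_def)
  note E = weighted_treeD[OF wt]
  have finE: "finite E" using finite_edges fin wt S_def by metis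
  define E1 where "E1 = {A \<in> E. A \<subseteq> S1}"
  have split: "(\<Sum>A | A \<in> E \<and> i \<in> A \<and> h \<in> A. l A) = l S + (\<Sum>A | A \<in> E1 \<and> i \<in> A \<and> h \<in> A. l A)"
    if "i \<in> S1" "h \<in> S1" for i h
  proof -
    have "{A. A \<in> E \<and> i \<in> A \<and> h \<in> A} = insert S {A. A \<in> E1 \<and> i \<in> A \<and> h \<in> A}"
      using grafting_edges[OF wt[unfolded S_def] S1] E(2) that dis by (fastforce simp: E1_def S_def)
    moreover have "S \<notin> {A. A \<in> E1 \<and> i \<in> A \<and> h \<in> A}" using dis by (auto simp: E1_def S_def)
    moreover have "finite {A. A \<in> E1 \<and> i \<in> A \<and> h \<in> A}" using finE by (auto simp: E1_def)
    ultimately show ?thesis by simp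
  qed
  have br: "branch S S1 l A = l A / (1 - l S)" if "A \<in> E1" for A
    using that by (simp add: branch_def E1_def)
  have pos: "1 - l S > 0" using r S_def by simp
  have one: "(\<Sum>A | A \<in> E1 \<and> i \<in> A. l A) = 1 - l S" if "i \<in> S1" for i
    using split[OF that that] E(8)[of i] that by (simp add: S_def)
  have le: "l A \<le> 1 - l S" if A: "A \<in> E1" for A
  proof -
    have "A \<noteq> {}" using A E(1) by (auto simp: E1_def)
    then obtain i where i: "i \<in> A" by blast
    then have "l A \<le> (\<Sum>A | A \<in> E1 \<and> i \<in> A. l A)"
      by (intro member_le_sum) (use A finE E(6) in \<open>auto simp: E1_def\<close>)
    then show ?thesis using one[of i] i A by (auto simp: E1_def)
  qed
  have "rooted_tree S1 E1"
    unfolding rooted_tree_def using E(1,3,4) S1 by (auto simp: E1_def S_def)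
  moreover have "branch S S1 l A = 0" if "A \<notin> E1" for A
    using that E(5) by (auto simp: branch_def E1_def)
  moreover have "branch S S1 l A \<in> {0..1}" if "A \<in> E1" for A
    unfolding br[OF that] using le[OF that] E(6)[of A] pos by (simp add: divide_simps)
  moreover have "(\<Sum>A | A \<in> E1 \<and> i \<in> A. branch S S1 l A) = 1" if "i \<in> S1" for i
  proof -
    have "(\<Sum>A | A \<in> E1 \<and> i \<in> A. branch S S1 l A) = (\<Sum>A | A \<in> E1 \<and> i \<in> A. l A) / (1 - l S)"
      unfolding sum_divide_distrib by (rule sum.cong) (auto simp: br)
    then show ?thesis using one[OF that] pos by simp
  qed
  ultimately have wt1: "weighted_tree S1 E1 (branch S S1 l)"
    unfolding weighted_tree_def by blast
  then show "\<exists>E. weighted_tree S1 E (branch (S1 \<union> S2) S1 l)" unfolding S_def by blast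
  assume ih: "i \<in> S1" "h \<in> S1"
  have "meet_dist S1 (branch S S1 l) i h = (\<Sum>A | A \<in> E1 \<and> i \<in> A \<and> h \<in> A. branch S S1 l A)"
    using meet_dist_edges[OF _ wt1] fin by simp
  also have "\<dots> = (\<Sum>A | A \<in> E1 \<and> i \<in> A \<and> h \<in> A. l A) / (1 - l S)"
    unfolding sum_divide_distrib by (rule sum.cong) (auto simp: br)
  also have "\<dots> = (meet_dist S l i h - l S) / (1 - l S)"
    using split[OF ih] meet_dist_edges[OF _ wt] fin by (simp add: S_def)
  finally show "meet_dist S1 (branch (S1 \<union> S2) S1 l) i h =
           (meet_dist (S1 \<union> S2) l i h - l (S1 \<union> S2)) / (1 - l (S1 \<union> S2))" unfolding S_def .
qed

text \<open>
  The edges \<open>S1\<close> and \<open>S2\<close> may be inserted with length 0, provided that no edge of positive length other than the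
  root edge contains leaves from both sides. The edges of length 0 that obstruct this are
  dropped first.
\<close>

lemma graftingI:
  assumes fin: "finite (S1 \<union> S2)" and wt: "weighted_tree (S1 \<union> S2) E l"
    and ne: "S1 \<noteq> {}" "S2 \<noteq> {}" "S1 \<inter> S2 = {}"
    and sides: "\<And>A. A \<in> E \<Longrightarrow> l A \<noteq> 0 \<Longrightarrow> A = S1 \<union> S2 \<or> A \<subseteq> S1 \<or> A \<subseteq> S2"
  shows "grafting S1 S2 l"
proof -
  define S where "S = S1 \<union> S2"
  note E = weighted_treeD[OF wt[folded S_def]]
  define E0 where "E0 = {A \<in> E. l A \<noteq> 0} \<union> (\<lambda>i. {i}) ` S"
  define E' where "E' = E0 \<union> {S, S1, S2}"
  have E0: "A \<in> E" if "A \<in> E0" for A using that E(3) by (auto simp: E0_def)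
  have side0: "A = S \<or> A \<subseteq> S1 \<or> A \<subseteq> S2" if "A \<in> E0" for A
    using that sides by (auto simp: E0_def S_def)
  have sub0: "A \<subseteq> S \<and> A \<noteq> {}" if "A \<in> E0" for A using E0[OF that] E(1) by blast
  have "rooted_tree S E'"
    unfolding rooted_tree_def
  proof (intro conjI ballI)
    show "E' \<subseteq> Pow S - {{}}" using sub0 ne by (auto simp: E'_def S_def)
    show "S \<in> E'" by (simp add: E'_def)
    show "{i} \<in> E'" if "i \<in> S" for i using that by (simp add: E'_def E0_def)
    fix A B assume "A \<in> E'" "B \<in> E'"
    then consider "A \<in> E0" "B \<in> E0" | "A \<in> E0" "B \<in> {S, S1, S2}" | "B \<in> E0" "A \<in> {S, S1, S2}"
      | "A \<in> {S, S1, S2}" "B \<in> {S, S1, S2}" by (auto simp: E'_def)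
    then show "A \<subseteq> B \<or> B \<subseteq> A \<or> A \<inter> B = {}"
    proof cases
      case 1 then show ?thesis using E(4) E0 by blast
    next
      case 2 then show ?thesis using side0[of A] sub0[of A] ne(3) S_def by blast
    next
      case 3 then show ?thesis using side0[of B] sub0[of B] ne(3) S_def by blast
    next
      case 4 then show ?thesis using ne(3) S_def by blast
    qed
  qed
  moreover have "l A = 0" if "A \<notin> E'" for A
    using that E(5)[of A] by (auto simp: E'_def E0_def)
  moreover have "l A \<in> {0..1}" for A using E(6,7) by simp
  moreover have "(\<Sum>A | A \<in> E' \<and> i \<in> A. l A) = 1" if "i \<in> S" for i
  proof -
    have sum: "(\<Sum>A | A \<in> X \<and> i \<in> A. l A) = (\<Sum>A | A \<in> Pow S \<and> i \<in> A. l A)"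
      if "X \<subseteq> Pow S" "\<And>A. A \<notin> X \<Longrightarrow> l A = 0" for X
      by (rule sum.mono_neutral_left) (use fin that in \<open>auto simp: S_def\<close>)
    have "E' \<subseteq> Pow S" using sub0 by (auto simp: E'_def S_def)
    moreover have "l A = 0" if "A \<notin> E'" for A
      using that E(5)[of A] by (auto simp: E'_def E0_def)
    moreover have "E \<subseteq> Pow S" using E(1) by blast
    ultimately have "(\<Sum>A | A \<in> E' \<and> i \<in> A. l A) = (\<Sum>A | A \<in> E \<and> i \<in> A. l A)"
      using sum[of E'] sum[of E] E(5) by metis
    then show ?thesis using E(8)[OF that] by simp
  qed
  ultimately have "weighted_tree S E' l" unfolding weighted_tree_def by blast
  then show ?thesis unfolding grafting_def S_def[symmetric] E'_def by blast
qed

text \<open>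
  An edge \<open>A\<close> of positive length that contains leaves of both sides, but misses some leaf \<open>k\<close>, puts the meeting vertex of two leaves
  \<open>i\<close>, \<open>h\<close> of different sides further from the root than that of \<open>k\<close> and the one of \<open>i\<close>, \<open>h\<close> that is on the side of
  \<open>k\<close>.
\<close>

lemma not_grafting_meet_dist:
  assumes fin: "finite (S1 \<union> S2)" and wt: "weighted_tree (S1 \<union> S2) E l"
    and ne: "S1 \<noteq> {}" "S2 \<noteq> {}" "S1 \<inter> S2 = {}" and ng: "\<not> grafting S1 S2 l"
  obtains R x y i h where "R = S1 \<or> R = S2" "x \<in> R" "y \<in> R" "x \<noteq> y" "i \<in> S1" "h \<in> S2"
    "meet_dist (S1 \<union> S2) l x y < meet_dist (S1 \<union> S2) l i h"
proof -
  note E = weighted_treeD[OF wt] and finE = finite_edges[OF fin wt]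
  obtain A where A: "A \<in> E" "l A \<noteq> 0" "A \<noteq> S1 \<union> S2" "\<not> A \<subseteq> S1" "\<not> A \<subseteq> S2"
    using graftingI[OF fin wt ne] ng by blast
  have AS: "A \<subseteq> S1 \<union> S2" using A E(1) by blast
  obtain i h where ih: "i \<in> S1" "h \<in> S2" "i \<in> A" "h \<in> A" using A AS by blast
  obtain k where k: "k \<in> S1 \<union> S2" "k \<notin> A" using A AS by blast
  have lt: "meet_dist (S1 \<union> S2) l k y < meet_dist (S1 \<union> S2) l i h" if "y \<in> A" for y
  proof -
    \<comment> \<open>An edge through \<open>k\<close> that meets \<open>A\<close> contains \<open>A\<close>, and \<open>A\<close> itself is an extra edge on the way to \<open>i\<close> and \<open>h\<close>.\<close>
    let ?X = "{B. B \<in> E \<and> k \<in> B \<and> y \<in> B}"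
    have X: "?X \<subseteq> {B. B \<in> E \<and> i \<in> B \<and> h \<in> B}" "A \<notin> ?X" "A \<in> {B. B \<in> E \<and> i \<in> B \<and> h \<in> B}"
      using E(4)[OF A(1)] ih k that A(1) by blast+
    have "(\<Sum>B\<in>?X. l B) < (\<Sum>B\<in>insert A ?X. l B)"
      using X(2) finE A(2) E(6)[of A] by simp
    also have "\<dots> \<le> (\<Sum>B | B \<in> E \<and> i \<in> B \<and> h \<in> B. l B)"
      by (rule sum_mono2) (use finE X E(6) in auto)
    finally show ?thesis unfolding meet_dist_edges[OF fin wt] .
  qed
  show ?thesis
  proof (cases "k \<in> S1")
    case True
    then show ?thesis using that[of S1 k i i h] lt[of i] ih k by blast
  next
    case False
    then show ?thesis using that[of S2 k h i h] lt[of h] ih k by blast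
  qed
qed

lemma closed_weighted_tree: "closed {l. weighted_tree S E l}"
proof -
  have c: "continuous_on UNIV (\<lambda>l :: 'a set \<Rightarrow> real. l A)" for A
    by (rule continuous_on_product_coordinates)
  have "{l. weighted_tree S E l} = {l. rooted_tree S E} \<inter> (\<Inter>A\<in>-E. {l. l A = 0}) \<inter>
      (\<Inter>A\<in>E. {l. 0 \<le> l A} \<inter> {l. l A \<le> 1}) \<inter> (\<Inter>i\<in>S. {l. (\<Sum>A | A \<in> E \<and> i \<in> A. l A) = 1})"
    by (auto simp: weighted_tree_def)
  then show ?thesis
    by (auto intro!: closed_Int closed_INT closed_Collect_eq closed_Collect_le closed_Collect_const
        continuous_on_sum c)
qed

text \<open>
  For fixed edges the conditions on lengths are closed, and there are finitely many sets of edges.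
\<close>

lemma compact_trees:
  assumes "finite S" shows "compact {l. \<exists>E. weighted_tree S E l}"
proof -
  have "compactin (product_topology (\<lambda>_. euclidean) UNIV) (UNIV \<rightarrow>\<^sub>E {0..1::real})"
    by (simp add: compactin_PiE)
  then have cp: "compact ((UNIV :: 'a set set) \<rightarrow>\<^sub>E {0..1::real})"
    unfolding euclidean_product_topology compactin_euclidean_iff .
  have "E \<in> Pow (Pow S)" if "weighted_tree S E l" for E l
    using weighted_treeD(1)[OF that] by blast
  then have "{l. \<exists>E. weighted_tree S E l} = (\<Union>E\<in>Pow (Pow S). {l. weighted_tree S E l})"
    by blast
  moreover have "closed (\<Union>E\<in>Pow (Pow S). {l. weighted_tree S E l})"
    by (intro closed_UN ballI closed_weighted_tree) (simp add: assms)
  ultimately have "closed {l. \<exists>E. weighted_tree S E l}" by metis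
  moreover have "{l. \<exists>E. weighted_tree S E l} \<subseteq> UNIV \<rightarrow>\<^sub>E {0..1}"
    by (auto intro: weighted_treeD(6,7))
  ultimately show ?thesis using cp compact_Int_closed by (metis Int_absorb1)
qed

lemma closed_degenerate: assumes "finite S" shows "closed {l. degenerate S l}"
proof -
  have c: "closed {l :: 'a set \<Rightarrow> real. l A = 0}" for A
    by (intro closed_Collect_eq continuous_on_product_coordinates continuous_on_const)
  have "{l. degenerate S l} = {l. l S = 0} \<union> (\<Union>i\<in>S. {l. l {i} = 0})"
    by (auto simp: degenerate_def)
  then show ?thesis
    by (simp only:) (intro closed_Un closed_UN assms ballI c)
qed

lemma continuous_meet_dist: "continuous_on X (\<lambda>l. meet_dist S l i h)"
  unfolding meet_dist_def
  by (intro continuous_on_sum continuous_on_subset[OF continuous_on_product_coordinates]) auto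

section \<open>Coordinates of the map from the total fibre\<close>

text \<open>
  The coordinate of \<open>J(F)\<close> at the leaf \<open>i\<close>, for arbitrary numbers \<open>p\<close> in place of the meeting distances: the homotopy
  deforms these numbers through values that do not come from trees.
\<close>

definition fibre_coord ::
  "('i \<Rightarrow> 'a based) \<Rightarrow> 'i set \<Rightarrow> ('i, 'a) tofib_pt \<Rightarrow> ('i \<Rightarrow> 'i \<Rightarrow> real) \<Rightarrow> 'i \<Rightarrow> 'a" where
  "fibre_coord Y R F p i = wedge_single Y i (F {i} (\<lambda>h\<in>R - {i}. p i h))"

lemma J_formula_fibre_coord:
  "J_formula Y S F l = smash_pt Y S (\<lambda>i\<in>S. fibre_coord Y S F (meet_dist S l) i)"
  by (simp add: J_formula_def fibre_coord_def)

lemma smash_pt_eq_None: "smash_pt Y S f = None \<longleftrightarrow> (\<exists>i\<in>S. f i = snd (Y i))"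
  by (simp add: smash_pt_def collapse_pt_def)

lemma smash_pt_NoneI: "i \<in> S \<Longrightarrow> y i = snd (Y i) \<Longrightarrow> smash_pt Y S (\<lambda>i\<in>S. y i) = None"
  unfolding smash_pt_eq_None by force

lemma tofibD:
  assumes "F \<in> pts (tofib Y R)"
  shows "T \<subseteq> R \<Longrightarrow> continuous_map (cube (R - T)) (fst (bwedge Y T)) (F T)"
    and "T \<subseteq> R \<Longrightarrow> p \<in> topspace (cube (R - T)) \<Longrightarrow> k \<in> R - T \<Longrightarrow> p k = 0 \<Longrightarrow> F T p = None"
    and "T \<subseteq> T' \<Longrightarrow> T' \<subseteq> R \<Longrightarrow> p \<in> topspace (cube (R - T')) \<Longrightarrow>
           wedge_collapse T (F T' p) = F T (\<lambda>k\<in>R - T. if k \<in> T' then 1 else p k)"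
proof -
  have ts: "F \<in> (\<Pi>\<^sub>E T\<in>Pow R. topspace (map_space (cube (R - T)) (fst (bwedge Y T))))"
    and zero: "\<forall>T\<subseteq>R. \<forall>p\<in>topspace (cube (R - T)). (\<exists>k\<in>R - T. p k = 0) \<longrightarrow> F T p = None"
    and coll: "\<forall>T T'. T \<subseteq> T' \<and> T' \<subseteq> R \<longrightarrow> (\<forall>p\<in>topspace (cube (R - T')).
      wedge_collapse T (F T' p) = F T (\<lambda>k\<in>R - T. if k \<in> T' then 1 else p k))"
    using assms unfolding tofib_def by simp_all
  show "continuous_map (cube (R - T)) (fst (bwedge Y T)) (F T)" if "T \<subseteq> R"
    using PiE_mem[OF ts, of T] that by (simp add: topspace_map_space)
  show "F T p = None" if "T \<subseteq> R" "p \<in> topspace (cube (R - T))" "k \<in> R - T" "p k = 0"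
    using zero that by blast
  show "wedge_collapse T (F T' p) = F T (\<lambda>k\<in>R - T. if k \<in> T' then 1 else p k)"
    if "T \<subseteq> T'" "T' \<subseteq> R" "p \<in> topspace (cube (R - T'))"
    using coll that by blast
qed

lemma tofib_empty_wedge:
  assumes "F \<in> pts (tofib Y R)" "p \<in> topspace (cube R)"
  shows "F {} p = None"
proof -
  have "F {} p \<in> pts (bwedge Y {})"
    using tofibD(1)[OF assms(1), of "{}"] assms(2) by (auto simp: continuous_map_def)
  then show ?thesis by (simp add: bwedge_def topspace_collapse)
qed

lemma restrict_in_cube: "(\<And>h. h \<in> R \<Longrightarrow> p h \<in> {0..1}) \<Longrightarrow> restrict p R \<in> topspace (cube R)"
  by (auto simp: topspace_cube)

lemma fibre_coord_zero:
  assumes "F \<in> pts (tofib Y R)" "i \<in> R" "h \<in> R" "i \<noteq> h" "p i h = 0"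
    and "\<And>k. k \<in> R \<Longrightarrow> p i k \<in> {0..1}"
  shows "fibre_coord Y R F p i = snd (Y i)"
proof -
  have "F {i} (\<lambda>h\<in>R - {i}. p i h) = None"
    by (rule tofibD(2)[OF assms(1), of _ _ h]) (use assms in \<open>auto intro!: restrict_in_cube\<close>)
  then show ?thesis by (simp add: fibre_coord_def wedge_single_def)
qed

text \<open>
  Both coordinates are collapses of the same point \<open>F {i, h} q\<close> of a wedge of two spaces, by the compatibility of the components
  of \<open>F\<close> at the faces where a coordinate is 1.
\<close>

lemma fibre_coord_one:
  assumes F: "F \<in> pts (tofib Y R)" and ih: "i \<in> R" "h \<in> R" "i \<noteq> h" "p i h = 1" "p h i = 1"
    and p: "\<And>k. k \<in> R \<Longrightarrow> p i k \<in> {0..1}"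
    and eq: "\<And>k. k \<in> R - {i, h} \<Longrightarrow> p i k = p h k"
  shows "fibre_coord Y R F p i = snd (Y i) \<or> fibre_coord Y R F p h = snd (Y h)"
proof -
  define q where "q = (\<lambda>k\<in>R - {i, h}. p i k)"
  have q: "q \<in> topspace (cube (R - {i, h}))" unfolding q_def by (rule restrict_in_cube) (use p in auto)
  have "(\<lambda>k\<in>R - {i}. if k \<in> {i, h} then 1 else q k) = (\<lambda>k\<in>R - {i}. p i k)"
    "(\<lambda>k\<in>R - {h}. if k \<in> {i, h} then 1 else q k) = (\<lambda>k\<in>R - {h}. p h k)"
    using ih eq by (auto simp: q_def fun_eq_iff restrict_def)
  then have "wedge_collapse {i} (F {i, h} q) = F {i} (\<lambda>k\<in>R - {i}. p i k)"
    "wedge_collapse {h} (F {i, h} q) = F {h} (\<lambda>k\<in>R - {h}. p h k)"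
    using tofibD(3)[OF F _ _ q, of "{i}"] tofibD(3)[OF F _ _ q, of "{h}"] ih by auto
  moreover have "wedge_collapse {i} w = None \<or> wedge_collapse {h} w = None" for w :: "('a \<times> 'b) option"
  proof (cases w)
    case (Some a)
    then show ?thesis using ih(3) by (cases a) (simp add: wedge_collapse_def)
  qed (simp add: wedge_collapse_def)
  ultimately have "F {i} (\<lambda>k\<in>R - {i}. p i k) = None \<or> F {h} (\<lambda>k\<in>R - {h}. p h k) = None"
    by metis
  then show ?thesis by (auto simp: fibre_coord_def wedge_single_def)
qed

lemma fibre_coord_base: 
  assumes "i \<in> R" "\<And>k. k \<in> R \<Longrightarrow> p i k \<in> {0..1}"
  shows "fibre_coord Y R (snd (tofib Y R)) p i = snd (Y i)"
proof -
  have "(\<lambda>h\<in>R - {i}. p i h) \<in> topspace (cube (R - {i}))"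
    by (rule restrict_in_cube) (use assms in auto)
  then show ?thesis using assms(1) by (simp add: fibre_coord_def wedge_single_def tofib_def)
qed

lemma fibre_coord_cong:
  "(\<And>h. h \<in> R - {i} \<Longrightarrow> p i h = q i h) \<Longrightarrow> fibre_coord Y R F p i = fibre_coord Y R F q i"
  unfolding fibre_coord_def by (metis (no_types, lifting) restrict_ext)

lemma continuous_map_wedge_single:
  assumes "based_space (Y i)"
  shows "continuous_map (fst (bwedge Y {i})) (fst (Y i)) (wedge_single Y i)"
  unfolding continuous_map_def
proof (intro conjI allI impI)
  show "wedge_single Y i \<in> pts (bwedge Y {i}) \<rightarrow> topspace (fst (Y i))"
    using assms by (auto simp: bwedge_def topspace_collapse wedge_single_def based_space_def)
next
  fix U assume U: "openin (fst (Y i)) U"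
  let ?B = "{(i, x). x = snd (Y i)}"
  have "{w \<in> Sigma {i} (topspace \<circ> (\<lambda>i. fst (Y i))). wedge_single Y i (collapse_pt ?B w) \<in> U} = {i} \<times> U"
    using openin_subset[OF U] by (auto simp: collapse_pt_def wedge_single_def)
  moreover have "openin (sum_topology (\<lambda>i. fst (Y i)) {i}) ({i} \<times> U)"
    using U openin_subset[OF U] by (auto simp: openin_sum_topology)
  moreover have "{w \<in> topspace (sum_topology (\<lambda>i. fst (Y i)) {i}).
      collapse_pt ?B w \<in> {w \<in> pts (bwedge Y {i}). wedge_single Y i w \<in> U}} =
    {w \<in> Sigma {i} (topspace \<circ> (\<lambda>i. fst (Y i))). wedge_single Y i (collapse_pt ?B w) \<in> U}"
    using continuous_map_collapse_pt[of "sum_topology (\<lambda>i. fst (Y i)) {i}" ?B]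
    by (auto simp: bwedge_def continuous_map_def Pi_iff)
  ultimately show "openin (fst (bwedge Y {i})) {w \<in> pts (bwedge Y {i}). wedge_single Y i w \<in> U}"
    unfolding bwedge_def openin_collapse by (auto simp: topspace_collapse)
qed

lemma continuous_map_fibre_coord:
  assumes Y: "based_space (Y i)" and i: "i \<in> R" and f: "continuous_map X (fst (tofib Y R)) f"
    and p: "\<And>h. h \<in> R \<Longrightarrow> continuous_map X unit_interval (\<lambda>x. p x i h)"
  shows "continuous_map X (fst (Y i)) (\<lambda>x. fibre_coord Y R (f x) (p x) i)"
proof -
  let ?M = "map_space (cube (R - {i})) (fst (bwedge Y {i}))"
  have "continuous_map (fst (tofib Y R)) ?M (\<lambda>F. F {i})"
    unfolding tofib_def fst_conv
    by (rule continuous_map_from_subtopology)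
      (rule continuous_map_product_projection[where X = "\<lambda>T. map_space (cube (R - T)) (fst (bwedge Y T))"], use i in auto)
  from continuous_map_compose[OF f this] have 1: "continuous_map X ?M (\<lambda>x. f x {i})"
    by (simp add: o_def)
  have 2: "continuous_map X (cube (R - {i})) (\<lambda>x. \<lambda>h\<in>R - {i}. p x i h)"
    unfolding cube_def continuous_map_componentwise using p by auto
  have "continuous_map X (prod_topology ?M (cube (R - {i}))) (\<lambda>x. (f x {i}, \<lambda>h\<in>R - {i}. p x i h))"
    using 1 2 by (simp add: continuous_map_pairedI)
  from continuous_map_compose[OF continuous_map_compose[OF this
      continuous_map_eval[OF compact_Hausdorff_cube]] continuous_map_wedge_single[of Y, OF Y]]
  show ?thesis by (simp add: o_def fibre_coord_def)
qed

lemma continuous_map_smash_pt: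
  assumes "\<And>i. i \<in> S \<Longrightarrow> continuous_map X (fst (Y i)) (\<lambda>x. y x i)"
  shows "continuous_map X (fst (bsmash Y S)) (\<lambda>x. smash_pt Y S (\<lambda>i\<in>S. y x i))"
proof -
  have "continuous_map X (product_topology (\<lambda>i. fst (Y i)) S) (\<lambda>x. \<lambda>i\<in>S. y x i)"
    unfolding continuous_map_componentwise using assms by auto
  from continuous_map_compose[OF this continuous_map_collapse_pt]
  show ?thesis unfolding bsmash_def smash_pt_def by (simp add: o_def)
qed

lemma None_in_bsmash: "None \<in> pts (bsmash Y S)"
  by (simp add: bsmash_def topspace_collapse)

lemma pts_tree_space:
  "pts (tree_space S) = insert None (Some ` ({l. \<exists>E. weighted_tree S E l} - {l. degenerate S l}))"
  by (simp add: tree_space_def topspace_collapse)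

lemma snd_tree_space: "snd (tree_space S) = None"
  by (simp add: tree_space_def collapse_def)

lemma snd_bsmash: "snd (bsmash Y S) = None"
  by (simp add: bsmash_def collapse_def)

text \<open>
  Maps into the space of based maps out of the tree space are constructed from maps defined on all weighted
  trees, by the exponential law and descent to the quotient.
\<close>

lemma continuous_map_into_tree_maps:
  assumes fin: "finite S"
    and f: "continuous_map (prod_topology W (top_of_set {l. \<exists>E. weighted_tree S E l})) (fst Z) (\<lambda>(w, l). f w l)"
    and z: "snd Z \<in> pts Z"
    and deg: "\<And>w E l. w \<in> topspace W \<Longrightarrow> weighted_tree S E l \<Longrightarrow> degenerate S l \<Longrightarrow> f w l = snd Z"
  shows "continuous_map W (fst (based_maps (tree_space S) Z))
           (\<lambda>w. \<lambda>\<tau>\<in>pts (tree_space S). case \<tau> of None \<Rightarrow> snd Z | Some l \<Rightarrow> f w l)"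
proof -
  let ?K = "{l. \<exists>E. weighted_tree S E l}"
  have "compact (?K \<inter> {l. degenerate S l})"
    by (intro compact_Int_closed compact_trees closed_degenerate fin)
  moreover have "closedin (top_of_set ?K) (?K \<inter> {l. degenerate S l})"
    using closed_degenerate[OF fin] by (simp add: closedin_closed_Int)
  ultimately have "continuous_map (prod_topology W (fst (tree_space S))) (fst Z)
      (\<lambda>(w, \<tau>). case \<tau> of None \<Rightarrow> snd Z | Some l \<Rightarrow> f w l)"
    unfolding tree_space_def
    by (intro continuous_map_prod_collapse f z) (use deg in \<open>auto simp: compactin_subtopology\<close>)
  from continuous_map_curry[OF this] show ?thesis
    unfolding based_maps_def fst_conv snd_tree_space
    by (auto simp: continuous_map_in_subtopology pts_tree_space)
qed

text \<open>
  If \<open>T i h = 1\<close>, the ultrametric inequality gives \<open>T i k = T h k\<close> for all \<open>k\<close>, as needed for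
  \<open>fibre_coord_one\<close>.
\<close>

lemma J_formula_degenerate:
  assumes "finite S" "weighted_tree S E l" "degenerate S l" "F \<in> pts (tofib Y S)"
  shows "J_formula Y S F l = None"
proof -
  let ?T = "meet_dist S l"
  obtain i h where ih: "i \<in> S" "h \<in> S" "i \<noteq> h" and T: "?T i h = 0 \<or> ?T i h = 1"
    using degenerate_meet_dist[OF assms(1-3)] by metis
  note bd = meet_dist_bounds[OF assms(1,2)]
  have "fibre_coord Y S F ?T i = snd (Y i) \<or> fibre_coord Y S F ?T h = snd (Y h)"
    using T
  proof
    assume "?T i h = 0"
    then show ?thesis using fibre_coord_zero[OF assms(4) ih] bd ih by simp
  next
    assume one: "?T i h = 1"
    have "?T i k = ?T h k" if "k \<in> S" for k
      using meet_dist_ultrametric[OF assms(1,2), of i h k] meet_dist_ultrametric[OF assms(1,2), of h i k]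
        bd(2)[OF ih(1), of k] bd(2)[OF ih(2), of k] one meet_dist_commute[of S l h i]
      by (simp add: min_def split: if_splits)
    then show ?thesis using fibre_coord_one[OF assms(4) ih] bd ih one meet_dist_commute[of S l h i] by simp
  qed
  then show ?thesis
    unfolding J_formula_fibre_coord using smash_pt_NoneI[where y = "fibre_coord Y S F ?T"] ih by blast
qed

lemma J_tree_class:
  assumes "finite S" "weighted_tree S E l" "F \<in> pts (tofib Y S)"
  shows "J Y S F (tree_class S l) = J_formula Y S F l"
  using J_formula_degenerate[OF assms(1,2) _ assms(3)] assms(2)
  by (auto simp: J_def tree_class_def collapse_pt_def pts_tree_space)

lemma J_formula_base:
  assumes "finite S" "weighted_tree S E l"
  shows "J_formula Y S (snd (tofib Y S)) l = None"
proof -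
  obtain i where i: "i \<in> S" using weighted_treeD(1,2)[OF assms(2)] by blast
  show ?thesis unfolding J_formula_fibre_coord
    by (rule smash_pt_NoneI[OF i], rule fibre_coord_base) (use i meet_dist_bounds[OF assms i] in auto)
qed

lemma J_base:
  assumes "finite S"
  shows "J Y S (snd (tofib Y S)) = snd (based_maps (tree_space S) (bsmash Y S))"
proof
  fix \<tau>
  show "J Y S (snd (tofib Y S)) \<tau> = snd (based_maps (tree_space S) (bsmash Y S)) \<tau>"
    by (cases \<tau>) (auto simp: J_def based_maps_def snd_bsmash pts_tree_space J_formula_base[OF assms] restrict_def)
qed

lemma continuous_meet_dist_unit:
  assumes fin: "finite S" and i: "i \<in> S"
  shows "continuous_map (top_of_set {l. \<exists>E. weighted_tree S E l}) unit_interval (\<lambda>l. meet_dist S l i h)"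
  using continuous_meet_dist meet_dist_bounds[OF fin _ i] by (auto simp: continuous_map_in_subtopology)

lemma J_based_map:
  assumes fin: "finite S" and Y: "\<And>i. i \<in> S \<Longrightarrow> based_space (Y i)"
  shows "based_map (tofib Y S) (based_maps (tree_space S) (bsmash Y S)) (J Y S)"
proof -
  let ?K = "top_of_set {l. \<exists>E. weighted_tree S E l}"
  have "continuous_map (prod_topology (fst (tofib Y S)) ?K) (fst (bsmash Y S)) (\<lambda>p. J_formula Y S (fst p) (snd p))"
    unfolding J_formula_fibre_coord
  proof (rule continuous_map_smash_pt)
    fix i assume i: "i \<in> S"
    have "continuous_map (prod_topology (fst (tofib Y S)) ?K) unit_interval (\<lambda>p. meet_dist S (snd p) i h)" for h
      using continuous_map_compose[OF continuous_map_snd continuous_meet_dist_unit[OF fin i]]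
      by (simp add: o_def)
    then show "continuous_map (prod_topology (fst (tofib Y S)) ?K) (fst (Y i))
        (\<lambda>p. fibre_coord Y S (fst p) (meet_dist S (snd p)) i)"
      by (intro continuous_map_fibre_coord Y i continuous_map_fst)
  qed
  then have c: "continuous_map (prod_topology (fst (tofib Y S)) ?K) (fst (bsmash Y S)) (\<lambda>(F, l). J_formula Y S F l)"
    by (simp add: case_prod_unfold)
  have "continuous_map (fst (tofib Y S)) (fst (based_maps (tree_space S) (bsmash Y S))) (J Y S)"
    using continuous_map_into_tree_maps[OF fin c]
    by (simp add: snd_bsmash None_in_bsmash J_formula_degenerate[OF fin] J_def[abs_def])
  then show ?thesis using J_base[OF fin] by (simp add: based_map_def)
qed

lemma perm_tree_dist:
  assumes "\<sigma> permutes S"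
  shows "meet_dist S (\<lambda>A. l (\<sigma> -` A)) (\<sigma> i) (\<sigma> h) = meet_dist S l i h"
proof -
  have b: "bij \<sigma>" and im: "\<sigma> ` S = S" using assms permutes_bij permutes_image by blast+
  show ?thesis
    unfolding meet_dist_def
  proof (rule sum.reindex_bij_witness[of _ "\<lambda>A. \<sigma> ` A" "\<lambda>A. \<sigma> -` A"])
    fix A assume A: "A \<in> {A. A \<subseteq> S \<and> \<sigma> i \<in> A \<and> \<sigma> h \<in> A}"
    show "\<sigma> ` (\<sigma> -` A) = A" using b by (simp add: bij_def surj_image_vimage_eq)
    have "\<sigma> -` A \<subseteq> S" using A assms by (auto simp: permutes_in_image)
    then show "\<sigma> -` A \<in> {A. A \<subseteq> S \<and> i \<in> A \<and> h \<in> A}" using A by auto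
  next
    fix A assume A: "A \<in> {A. A \<subseteq> S \<and> i \<in> A \<and> h \<in> A}"
    show "\<sigma> -` (\<sigma> ` A) = A" using b by (simp add: bij_def inj_vimage_image_eq)
    show "\<sigma> ` A \<in> {A. A \<subseteq> S \<and> \<sigma> i \<in> A \<and> \<sigma> h \<in> A}" using A im by blast
  qed auto
qed

lemma weighted_tree_perm:
  assumes \<sigma>: "\<sigma> permutes S" and wt: "weighted_tree S E l"
  shows "weighted_tree S ((`) \<sigma> ` E) (\<lambda>A. l (\<sigma> -` A))"
proof -
  have b: "bij \<sigma>" and inj: "inj \<sigma>" and im: "\<sigma> ` S = S"
    using \<sigma> permutes_bij permutes_inj permutes_image by blast+
  note E = weighted_treeD[OF wt]
  have vi: "\<sigma> -` (\<sigma> ` A) = A" for A using inj by (simp add: inj_vimage_image_eq)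
  have iv: "\<sigma> ` (\<sigma> -` A) = A" for A using b by (simp add: bij_def surj_image_vimage_eq)
  have mem: "A \<in> (`) \<sigma> ` E \<longleftrightarrow> \<sigma> -` A \<in> E" for A using vi iv by (metis image_iff)
  have "rooted_tree S ((`) \<sigma> ` E)"
    unfolding rooted_tree_def
  proof (intro conjI ballI)
    show "(`) \<sigma> ` E \<subseteq> Pow S - {{}}" using E(1) im by blast
    show "S \<in> (`) \<sigma> ` E" using E(2) im by blast
    show "{i} \<in> (`) \<sigma> ` E" if "i \<in> S" for i
    proof -
      obtain j where "j \<in> S" "i = \<sigma> j" using im \<open>i \<in> S\<close> by blast
      then show ?thesis using E(3)[of j] by (intro image_eqI[of _ _ "{j}"]) auto
    qed
    fix A B assume "A \<in> (`) \<sigma> ` E" "B \<in> (`) \<sigma> ` E"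
    then obtain A' B' where "A' \<in> E" "B' \<in> E" "A = \<sigma> ` A'" "B = \<sigma> ` B'" by blast
    then show "A \<subseteq> B \<or> B \<subseteq> A \<or> A \<inter> B = {}"
      using E(4)[of A' B'] image_Int[OF inj, of A' B'] by auto
  qed
  moreover have "(\<Sum>A | A \<in> (`) \<sigma> ` E \<and> i \<in> A. l (\<sigma> -` A)) = 1" if i: "i \<in> S" for i
  proof -
    obtain j where j: "j \<in> S" "i = \<sigma> j" using im i by blast
    have "(\<Sum>A | A \<in> (`) \<sigma> ` E \<and> i \<in> A. l (\<sigma> -` A)) = (\<Sum>A | A \<in> E \<and> j \<in> A. l A)"
      by (rule sum.reindex_bij_witness[of _ "\<lambda>A. \<sigma> ` A" "\<lambda>A. \<sigma> -` A"]) (simp_all add: iv vi mem j del: image_vimage_eq)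
    then show ?thesis using E(8)[OF j(1)] by simp
  qed
  ultimately show ?thesis
    unfolding weighted_tree_def using E(5-7) mem by auto
qed

text \<open>
  With the family, the point of the total fibre and the tree all permuted, the coordinate at \<open>\<sigma> i\<close> becomes
  the original coordinate at \<open>i\<close>, because \<open>\<sigma>\<close> preserves distances.
\<close>

lemma J_equivariant:
  assumes fin: "finite S" and \<sigma>: "\<sigma> permutes S" and F: "F \<in> pts (tofib Y S)" and \<tau>: "\<tau> \<in> pts (tree_space S)"
  shows "J (perm_family \<sigma> Y) S (perm_tofib \<sigma> S F) (perm_tree \<sigma> \<tau>) = perm_smash \<sigma> (J Y S F \<tau>)"
proof (cases \<tau>)
  case None
  then show ?thesis by (simp add: J_def perm_tree_def perm_smash_def pts_tree_space)
next
  case (Some l)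
  note mem = permutes_in_image[OF \<sigma>]
  have inv: "inv \<sigma> (\<sigma> i) = i" "\<sigma> (inv \<sigma> i) = i" for i
    using \<sigma> by (simp_all add: permutes_inverses)
  have mem': "inv \<sigma> i \<in> S \<longleftrightarrow> i \<in> S" for i using mem[of "inv \<sigma> i"] inv by simp
  obtain E where wt: "weighted_tree S E l" and nd: "\<not> degenerate S l"
    using \<tau> Some by (auto simp: pts_tree_space)
  define l' where "l' = (\<lambda>A. l (\<sigma> -` A))"
  have wt': "weighted_tree S ((`) \<sigma> ` E) l'" unfolding l'_def by (rule weighted_tree_perm[OF \<sigma> wt])
  have vim: "\<sigma> -` {i} = {inv \<sigma> i}" for i by (simp add: bij_vimage_eq_inv_image[OF permutes_bij[OF \<sigma>]])
  have "\<sigma> -` S = S" using mem by auto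
  then have nd': "\<not> degenerate S l'"
    using nd mem' by (auto simp: degenerate_def l'_def vim)
  have fc: "fibre_coord (perm_family \<sigma> Y) S (perm_tofib \<sigma> S F) (meet_dist S l') i =
      fibre_coord Y S F (meet_dist S l) (inv \<sigma> i)" if i: "i \<in> S" for i
  proof -
    define p where "p = (\<lambda>h\<in>S - {i}. meet_dist S l' i h)"
    have p: "p \<in> topspace (cube (S - {i}))"
      unfolding p_def by (rule restrict_in_cube) (use meet_dist_bounds[OF fin wt' i] in auto)
    have "(\<lambda>k\<in>S - \<sigma> -` {i}. p (\<sigma> k)) = (\<lambda>k\<in>S - {inv \<sigma> i}. meet_dist S l (inv \<sigma> i) k)"
      unfolding vim
    proof (rule restrict_ext)
      fix k assume k: "k \<in> S - {inv \<sigma> i}"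
      then have "\<sigma> k \<in> S - {i}" using mem inv by auto
      then have "p (\<sigma> k) = meet_dist S l' (\<sigma> (inv \<sigma> i)) (\<sigma> k)" by (simp add: p_def inv)
      then show "p (\<sigma> k) = meet_dist S l (inv \<sigma> i) k"
        unfolding l'_def perm_tree_dist[OF \<sigma>] .
    qed
    then have "perm_tofib \<sigma> S F {i} p = map_option (\<lambda>(i, x). (\<sigma> i, x))
        (F {inv \<sigma> i} (\<lambda>k\<in>S - {inv \<sigma> i}. meet_dist S l (inv \<sigma> i) k))"
      using i p by (simp add: perm_tofib_def vim)
    then show ?thesis
      unfolding fibre_coord_def p_def[symmetric]
      by (auto simp: wedge_single_def perm_family_def split: option.splits)
  qed
  define y where "y = (\<lambda>i\<in>S. fibre_coord Y S F (meet_dist S l) i)"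
  have y': "(\<lambda>i\<in>S. fibre_coord (perm_family \<sigma> Y) S (perm_tofib \<sigma> S F) (meet_dist S l') i) = y \<circ> inv \<sigma>"
    using fc mem' by (auto simp: y_def fun_eq_iff restrict_def)
  have "(\<exists>i\<in>S. (y \<circ> inv \<sigma>) i = snd (perm_family \<sigma> Y i)) \<longleftrightarrow> (\<exists>i\<in>S. y i = snd (Y i))"
    using mem' mem inv unfolding perm_family_def o_def by metis
  then have "J_formula (perm_family \<sigma> Y) S (perm_tofib \<sigma> S F) l' = perm_smash \<sigma> (J_formula Y S F l)"
    unfolding J_formula_fibre_coord y' y_def[symmetric]
    by (auto simp: smash_pt_def collapse_pt_def perm_smash_def)
  moreover have "perm_tree \<sigma> \<tau> = Some l'" by (simp add: Some perm_tree_def l'_def)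
  moreover have "Some l' \<in> pts (tree_space S)" using wt' nd' by (auto simp: pts_tree_space)
  ultimately show ?thesis using \<tau> Some by (simp add: J_def)
qed

section \<open>The interpolating bracket\<close>

lemma loopsD:
  assumes "F \<in> pts (loops Z)"
  shows "F 0 = snd Z" "F 1 = snd Z" "x \<in> {0..1} \<Longrightarrow> F x \<in> pts Z"
  using assms by (auto simp: loops_def topspace_map_space continuous_map_def)

lemma continuous_map_loop_eval:
  assumes f: "continuous_map X (fst (loops Z)) f" and t: "continuous_map X unit_interval t"
  shows "continuous_map X (fst Z) (\<lambda>x. f x (t x))"
proof -
  have "continuous_map X (map_space unit_interval (fst Z)) f"
    using f by (simp add: loops_def continuous_map_in_subtopology)
  then have "continuous_map X (prod_topology (map_space unit_interval (fst Z)) unit_interval) (\<lambda>x. (f x, t x))"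
    using t by (simp add: continuous_map_pairedI)
  from continuous_map_compose[OF this continuous_map_eval[OF compact_Hausdorff_unit_interval]]
  show ?thesis by (simp add: o_def)
qed

lemma continuous_map_Max:
  fixes f :: "'i \<Rightarrow> 'x \<Rightarrow> real"
  assumes "finite I" "I \<noteq> {}" "\<And>i. i \<in> I \<Longrightarrow> continuous_map X euclideanreal (f i)"
  shows "continuous_map X euclideanreal (\<lambda>x. Max ((\<lambda>i. f i x) ` I))"
  using assms
proof (induction I rule: finite_ne_induct)
  case (singleton i)
  then show ?case by simp
next
  case (insert i I)
  have "continuous_map X euclideanreal (\<lambda>x. max (f i x) (Max ((\<lambda>i. f i x) ` I)))"
    using insert by (intro continuous_map_real_max) auto
  then show ?case using insert by simp
qed

text \<open>
  The two coordinates of \<open>phi \<theta> 1\<close>: a path along two sides of the unit square, from \<open>(1, 0)\<close> through \<open>(1, 1)\<close> to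
  \<open>(0, 1)\<close>.
\<close>

definition bracket1 :: "real \<Rightarrow> real" where
  "bracket1 \<theta> = min 1 (2 - 2 * \<theta>)"

definition bracket2 :: "real \<Rightarrow> real" where
  "bracket2 \<theta> = min 1 (2 * \<theta>)"

lemma phi_bracket: "phi \<theta> t = (bracket1 \<theta> * t, bracket2 \<theta> * t)"
  by (simp add: phi_def bracket1_def bracket2_def)

lemma bracket_range:
  assumes "\<theta> \<in> {0..1}"
  shows "bracket1 \<theta> \<in> {0..1}" "bracket2 \<theta> \<in> {0..1}" "bracket1 \<theta> = 1 \<or> bracket2 \<theta> = 1"
  using assms by (auto simp: bracket1_def bracket2_def min_def)

text \<open>
  The identity at \<open>s = 0\<close>. At \<open>s = 1\<close> the interval \<open>[1/4, 3/4]\<close>, on which a commutator moves along the two sides of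
  the square away from the axes, is stretched to the unit interval.
\<close>

definition shift_angle :: "real \<Rightarrow> real \<Rightarrow> real" where
  "shift_angle s \<theta> = max 0 (min 1 ((1 + s) * \<theta> - s / 2))"

lemma shift_angle_range: "shift_angle s \<theta> \<in> {0..1}"
  by (simp add: shift_angle_def)

text \<open>
  For \<open>a = 1\<close> division by zero gives the value 0, so values stay in the unit interval for all \<open>a \<le> 1\<close>.
\<close>

definition cut :: "real \<Rightarrow> real \<Rightarrow> real" where
  "cut a t = max 0 ((t - a) / (1 - a))"

lemma cut_range: "a \<le> 1 \<Longrightarrow> t \<le> 1 \<Longrightarrow> cut a t \<in> {0..1}"
  by (cases "a = 1") (simp_all add: cut_def divide_simps)

lemma cut_eq_0: "t \<le> a \<Longrightarrow> a \<le> 1 \<Longrightarrow> cut a t = 0"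
  using divide_nonpos_nonneg[of "t - a" "1 - a"] by (simp add: cut_def max_absorb1)

lemma cut_one: "a < 1 \<Longrightarrow> cut a 1 = 1"
  by (simp add: cut_def)

locale two_blocks =
  fixes Y :: "'i \<Rightarrow> 'a based" and S1 S2 :: "'i set"
  assumes fin: "finite S1" "finite S2" and ne: "S1 \<noteq> {}" "S2 \<noteq> {}" and dis: "S1 \<inter> S2 = {}"
    and based: "\<And>i. i \<in> S1 \<union> S2 \<Longrightarrow> based_space (Y i)"
begin

abbreviation S :: "'i set" where "S \<equiv> S1 \<union> S2"

abbreviation T :: "('i set \<Rightarrow> real) \<Rightarrow> 'i \<Rightarrow> 'i \<Rightarrow> real" where "T \<equiv> meet_dist S"

lemma finS: "finite S" using fin by simp

text \<open>
  The common shape of both brackets: the coordinates of two points of the total fibres over \<open>S1\<close> and \<open>S2\<close>,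
  assembled to a point of the smash product over the union.
\<close>

definition joint ::
  "('i, 'a) tofib_pt \<Rightarrow> ('i, 'a) tofib_pt \<Rightarrow> ('i \<Rightarrow> 'i \<Rightarrow> real) \<Rightarrow> ('i \<Rightarrow> 'a) option" where
  "joint F1 F2 p = smash_pt Y S
     (\<lambda>i\<in>S. if i \<in> S1 then fibre_coord Y S1 F1 p i else fibre_coord Y S2 F2 p i)"

lemma joint_NoneI1: "i \<in> S1 \<Longrightarrow> fibre_coord Y S1 F1 p i = snd (Y i) \<Longrightarrow> joint F1 F2 p = None"
  unfolding joint_def by (rule smash_pt_NoneI[of i]) auto

lemma joint_NoneI2: "i \<in> S2 \<Longrightarrow> fibre_coord Y S2 F2 p i = snd (Y i) \<Longrightarrow> joint F1 F2 p = None"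
  unfolding joint_def by (rule smash_pt_NoneI[of i]) (use dis in auto)

lemma joint_base:
  assumes "F1 = snd (tofib Y S1) \<or> F2 = snd (tofib Y S2)"
    and p: "\<And>i h. i \<in> S \<Longrightarrow> h \<in> S \<Longrightarrow> p i h \<in> {0..1}"
  shows "joint F1 F2 p = None"
proof -
  obtain i h where ih: "i \<in> S1" "h \<in> S2" using ne by blast
  show ?thesis
    using assms(1)
  proof
    assume "F1 = snd (tofib Y S1)"
    then show ?thesis
      by (intro joint_NoneI1[OF ih(1)]) (use fibre_coord_base[of i S1 p Y] ih p in auto)
  next
    assume "F2 = snd (tofib Y S2)"
    then show ?thesis
      by (intro joint_NoneI2[OF ih(2)]) (use fibre_coord_base[of h S2 p Y] ih p in auto)
  qed
qed

lemma joint_zero: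
  assumes "F1 \<in> pts (tofib Y S1)" "F2 \<in> pts (tofib Y S2)"
    and "R = S1 \<or> R = S2" "x \<in> R" "y \<in> R" "x \<noteq> y" "p x y = 0"
    and p: "\<And>i h. i \<in> S \<Longrightarrow> h \<in> S \<Longrightarrow> p i h \<in> {0..1}"
  shows "joint F1 F2 p = None"
  using assms(3)
proof
  assume "R = S1"
  then show ?thesis
    by (intro joint_NoneI1[of x] fibre_coord_zero[of _ _ _ _ y]) (use assms in auto)
next
  assume "R = S2"
  then show ?thesis
    by (intro joint_NoneI2[of x] fibre_coord_zero[of _ _ _ _ y]) (use assms in auto)
qed

lemma joint_one:
  assumes "F1 \<in> pts (tofib Y S1)" "F2 \<in> pts (tofib Y S2)"
    and "R = S1 \<or> R = S2" "x \<in> R" "y \<in> R" "x \<noteq> y" "p x y = 1" "p y x = 1"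
    and "\<And>k. k \<in> S \<Longrightarrow> p x k = p y k \<or> k \<in> {x, y}"
    and p: "\<And>i h. i \<in> S \<Longrightarrow> h \<in> S \<Longrightarrow> p i h \<in> {0..1}"
  shows "joint F1 F2 p = None"
  using assms(3)
proof
  assume R: "R = S1"
  have "fibre_coord Y S1 F1 p x = snd (Y x) \<or> fibre_coord Y S1 F1 p y = snd (Y y)"
    by (rule fibre_coord_one) (use assms R in auto)
  then show ?thesis
    using joint_NoneI1[of x F1 p] joint_NoneI1[of y F1 p] assms(4,5) R by metis
next
  assume R: "R = S2"
  have "fibre_coord Y S2 F2 p x = snd (Y x) \<or> fibre_coord Y S2 F2 p y = snd (Y y)"
    by (rule fibre_coord_one) (use assms R in auto)
  then show ?thesis
    using joint_NoneI2[of x F2 p] joint_NoneI2[of y F2 p] assms(4,5) R by metis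
qed

lemma joint_cong:
  assumes "\<And>i h. i \<in> S \<Longrightarrow> h \<in> S \<Longrightarrow> p i h = q i h"
  shows "joint F1 F2 p = joint F1 F2 q"
proof -
  have "fibre_coord Y S1 F1 p i = fibre_coord Y S1 F1 q i" if "i \<in> S1" for i
    by (rule fibre_coord_cong) (use assms that in auto)
  moreover have "fibre_coord Y S2 F2 p i = fibre_coord Y S2 F2 q i" if "i \<in> S2" for i
    by (rule fibre_coord_cong) (use assms that in auto)
  ultimately have "(\<lambda>i\<in>S. if i \<in> S1 then fibre_coord Y S1 F1 p i else fibre_coord Y S2 F2 p i) =
      (\<lambda>i\<in>S. if i \<in> S1 then fibre_coord Y S1 F1 q i else fibre_coord Y S2 F2 q i)"
    by (intro restrict_ext) auto
  then show ?thesis by (simp add: joint_def)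
qed

definition cross_dist :: "('i set \<Rightarrow> real) \<Rightarrow> real" where
  "cross_dist l = Max ((\<lambda>(i, h). T l i h) ` (S1 \<times> S2))"

lemma cross_dist_ge: "i \<in> S1 \<Longrightarrow> h \<in> S2 \<Longrightarrow> T l i h \<le> cross_dist l"
  unfolding cross_dist_def by (rule Max_ge) (use fin in auto)

lemma cross_dist_attained: obtains i h where "i \<in> S1" "h \<in> S2" "cross_dist l = T l i h"
proof -
  have "cross_dist l \<in> (\<lambda>(i, h). T l i h) ` (S1 \<times> S2)"
    unfolding cross_dist_def by (rule Max_in) (use fin ne in auto)
  then show ?thesis using that by auto
qed

lemma cross_dist_range:
  assumes "weighted_tree S E l" shows "cross_dist l \<in> {0..1}"
proof -
  obtain i h where "i \<in> S1" "h \<in> S2" "cross_dist l = T l i h" by (rule cross_dist_attained)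
  then show ?thesis using meet_dist_bounds[OF finS assms, of i h] by auto
qed

text \<open>
  The diagonal \<open>x = y\<close> is included: as \<open>T l x x = 1\<close>, a separated tree has \<open>cross_dist l < 1\<close>.
\<close>

definition separated :: "('i set \<Rightarrow> real) \<Rightarrow> bool" where
  "separated l \<longleftrightarrow> (\<forall>R\<in>{S1, S2}. \<forall>x\<in>R. \<forall>y\<in>R. cross_dist l < T l x y)"

text \<open>
  Moving \<open>i\<close> and \<open>h\<close> within their sides does not change \<open>T i h\<close>, since in an ultrametric triangle the two
  smallest distances agree.
\<close>

lemma separated_cross:
  assumes wt: "weighted_tree S E l" and sep: "separated l" and ih: "i \<in> S1" "h \<in> S2"
  shows "T l i h = cross_dist l"
proof -
  obtain i' h' where c: "i' \<in> S1" "h' \<in> S2" "cross_dist l = T l i' h'" by (rule cross_dist_attained)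
  have "min (T l i i') (T l i' h) \<le> T l i h" "min (T l i' h') (T l h' h) \<le> T l i' h"
    by (rule meet_dist_ultrametric[OF finS wt])+
  moreover have "cross_dist l < T l i i'" "cross_dist l < T l h' h" using sep c ih by (auto simp: separated_def)
  ultimately show ?thesis using cross_dist_ge[OF ih, of l] c(3) by (simp add: min_def split: if_splits)
qed

definition box_side :: "real \<Rightarrow> ('i set \<Rightarrow> real) \<Rightarrow> real" where
  "box_side s l = min 1 ((1 + 2 * s) * cross_dist l)"

definition floor_dist :: "real \<Rightarrow> ('i set \<Rightarrow> real) \<Rightarrow> real" where
  "floor_dist s l = max (cross_dist l) (s / 3)"

text \<open>
  The value of the homotopy at time \<open>s\<close>, loop parameter \<open>\<theta>\<close> and tree \<open>l\<close>: the two loops run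
  along two sides of a square of side \<open>box_side s l\<close>, while the distances are measured from the
  level \<open>floor_dist s l\<close> upwards.
\<close>

definition interp ::
  "real \<Rightarrow> (real \<Rightarrow> ('i, 'a) tofib_pt) \<Rightarrow> (real \<Rightarrow> ('i, 'a) tofib_pt) \<Rightarrow> real \<Rightarrow>
   ('i set \<Rightarrow> real) \<Rightarrow> ('i \<Rightarrow> 'a) option" where
  "interp s F1 F2 \<theta> l =
     joint (F1 (box_side s l * bracket1 (shift_angle s \<theta>))) (F2 (box_side s l * bracket2 (shift_angle s \<theta>)))
       (\<lambda>i h. cut (floor_dist s l) (T l i h))"

context
  fixes E l s assumes wt: "weighted_tree S E l" and s: "s \<in> {0..1 :: real}"
begin

lemma box_side_range: "box_side s l \<in> {0..1}"
  using cross_dist_range[OF wt] s by (simp add: box_side_def)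

lemma floor_dist_range: "floor_dist s l \<in> {0..1}"
  using cross_dist_range[OF wt] s by (auto simp: floor_dist_def max_def)

lemma cut_dist_range: "i \<in> S \<Longrightarrow> cut (floor_dist s l) (T l i h) \<in> {0..1}"
  by (rule cut_range) (use floor_dist_range meet_dist_bounds[OF finS wt] in auto)

lemma box_side_eq_1: "1 \<le> cross_dist l \<Longrightarrow> box_side s l = 1"
  using s mult_mono[of 1 "1 + 2 * s" 1 "cross_dist l"] by (simp add: box_side_def)

lemma product_range: "x \<in> {0..1} \<Longrightarrow> box_side s l * x \<in> {0..1}"
  using box_side_range mult_nonneg_nonneg[of "box_side s l" x] mult_le_one[of "box_side s l" x] by simp

context
  fixes F1 F2 assumes F: "F1 \<in> pts (loops (tofib Y S1))" "F2 \<in> pts (loops (tofib Y S2))"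
begin

lemma loop_values:
  "F1 (box_side s l * bracket1 (shift_angle s \<theta>)) \<in> pts (tofib Y S1)"
  "F2 (box_side s l * bracket2 (shift_angle s \<theta>)) \<in> pts (tofib Y S2)"
  by (rule loopsD(3)[OF F(1)] loopsD(3)[OF F(2)], rule product_range, rule bracket_range, rule shift_angle_range)+

lemma interp_box_side_1:
  assumes "box_side s l = 1" "\<And>i h. i \<in> S \<Longrightarrow> h \<in> S \<Longrightarrow> p i h \<in> {0..1}"
  shows "joint (F1 (box_side s l * bracket1 (shift_angle s \<theta>))) (F2 (box_side s l * bracket2 (shift_angle s \<theta>))) p = None"
  by (rule joint_base)
    (use bracket_range(3)[OF shift_angle_range[of s \<theta>]] loopsD(2)[OF F(1)] loopsD(2)[OF F(2)] assms in auto)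

lemma interp_cross_1: "1 \<le> cross_dist l \<Longrightarrow> interp s F1 F2 \<theta> l = None"
  unfolding interp_def by (rule interp_box_side_1) (use box_side_eq_1 cut_dist_range in auto)

lemma interp_small:
  assumes "R = S1 \<or> R = S2" "x \<in> R" "y \<in> R" "x \<noteq> y" "T l x y \<le> floor_dist s l"
  shows "interp s F1 F2 \<theta> l = None"
  unfolding interp_def
  by (rule joint_zero[OF loop_values assms(1-4)]) (use cut_eq_0 assms floor_dist_range cut_dist_range in auto)

lemma interp_not_separated:
  assumes "\<not> separated l" shows "interp s F1 F2 \<theta> l = None"
proof -
  obtain R x y where R: "R = S1 \<or> R = S2" "x \<in> R" "y \<in> R" "T l x y \<le> cross_dist l"
    using assms unfolding separated_def by fastforce
  show ?thesis
  proof (cases "x = y")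
    case True
    then have "T l x y = 1" using meet_dist_self[OF finS wt] R by blast
    then show ?thesis using interp_cross_1 R by simp
  next
    case False
    then show ?thesis using interp_small[OF R(1-3)] R(4) by (simp add: floor_dist_def)
  qed
qed

text \<open>
  A pair of leaves at distance 0 or 1 on the same side is treated as for \<open>J\<close>. If the two leaves are on
  different sides of a separated tree, their distance is \<open>cross_dist l\<close>; if it is 0 then the square shrinks to a point.
\<close>

lemma interp_degenerate:
  assumes "degenerate S l" shows "interp s F1 F2 \<theta> l = None"
proof (cases "separated l \<and> cross_dist l < 1")
  case False
  then show ?thesis using interp_not_separated interp_cross_1 by fastforce
next
  case True
  then have sep: "separated l" and c1: "cross_dist l < 1" by blast+
  obtain x y where xy: "x \<in> S" "y \<in> S" "x \<noteq> y" "T l x y = 0 \<or> T l x y = 1"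
    using degenerate_meet_dist[OF finS wt assms] by metis
  have "cross_dist l \<ge> 0" using cross_dist_range[OF wt] by simp
  show ?thesis
  proof (cases "\<exists>R\<in>{S1, S2}. x \<in> R \<and> y \<in> R")
    case False
    then consider "x \<in> S1" "y \<in> S2" | "x \<in> S2" "y \<in> S1" using xy by blast
    then have "T l x y = cross_dist l"
      using separated_cross[OF wt sep] meet_dist_commute[of S l x y] by cases auto
    then have "box_side s l = 0" using xy(4) c1 by (auto simp: box_side_def)
    then show ?thesis
      unfolding interp_def by (intro joint_base) (use loopsD(1)[OF F(1)] cut_dist_range in auto)
  next
    case True
    then obtain R where R: "R = S1 \<or> R = S2" "x \<in> R" "y \<in> R" by blast
    then have "T l x y > cross_dist l" using sep by (auto simp: separated_def)
    then have one: "T l x y = 1" using xy(4) \<open>cross_dist l \<ge> 0\<close> by auto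
    have eq: "T l x k = T l y k" if "k \<in> S" for k
      using meet_dist_ultrametric[OF finS wt, of x y k] meet_dist_ultrametric[OF finS wt, of y x k]
        meet_dist_bounds(2)[OF finS wt xy(1), of k] meet_dist_bounds(2)[OF finS wt xy(2), of k]
        one meet_dist_commute[of S l x y]
      by (simp add: min_def split: if_splits)
    have "floor_dist s l < 1" using c1 s by (simp add: floor_dist_def)
    then show ?thesis
      unfolding interp_def
      by (intro joint_one[OF loop_values R xy(3)])
        (use one eq cut_one meet_dist_commute[of S l x y] cut_dist_range in auto)
  qed
qed

end

end

lemma continuous_cross: "continuous_on X cross_dist"
proof -
  have "continuous_map (top_of_set X) euclideanreal (\<lambda>l. Max ((\<lambda>p. (\<lambda>p l. T l (fst p) (snd p)) p l) ` (S1 \<times> S2)))"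
    by (rule continuous_map_Max) (simp_all add: fin ne continuous_meet_dist)
  then show ?thesis by (simp add: cross_dist_def[abs_def] case_prod_unfold)
qed

text \<open>
  The distances fed to \<open>joint\<close> are continuous where \<open>cross_dist l < 1\<close>; on the remaining closed set
  \<open>joint\<close> is trivial for all distances.
\<close>

lemma continuous_interp:
  assumes cF1: "continuous_map X (fst (loops (tofib Y S1))) F1"
    and cF2: "continuous_map X (fst (loops (tofib Y S2))) F2"
    and cs': "continuous_map X unit_interval s" and c\<theta>': "continuous_map X unit_interval \<theta>"
    and cl: "continuous_map X (top_of_set {l. \<exists>E. weighted_tree S E l}) l"
  shows "continuous_map X (fst (bsmash Y S)) (\<lambda>x. interp (s x) (F1 x) (F2 x) (\<theta> x) (l x))"
proof -
  have cs: "continuous_map X euclideanreal s" and c\<theta>: "continuous_map X euclideanreal \<theta>"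
    using cs' c\<theta>' by (simp_all add: continuous_map_in_subtopology)
  have cc: "continuous_map X euclideanreal (\<lambda>x. cross_dist (l x))"
    using continuous_map_compose[OF cl, of euclideanreal cross_dist] continuous_cross by (simp add: o_def)
  have cT: "continuous_map X euclideanreal (\<lambda>x. T (l x) i h)" for i h
    using continuous_map_compose[OF cl, of euclideanreal "\<lambda>l. T l i h"] by (simp add: o_def continuous_meet_dist)
  have range: "\<exists>E. weighted_tree S E (l x)" "s x \<in> {0..1}" "F1 x \<in> pts (loops (tofib Y S1))"
    "F2 x \<in> pts (loops (tofib Y S2))" if "x \<in> topspace X" for x
    using that cF1 cF2 cs' cl by (auto simp: continuous_map_def Pi_iff)
  define \<alpha> \<beta> where "\<alpha> = (\<lambda>x. box_side (s x) (l x) * bracket1 (shift_angle (s x) (\<theta> x)))"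
    and "\<beta> = (\<lambda>x. box_side (s x) (l x) * bracket2 (shift_angle (s x) (\<theta> x)))"
  have "continuous_map X euclideanreal \<alpha>" "continuous_map X euclideanreal \<beta>"
    unfolding \<alpha>_def \<beta>_def box_side_def bracket1_def bracket2_def shift_angle_def
    by (intro continuous_intros cs c\<theta> cc; simp)+
  moreover have "\<alpha> x \<in> {0..1}" "\<beta> x \<in> {0..1}" if "x \<in> topspace X" for x
    unfolding \<alpha>_def \<beta>_def using range[OF that] product_range bracket_range(1,2)[OF shift_angle_range] by blast+
  ultimately have c\<alpha>: "continuous_map X unit_interval \<alpha>" and c\<beta>: "continuous_map X unit_interval \<beta>"
    by (auto simp: continuous_map_in_subtopology)
  let ?P = "cube (S \<times> S)"
  define \<Phi> where "\<Phi> = (\<lambda>x q. joint (F1 x (\<alpha> x)) (F2 x (\<beta> x)) (\<lambda>i h. q (i, h)))"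
  define p where "p = (\<lambda>x. \<lambda>(i, h)\<in>S \<times> S. cut (floor_dist (s x) (l x)) (T (l x) i h))"
  define D where "D = {x \<in> topspace X. cross_dist (l x) < 1}"
  have DX: "topspace (subtopology X D) \<subseteq> topspace X" by auto
  have cv1: "continuous_map (prod_topology X ?P) (fst (tofib Y S1)) (\<lambda>z. F1 (fst z) (\<alpha> (fst z)))"
    using continuous_map_compose[OF continuous_map_fst continuous_map_loop_eval[OF cF1 c\<alpha>]] by (simp add: o_def)
  have cv2: "continuous_map (prod_topology X ?P) (fst (tofib Y S2)) (\<lambda>z. F2 (fst z) (\<beta> (fst z)))"
    using continuous_map_compose[OF continuous_map_fst continuous_map_loop_eval[OF cF2 c\<beta>]] by (simp add: o_def)
  have cq: "continuous_map (prod_topology X ?P) unit_interval (\<lambda>z. snd z (i, h))" if "i \<in> S" "h \<in> S" for i h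
    using continuous_map_compose[OF continuous_map_snd
        continuous_map_product_projection[of "(i, h)" "S \<times> S" "\<lambda>_. unit_interval", folded cube_def]] that
    by (simp add: o_def)
  have "continuous_map (prod_topology X ?P) (fst (bsmash Y S)) (\<lambda>z. \<Phi> (fst z) (snd z))"
    unfolding \<Phi>_def joint_def
  proof (rule continuous_map_smash_pt)
    fix i assume i: "i \<in> S"
    show "continuous_map (prod_topology X ?P) (fst (Y i)) (\<lambda>z. if i \<in> S1
        then fibre_coord Y S1 (F1 (fst z) (\<alpha> (fst z))) (\<lambda>i h. snd z (i, h)) i
        else fibre_coord Y S2 (F2 (fst z) (\<beta> (fst z))) (\<lambda>i h. snd z (i, h)) i)"
    proof (cases "i \<in> S1")
      case True
      then show ?thesis
        using continuous_map_fibre_coord[OF based[OF i] True cv1, of "\<lambda>z i h. snd z (i, h)"] cq by simp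
    next
      case False
      then have "i \<in> S2" using i by blast
      then show ?thesis
        using continuous_map_fibre_coord[OF based[OF i] _ cv2, of "\<lambda>z i h. snd z (i, h)"] cq False by simp
    qed
  qed
  then have \<Phi>: "continuous_map (prod_topology X ?P) (fst (bsmash Y S)) (\<lambda>(x, q). \<Phi> x q)"
    by (simp add: case_prod_unfold)
  have pP: "p x \<in> topspace ?P" if "x \<in> topspace X" for x
    unfolding p_def by (rule restrict_in_cube) (use cut_dist_range range[OF that] in auto)
  have D: "openin X D"
    using openin_continuous_map_preimage[OF cc, of "{..<1}"] by (simp add: D_def)
  have "continuous_map X (fst (bsmash Y S)) (\<lambda>x. \<Phi> x (p x))"
  proof (rule continuous_map_blow_down[OF \<Phi> compact_Hausdorff_cube(1) D _ pP])
    have sub: "continuous_map (subtopology X D) euclideanreal f" if "continuous_map X euclideanreal f" for f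
      using that by (rule continuous_map_from_subtopology)
    have "continuous_map (subtopology X D) unit_interval (\<lambda>x. cut (floor_dist (s x) (l x)) (T (l x) i h))"
      if "i \<in> S" "h \<in> S" for i h
      unfolding continuous_map_in_subtopology
    proof
      have "1 - max (cross_dist (l x)) (s x / 3) \<noteq> 0" if "x \<in> topspace (subtopology X D)" for x
        using that range(2)[of x] by (auto simp: D_def max_def)
      then show "continuous_map (subtopology X D) euclideanreal (\<lambda>x. cut (floor_dist (s x) (l x)) (T (l x) i h))"
        unfolding cut_def floor_dist_def
        by (intro continuous_map_real_max continuous_map_real_divide continuous_map_diff
            sub cs cc cT continuous_map_canonical_const) simp_all
      show "(\<lambda>x. cut (floor_dist (s x) (l x)) (T (l x) i h)) \<in> topspace (subtopology X D) \<rightarrow> {0..1}"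
        using cut_dist_range range that DX by blast
    qed
    then show "continuous_map (subtopology X D) ?P p"
      unfolding cube_def continuous_map_componentwise p_def by auto
    show "\<Phi> x q = \<Phi> x (p x)" if x: "x \<in> topspace X" "x \<notin> D" and q: "q \<in> topspace ?P" for x q
    proof -
      obtain E where wt: "weighted_tree S E (l x)" using range(1)[OF x(1)] by blast
      have "1 \<le> cross_dist (l x)" using x by (simp add: D_def)
      then have sc: "box_side (s x) (l x) = 1" by (rule box_side_eq_1[OF wt range(2)[OF x(1)]])
      have "\<Phi> x q' = None" if "q' \<in> topspace ?P" for q'
        unfolding \<Phi>_def \<alpha>_def \<beta>_def
        by (rule interp_box_side_1[OF wt range(2-4)[OF x(1)] sc])
          (use that in \<open>auto simp: topspace_cube PiE_iff\<close>)
      then show ?thesis using q pP[OF x(1)] by simp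
    qed
  qed
  moreover have "\<Phi> x (p x) = interp (s x) (F1 x) (F2 x) (\<theta> x) (l x)" for x
    unfolding \<Phi>_def interp_def \<alpha>_def \<beta>_def by (rule joint_cong) (simp add: p_def)
  ultimately show ?thesis by simp
qed

end

section \<open>The start of the homotopy: the grafting bracket\<close>

context two_blocks
begin

lemma joint_eq_smash_join:
  "joint F1 F2 p = smash_join S1 S2 (collapse_pt {(z, w). z = None \<or> w = None}
     (smash_pt Y S1 (\<lambda>i\<in>S1. fibre_coord Y S1 F1 p i), smash_pt Y S2 (\<lambda>i\<in>S2. fibre_coord Y S2 F2 p i)))"
proof -
  define y1 y2 where "y1 = fibre_coord Y S1 F1 p" and "y2 = fibre_coord Y S2 F2 p"
  have n1: "(\<exists>i\<in>S1. (\<lambda>i\<in>S1. y1 i) i = snd (Y i)) \<longleftrightarrow> (\<exists>i\<in>S1. y1 i = snd (Y i))"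
    and n2: "(\<exists>i\<in>S2. (\<lambda>i\<in>S2. y2 i) i = snd (Y i)) \<longleftrightarrow> (\<exists>i\<in>S2. y2 i = snd (Y i))"
    by (intro bex_cong; simp)+
  have "(\<exists>i\<in>S. (\<lambda>i\<in>S. if i \<in> S1 then y1 i else y2 i) i = snd (Y i)) \<longleftrightarrow>
      (\<exists>i\<in>S1. y1 i = snd (Y i)) \<or> (\<exists>i\<in>S2. y2 i = snd (Y i))"
    using dis by (auto simp: bex_Un disjoint_iff)
  moreover have "(\<lambda>i\<in>S. if i \<in> S1 then (\<lambda>i\<in>S1. y1 i) i else (\<lambda>i\<in>S2. y2 i) i) = (\<lambda>i\<in>S. if i \<in> S1 then y1 i else y2 i)"
    by (rule restrict_ext) auto
  ultimately show ?thesis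
    unfolding joint_def smash_pt_def collapse_pt_def y1_def[symmetric] y2_def[symmetric]
    using n1 n2 by (simp add: smash_join_def)
qed

text \<open>
  On a grafting, \<open>cross_dist l\<close> is the length of the root edge and the distances in the branches are those of
  \<open>interp 0\<close>. Off the graftings the tree is not separated and both sides are trivial.
\<close>

lemma interp_graft:
  assumes F: "F1 \<in> pts (loops (tofib Y S1))" "F2 \<in> pts (loops (tofib Y S2))"
    and \<theta>: "\<theta> \<in> {0..1}" and wt: "weighted_tree S E l" and nd: "\<not> degenerate S l"
  shows "smash_join S1 S2 (graft_prod (bsmash Y S1) (bsmash Y S2) S1 S2
           (loops_map (J Y S1) F1, loops_map (J Y S2) F2) \<theta> (Some l)) = interp 0 F1 F2 \<theta> l"
proof -
  have \<tau>: "Some l \<in> pts (tree_space S)" using wt nd by (auto simp: pts_tree_space)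
  have s0: "(0::real) \<in> {0..1}" by simp
  show ?thesis
  proof (cases "grafting S1 S2 l")
    case False
    obtain R x y i h where "R = S1 \<or> R = S2" "x \<in> R" "y \<in> R" "i \<in> S1" "h \<in> S2" "T l x y < T l i h"
      using not_grafting_meet_dist[OF finS wt ne dis False] by metis
    then have "\<not> separated l" using cross_dist_ge[of i h l] by (force simp: separated_def)
    then have "interp 0 F1 F2 \<theta> l = None" by (rule interp_not_separated[OF wt s0 F])
    moreover have "ungraft S1 S2 (Some l) = None" using False by (simp add: ungraft_def)
    ultimately show ?thesis using \<theta> \<tau> by (simp add: graft_prod_def smash_join_def)
  next
    case True
    define r where "r = l S"
    note E = weighted_treeD[OF wt]
    obtain i h where ih: "i \<in> S1" "h \<in> S2" using ne by blast
    have r0: "0 < r" using nd E(6)[of S] by (simp add: degenerate_def r_def)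
    \<comment> \<open>The leaf edge of \<open>i\<close> has positive length and differs from the root edge, which is thus shorter than 1.\<close>
    have "l S + l {i} = (\<Sum>A\<in>{S, {i}}. l A)" using ih dis by (subst sum.insert) auto
    also have "\<dots> \<le> (\<Sum>A | A \<in> E \<and> i \<in> A. l A)"
      by (rule sum_mono2) (use finite_edges[OF finS wt] E ih in auto)
    also have "\<dots> = 1" using E(8) ih by simp
    finally have "l S + l {i} \<le> 1" .
    moreover have "l {i} > 0" using nd ih E(6)[of "{i}"] by (force simp: degenerate_def)
    ultimately have r1: "r < 1" by (simp add: r_def)
    have crossr: "cross_dist l = r"
      using cross_dist_attained[of l] grafting_cross_dist[OF finS dis True] r_def by metis
    define b1 b2 where "b1 = branch S S1 l" and "b2 = branch S S2 l"
    have True': "grafting S2 S1 l" using True grafting_commute by blast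
    obtain E1 E2 where wt1: "weighted_tree S1 E1 b1" and wt2: "weighted_tree S2 E2 b2"
      using grafting_branch(1)[OF finS dis ne(2) True r1[unfolded r_def]]
        grafting_branch(1)[of S2 S1 l] finS dis ne(1) True' r1
      by (auto simp: b1_def b2_def r_def Un_commute Int_commute)
    have T1: "meet_dist S1 b1 i h = (T l i h - r) / (1 - r)" if "i \<in> S1" "h \<in> S1" for i h
      using grafting_branch(2)[OF finS dis ne(2) True r1[unfolded r_def] that] by (simp add: b1_def r_def)
    have T2: "meet_dist S2 b2 i h = (T l i h - r) / (1 - r)" if "i \<in> S2" "h \<in> S2" for i h
      using grafting_branch(2)[of S2 S1 l i h] finS dis ne(1) True' r1 that
      by (simp add: b2_def r_def Un_commute Int_commute)
    have cut1: "cut r (T l i h) = meet_dist S1 b1 i h" if "i \<in> S1" "h \<in> S1" for i h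
      using meet_dist_bounds(1)[OF fin(1) wt1 that(1), of h] T1[OF that] by (simp add: cut_def)
    have cut2: "cut r (T l i h) = meet_dist S2 b2 i h" if "i \<in> S2" "h \<in> S2" for i h
      using meet_dist_bounds(1)[OF fin(2) wt2 that(1), of h] T2[OF that] by (simp add: cut_def)
    define \<theta>1 \<theta>2 where "\<theta>1 = r * bracket1 \<theta>" and "\<theta>2 = r * bracket2 \<theta>"
    have \<theta>12: "\<theta>1 \<in> {0..1}" "\<theta>2 \<in> {0..1}"
      using bracket_range[OF \<theta>] r0 r1 mult_le_one[of r "bracket1 \<theta>"] mult_le_one[of r "bracket2 \<theta>"]
      by (simp_all add: \<theta>1_def \<theta>2_def)
    have FF: "F1 \<theta>1 \<in> pts (tofib Y S1)" "F2 \<theta>2 \<in> pts (tofib Y S2)"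
      using loopsD(3)[OF F(1) \<theta>12(1)] loopsD(3)[OF F(2) \<theta>12(2)] by blast+
    let ?C = "{(z, w). z = None \<or> w = None}"
    let ?p = "\<lambda>i h. cut r (T l i h)"
    have "interp 0 F1 F2 \<theta> l = joint (F1 \<theta>1) (F2 \<theta>2) ?p"
      using \<theta> r0 r1 by (simp add: interp_def box_side_def floor_dist_def crossr shift_angle_def \<theta>1_def \<theta>2_def)
    also have "\<dots> = smash_join S1 S2 (collapse_pt ?C (J_formula Y S1 (F1 \<theta>1) b1, J_formula Y S2 (F2 \<theta>2) b2))"
    proof -
      have "fibre_coord Y S1 (F1 \<theta>1) ?p i = fibre_coord Y S1 (F1 \<theta>1) (meet_dist S1 b1) i" if "i \<in> S1" for i
        by (rule fibre_coord_cong) (use cut1 that in auto)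
      moreover have "fibre_coord Y S2 (F2 \<theta>2) ?p i = fibre_coord Y S2 (F2 \<theta>2) (meet_dist S2 b2) i" if "i \<in> S2" for i
        by (rule fibre_coord_cong) (use cut2 that in auto)
      ultimately show ?thesis
        unfolding joint_eq_smash_join J_formula_fibre_coord by (simp cong: restrict_cong)
    qed
    also have "\<dots> = smash_join S1 S2 (graft_prod (bsmash Y S1) (bsmash Y S2) S1 S2
        (loops_map (J Y S1) F1, loops_map (J Y S2) F2) \<theta> (Some l))"
    proof (cases "degenerate S1 b1 \<or> degenerate S2 b2")
      case deg: True
      then have "ungraft S1 S2 (Some l) = None"
        using True r0 r1
        by (auto simp: ungraft_def collapse_pt_def tree_class_def b1_def b2_def)
      moreover have "J_formula Y S1 (F1 \<theta>1) b1 = None \<or> J_formula Y S2 (F2 \<theta>2) b2 = None"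
        using deg J_formula_degenerate[OF fin(1) wt1 _ FF(1)] J_formula_degenerate[OF fin(2) wt2 _ FF(2)] by auto
      ultimately show ?thesis using \<theta> \<tau> by (auto simp: graft_prod_def collapse_pt_def)
    next
      case False
      then have "ungraft S1 S2 (Some l) = Some (r, Some b1, Some b2)"
        using True r0 r1 by (simp add: ungraft_def collapse_pt_def tree_class_def b1_def b2_def r_def)
      moreover have "Some b1 \<in> pts (tree_space S1)" "Some b2 \<in> pts (tree_space S2)"
        using wt1 wt2 False by (auto simp: pts_tree_space)
      moreover have "phi \<theta> r = (\<theta>1, \<theta>2)" by (simp add: phi_bracket \<theta>1_def \<theta>2_def mult.commute)
      ultimately show ?thesis
        using \<theta> \<tau> \<theta>12 by (simp add: graft_prod_def loops_map_def J_def snd_bsmash)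
    qed
    finally show ?thesis by simp
  qed
qed

end

section \<open>The end of the homotopy: the Samelson bracket\<close>

lemma unit_interval_mult: "a \<in> {0..1} \<Longrightarrow> b \<in> {0..1} \<Longrightarrow> a * b \<in> {0..1 :: real}"
  by (simp add: mult_le_one)

text \<open>
  The path \<open>(trapezoid1, trapezoid2)\<close> runs once around the boundary of the unit square, in the four
  steps of a commutator.
\<close>

definition trapezoid1 :: "real \<Rightarrow> real" where
  "trapezoid1 \<theta> = (if \<theta> \<le> 1/4 then 4 * \<theta> else if \<theta> \<le> 1/2 then 1 else if \<theta> \<le> 3/4 then 3 - 4 * \<theta> else 0)"

definition trapezoid2 :: "real \<Rightarrow> real" where
  "trapezoid2 \<theta> = (if \<theta> \<le> 1/4 then 0 else if \<theta> \<le> 1/2 then 4 * \<theta> - 1 else if \<theta> \<le> 3/4 then 1 else 4 - 4 * \<theta>)"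

lemma trapezoid_range:
  assumes "\<theta> \<in> {0..1}" shows "trapezoid1 \<theta> \<in> {0..1}" "trapezoid2 \<theta> \<in> {0..1}"
  using assms by (auto simp: trapezoid1_def trapezoid2_def)

lemma trapezoid_boundary:
  "trapezoid1 \<theta> \<in> {0, 1} \<or> trapezoid2 \<theta> \<in> {0, 1}"
  by (simp add: trapezoid1_def trapezoid2_def)

text \<open>
  The angle stretched at time \<open>s = 1\<close> is \<open>2 \<theta> - 1/2\<close>, clipped to the unit interval: the boundary of the square is followed at the
  speed of the commutator on its second and third quarter, and \<open>shift_angle\<close> rests at the ends on the first and
  last quarter, where on both paths the same loop is at time 0.
\<close>

lemma trapezoid_bracket:
  assumes "\<theta> \<in> {0..1}"
  shows "(trapezoid1 \<theta> = bracket1 (shift_angle 1 \<theta>) \<and> trapezoid2 \<theta> = bracket2 (shift_angle 1 \<theta>)) \<or>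
    (trapezoid2 \<theta> = 0 \<and> bracket2 (shift_angle 1 \<theta>) = 0) \<or>
    (trapezoid1 \<theta> = 0 \<and> bracket1 (shift_angle 1 \<theta>) = 0)"
  using assms
  by (simp add: trapezoid1_def trapezoid2_def bracket1_def bracket2_def shift_angle_def min_def max_def)

lemma commutator_trivial2:
  assumes "\<theta> \<in> {0..1}" "\<gamma> 0 = b" "\<gamma> 1 = b" "\<And>x. x \<in> {0..1} \<Longrightarrow> \<delta> x = b"
  shows "commutator \<gamma> \<delta> \<theta> = \<gamma> (trapezoid1 \<theta>)"
  using assms by (auto simp: commutator_def trapezoid1_def)

lemma commutator_trivial1:
  assumes "\<theta> \<in> {0..1}" "\<gamma> 0 = b" "\<gamma> 1 = b" "\<And>x. x \<in> {0..1} \<Longrightarrow> \<delta> x = b"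
  shows "commutator \<delta> \<gamma> \<theta> = \<gamma> (trapezoid2 \<theta>)"
  using assms by (auto simp: commutator_def trapezoid2_def)

lemma comm_null1_trapezoid: "\<gamma> 0 = b \<Longrightarrow> comm_null1 b \<gamma> t \<theta> = \<gamma> (t * trapezoid1 \<theta>)"
  by (simp add: comm_null1_def trapezoid1_def mult.commute)

lemma comm_null2_trapezoid: "\<gamma> 0 = b \<Longrightarrow> comm_null2 b \<gamma> t \<theta> = \<gamma> (t * trapezoid2 \<theta>)"
  by (simp add: comm_null2_def trapezoid2_def mult.commute)

lemma cube_coord: "t \<in> topspace (cube R) \<Longrightarrow> k \<in> R \<Longrightarrow> t k \<in> {0..1}"
  unfolding topspace_cube by (rule PiE_mem)

lemma min_coord_le: "finite R \<Longrightarrow> k \<in> R \<Longrightarrow> min_coord R t \<le> t k"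
  by (auto simp: min_coord_def)

lemma min_coord_attained:
  assumes "finite R" "R \<noteq> {}" obtains k where "k \<in> R" "min_coord R t = t k"
proof -
  have "Min (t ` R) \<in> t ` R" using assms by (intro Min_in) auto
  then obtain k where "k \<in> R" "Min (t ` R) = t k" by blast
  then show ?thesis using that assms(2) by (simp add: min_coord_def)
qed

lemma min_coord_range:
  assumes "finite R" "\<And>k. k \<in> R \<Longrightarrow> t k \<in> {0..1}" shows "min_coord R t \<in> {0..1}"
proof (cases "R = {}")
  case False
  obtain k where "k \<in> R" "min_coord R t = t k" by (rule min_coord_attained[OF assms(1) False, of t])
  then show ?thesis using assms(2)[of k] by metis
qed (simp add: min_coord_def)

lemma min_coord_empty: "min_coord {} t = 1"
  by (simp add: min_coord_def)

lemma rescale_in_cube: "(\<And>k. k \<in> R \<Longrightarrow> t k \<in> {0..1}) \<Longrightarrow> rescale R t \<in> topspace (cube R)"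
  unfolding rescale_def by (rule restrict_in_cube) auto

lemma tofib_rescale_zero:
  assumes "G \<in> pts (tofib Y R)" "i \<in> R" "finite R" "\<And>k. k \<in> R - {i} \<Longrightarrow> t k \<in> {0..1}"
    and "k \<in> R - {i}" "t k \<le> 1/3"
  shows "G {i} (rescale (R - {i}) t) = None"
  by (rule tofibD(2)[OF assms(1) _ rescale_in_cube, of _ _ k]) (use assms in \<open>auto simp: rescale_def\<close>)

lemma tofib_base_value:
  assumes "i \<in> R" "p \<in> topspace (cube (R - {i}))"
  shows "snd (tofib Y R) {i} p = None"
  using assms by (simp add: tofib_def)

context two_blocks
begin

context
  fixes F1 F2 \<theta>
  assumes F: "F1 \<in> pts (loops (tofib Y S1))" "F2 \<in> pts (loops (tofib Y S2))"
    and \<theta>: "\<theta> \<in> {0..1 :: real}"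
begin

text \<open>
  The loop \<open>F2\<close> contributes only its component over the empty set, which is trivial, so each of the three cases of
  the bracket degenerates. If \<open>m1 \<le> 1/3\<close>, some rescaled distance within \<open>S1\<close> vanishes and \<open>F1\<close> is
  trivial as well.
\<close>

lemma samelson_leaf1:
  assumes i: "i \<in> S1" and t: "t \<in> topspace (cube (S - {i}))"
  shows "samelson_prod S1 S2 (F1, F2) \<theta> {i} t =
    F1 (min 1 (3 * min_coord S2 t) * trapezoid1 \<theta>) {i} (rescale (S1 - {i}) t)"
proof -
  define \<gamma>1 \<gamma>2 where "\<gamma>1 = rescaled_loop S1 F1 {i} t" and "\<gamma>2 = rescaled_loop S2 F2 {i} t"
  define m1 m2 where "m1 = min_coord (S1 - {i}) t" and "m2 = min_coord S2 t"
  have tk: "t k \<in> {0..1}" if "k \<in> S - {i}" for k using t that by (rule cube_coord)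
  have i2: "i \<notin> S2" using i dis by blast
  have [simp]: "S2 - {i} = S2" "{i} \<inter> S1 = {i}" "{i} \<inter> S2 = {}" using i i2 by auto
  have q: "rescale (S1 - {i}) t \<in> topspace (cube (S1 - {i}))" "rescale S2 t \<in> topspace (cube S2)"
    by (rule rescale_in_cube; rule tk; use i2 in blast)+
  have \<gamma>1: "\<gamma>1 x = F1 x {i} (rescale (S1 - {i}) t)" and \<gamma>2: "\<gamma>2 x = F2 x {} (rescale S2 t)" for x
    by (simp_all add: \<gamma>1_def \<gamma>2_def rescaled_loop_def)
  have g2: "\<gamma>2 x = None" if "x \<in> {0..1}" for x
    unfolding \<gamma>2 by (rule tofib_empty_wedge[OF loopsD(3)[OF F(2) that] q(2)])
  have g1: "\<gamma>1 0 = None" "\<gamma>1 1 = None"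
    unfolding \<gamma>1 loopsD(1,2)[OF F(1)] using tofib_base_value[OF i q(1)] by auto
  have m1: "m1 \<in> {0..1}" unfolding m1_def by (rule min_coord_range) (use fin tk in auto)
  have m2: "m2 \<in> {0..1}" unfolding m2_def by (rule min_coord_range) (use fin tk i2 in auto)
  have red: "samelson_prod S1 S2 (F1, F2) \<theta> {i} t =
     (if \<forall>k\<in>S - {i}. t k \<ge> 1/3 then commutator \<gamma>1 \<gamma>2 \<theta>
      else if m1 \<le> 1/3 then comm_null2 None \<gamma>2 (3 * m1) \<theta> else comm_null1 None \<gamma>1 (3 * m2) \<theta>)"
    using \<theta> i t by (simp add: samelson_prod_def Let_def \<gamma>1_def \<gamma>2_def m1_def m2_def)
  obtain k2 where k2: "k2 \<in> S2" "m2 = t k2" unfolding m2_def by (rule min_coord_attained[OF fin(2) ne(2)])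
  have "samelson_prod S1 S2 (F1, F2) \<theta> {i} t = \<gamma>1 (min 1 (3 * m2) * trapezoid1 \<theta>)"
  proof (cases "\<forall>k\<in>S - {i}. t k \<ge> 1/3")
    case True
    moreover have "k2 \<in> S - {i}" using k2(1) i2 by blast
    ultimately have "1/3 \<le> t k2" by blast
    then have "min 1 (3 * m2) = 1" by (simp add: k2(2))
    then show ?thesis using red True commutator_trivial2[of \<theta> \<gamma>1 None \<gamma>2, OF \<theta> g1 g2] by simp
  next
    case not_all: False
    show ?thesis
    proof (cases "m1 \<le> 1/3")
      case True
      have "S1 - {i} \<noteq> {}"
      proof
        assume e: "S1 - {i} = {}"
        have "m1 = 1" unfolding m1_def e by (rule min_coord_empty)
        then show False using True by simp
      qed
      then obtain k where k: "k \<in> S1 - {i}" "m1 = t k"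
        unfolding m1_def by (rule min_coord_attained[OF finite_Diff[OF fin(1)]])
      have "\<gamma>1 x = None" if "x \<in> {0..1}" for x
        unfolding \<gamma>1 by (rule tofib_rescale_zero[OF loopsD(3)[OF F(1) that] i fin(1) _ k(1)]) (use tk k True in auto)
      moreover have "min 1 (3 * m2) * trapezoid1 \<theta> \<in> {0..1}" "3 * m1 * trapezoid2 \<theta> \<in> {0..1}"
        by (rule unit_interval_mult; use trapezoid_range[OF \<theta>] m1 m2 True in simp)+
      ultimately show ?thesis
        unfolding red if_not_P[OF not_all] if_P[OF True]
        using g2 comm_null2_trapezoid[of \<gamma>2 None "3 * m1" \<theta>] by simp
    next
      case False
      have "\<exists>k\<in>S2. t k < 1/3"
      proof (rule ccontr)
        assume "\<not> (\<exists>k\<in>S2. t k < 1/3)"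
        then obtain k where "k \<in> S1 - {i}" "t k < 1/3" using not_all by force
        then show False using min_coord_le[of "S1 - {i}" k t] fin False m1_def by simp
      qed
      then obtain k where "k \<in> S2" "t k < 1/3" by blast
      then have "3 * m2 < 1" using min_coord_le[OF fin(2), of k t] m2_def by simp
      then show ?thesis
        unfolding red if_not_P[OF not_all] if_not_P[OF False]
        using comm_null1_trapezoid[of \<gamma>1 None "3 * m2" \<theta>] g1 by simp
    qed
  qed
  then show ?thesis by (simp add: \<gamma>1 m2_def)
qed

text \<open>
  As for leaves of \<open>S1\<close>, but the test on \<open>m1\<close> comes first in the definition of the bracket, so a
  leaf of \<open>S2\<close> with a vanishing rescaled distance may reach either nullhomotopy.
\<close>

lemma samelson_leaf2:
  assumes i: "i \<in> S2" and t: "t \<in> topspace (cube (S - {i}))"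
  shows "samelson_prod S1 S2 (F1, F2) \<theta> {i} t =
    F2 (min 1 (3 * min_coord S1 t) * trapezoid2 \<theta>) {i} (rescale (S2 - {i}) t)"
proof -
  define \<gamma>1 \<gamma>2 where "\<gamma>1 = rescaled_loop S1 F1 {i} t" and "\<gamma>2 = rescaled_loop S2 F2 {i} t"
  define m1 m2 where "m1 = min_coord S1 t" and "m2 = min_coord (S2 - {i}) t"
  have tk: "t k \<in> {0..1}" if "k \<in> S - {i}" for k using t that by (rule cube_coord)
  have i1: "i \<notin> S1" using i dis by blast
  have [simp]: "S1 - {i} = S1" "{i} \<inter> S2 = {i}" "{i} \<inter> S1 = {}" using i i1 by auto
  have q: "rescale (S2 - {i}) t \<in> topspace (cube (S2 - {i}))" "rescale S1 t \<in> topspace (cube S1)"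
    by (rule rescale_in_cube; rule tk; use i1 in blast)+
  have \<gamma>2: "\<gamma>2 x = F2 x {i} (rescale (S2 - {i}) t)" and \<gamma>1: "\<gamma>1 x = F1 x {} (rescale S1 t)" for x
    by (simp_all add: \<gamma>1_def \<gamma>2_def rescaled_loop_def)
  have g1: "\<gamma>1 x = None" if "x \<in> {0..1}" for x
    unfolding \<gamma>1 by (rule tofib_empty_wedge[OF loopsD(3)[OF F(1) that] q(2)])
  have g2: "\<gamma>2 0 = None" "\<gamma>2 1 = None"
    unfolding \<gamma>2 loopsD(1,2)[OF F(2)] using tofib_base_value[OF i q(1)] by auto
  have m1: "m1 \<in> {0..1}" unfolding m1_def by (rule min_coord_range) (use fin tk i1 in auto)
  have m2: "m2 \<in> {0..1}" unfolding m2_def by (rule min_coord_range) (use fin tk in auto)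
  have red: "samelson_prod S1 S2 (F1, F2) \<theta> {i} t =
     (if \<forall>k\<in>S - {i}. t k \<ge> 1/3 then commutator \<gamma>1 \<gamma>2 \<theta>
      else if m1 \<le> 1/3 then comm_null2 None \<gamma>2 (3 * m1) \<theta> else comm_null1 None \<gamma>1 (3 * m2) \<theta>)"
    using \<theta> i t by (simp add: samelson_prod_def Let_def \<gamma>1_def \<gamma>2_def m1_def m2_def)
  obtain k1 where k1: "k1 \<in> S1" "m1 = t k1" unfolding m1_def by (rule min_coord_attained[OF fin(1) ne(1)])
  have "samelson_prod S1 S2 (F1, F2) \<theta> {i} t = \<gamma>2 (min 1 (3 * m1) * trapezoid2 \<theta>)"
  proof (cases "\<forall>k\<in>S - {i}. t k \<ge> 1/3")
    case True
    moreover have "k1 \<in> S - {i}" using k1(1) i1 by blast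
    ultimately have "1/3 \<le> t k1" by blast
    then have "min 1 (3 * m1) = 1" by (simp add: k1(2))
    then show ?thesis using red True commutator_trivial1[of \<theta> \<gamma>2 None \<gamma>1, OF \<theta> g2 g1] by simp
  next
    case not_all: False
    show ?thesis
    proof (cases "m1 \<le> 1/3")
      case True
      then show ?thesis
        unfolding red if_not_P[OF not_all] if_P[OF True]
        using comm_null2_trapezoid[of \<gamma>2 None "3 * m1" \<theta>] g2 by simp
    next
      case False
      have "\<exists>k\<in>S2 - {i}. t k < 1/3"
      proof (rule ccontr)
        assume "\<not> (\<exists>k\<in>S2 - {i}. t k < 1/3)"
        then obtain k where "k \<in> S1" "t k < 1/3" using not_all by force
        then show False using min_coord_le[of S1 k t] fin False m1_def by simp
      qed
      then obtain k where k: "k \<in> S2 - {i}" "t k < 1/3" by blast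
      then have "3 * m2 < 1" using min_coord_le[of "S2 - {i}" k t] fin m2_def by simp
      have "\<gamma>2 x = None" if "x \<in> {0..1}" for x
        unfolding \<gamma>2 by (rule tofib_rescale_zero[OF loopsD(3)[OF F(2) that] i fin(2) _ k(1)]) (use tk k in auto)
      moreover have "min 1 (3 * m1) * trapezoid2 \<theta> \<in> {0..1}" "3 * m2 * trapezoid1 \<theta> \<in> {0..1}"
        by (rule unit_interval_mult; use trapezoid_range[OF \<theta>] m1 m2 \<open>3 * m2 < 1\<close> in simp)+
      ultimately show ?thesis
        unfolding red if_not_P[OF not_all] if_not_P[OF False]
        using g1 comm_null1_trapezoid[of \<gamma>1 None "3 * m2" \<theta>] by simp
    qed
  qed
  then show ?thesis by (simp add: \<gamma>2 m1_def)
qed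

text \<open>
  Three cases. If some distance within \<open>S1\<close> or within \<open>S2\<close> is at most \<open>1/3\<close>, its rescaling vanishes and both
  sides are trivial. If all of these exceed \<open>1/3\<close> and some distance between \<open>S1\<close> and \<open>S2\<close> does not lie below
  \<open>1/3\<close>, then none does, all squares have side 1, and one loop is at an end. Otherwise the
  tree is separated, every distance between the sides is \<open>cross_dist l\<close>, and the formulas differ
  only in the angle, where \<open>trapezoid_bracket\<close> compares them.
\<close>

lemma interp_samelson:
  assumes wt: "weighted_tree S E l"
  shows "J_formula Y S (samelson_prod S1 S2 (F1, F2) \<theta>) l = interp 1 F1 F2 \<theta> l"
proof -
  have s1: "(1::real) \<in> {0..1}" by simp
  define u where "u = (\<lambda>x y. max 0 ((3 * T l x y - 1) / 2))"
  define G where "G = samelson_prod S1 S2 (F1, F2) \<theta>"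
  note bd = meet_dist_bounds[OF finS wt]
  define c1 c2 where "c1 = (\<lambda>i. min 1 (3 * min_coord S2 (T l i)))" and "c2 = (\<lambda>i. min 1 (3 * min_coord S1 (T l i)))"
  have u: "u x y \<in> {0..1}" if "x \<in> S" for x y using bd[OF that, of y] by (auto simp: u_def)
  have cube: "(\<lambda>h\<in>S - {i}. T l i h) \<in> topspace (cube (S - {i}))" if "i \<in> S" for i
    by (rule restrict_in_cube) (use bd[OF that] in auto)
  have mc: "min_coord R (\<lambda>h\<in>S - {i}. T l i h) = min_coord R (T l i)" if "R \<subseteq> S - {i}" for R i
  proof -
    have "(\<lambda>h\<in>S - {i}. T l i h) ` R = T l i ` R" using that by (intro image_cong) auto
    then show ?thesis by (simp add: min_coord_def)
  qed
  have rs: "rescale (R - {i}) (\<lambda>h\<in>S - {i}. T l i h) = (\<lambda>h\<in>R - {i}. u i h)" if "R \<subseteq> S" for R i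
    unfolding rescale_def by (rule restrict_ext) (use that in \<open>auto simp: u_def\<close>)
  have fc1: "fibre_coord Y S G (T l) i = fibre_coord Y S1 (F1 (c1 i * trapezoid1 \<theta>)) u i" if i: "i \<in> S1" for i
  proof -
    have "S2 \<subseteq> S - {i}" "i \<in> S" using i dis by blast+
    then show ?thesis
      using samelson_leaf1[OF i cube] mc[of S2 i] rs[of S1 i]
      by (simp add: fibre_coord_def G_def c1_def)
  qed
  have fc2: "fibre_coord Y S G (T l) i = fibre_coord Y S2 (F2 (c2 i * trapezoid2 \<theta>)) u i" if i: "i \<in> S2" for i
  proof -
    have "S1 \<subseteq> S - {i}" "i \<in> S" using i dis by blast+
    then show ?thesis
      using samelson_leaf2[OF i cube] mc[of S1 i] rs[of S2 i]
      by (simp add: fibre_coord_def G_def c2_def)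
  qed
  have Jeq: "J_formula Y S G l = smash_pt Y S (\<lambda>i\<in>S. if i \<in> S1
      then fibre_coord Y S1 (F1 (c1 i * trapezoid1 \<theta>)) u i else fibre_coord Y S2 (F2 (c2 i * trapezoid2 \<theta>)) u i)"
  proof -
    have "(\<lambda>i\<in>S. fibre_coord Y S G (T l) i) = (\<lambda>i\<in>S. if i \<in> S1
      then fibre_coord Y S1 (F1 (c1 i * trapezoid1 \<theta>)) u i else fibre_coord Y S2 (F2 (c2 i * trapezoid2 \<theta>)) u i)"
      by (rule restrict_ext) (use fc1 fc2 in auto)
    then show ?thesis by (simp add: J_formula_fibre_coord)
  qed
  have mr: "min_coord R (T l i) \<in> {0..1}" if "i \<in> S" "finite R" for R i
    by (rule min_coord_range) (use bd[OF that(1)] that in auto)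
  have c01: "c1 i \<in> {0..1}" "c2 i \<in> {0..1}" if "i \<in> S" for i
    using mr[OF that fin(2)] mr[OF that fin(1)] by (auto simp: c1_def c2_def)
  have FF: "F1 (c1 i * trapezoid1 \<theta>) \<in> pts (tofib Y S1)" "F2 (c2 i * trapezoid2 \<theta>) \<in> pts (tofib Y S2)" if "i \<in> S" for i
    by (rule loopsD(3)[OF F(1)] loopsD(3)[OF F(2)];
        use c01[OF that] trapezoid_range[OF \<theta>] in \<open>auto intro: mult_le_one\<close>)+
  have base1: "J_formula Y S G l = None"
    if "i \<in> S1" "fibre_coord Y S1 (F1 (c1 i * trapezoid1 \<theta>)) u i = snd (Y i)" for i
    unfolding Jeq by (rule smash_pt_NoneI[of i]) (use that in auto)
  have base2: "J_formula Y S G l = None"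
    if "i \<in> S2" "fibre_coord Y S2 (F2 (c2 i * trapezoid2 \<theta>)) u i = snd (Y i)" for i
    unfolding Jeq by (rule smash_pt_NoneI[of i]) (use that dis in auto)
  obtain i0 h0 where ih0: "i0 \<in> S1" "h0 \<in> S2" using ne by blast
  have triv1: "J_formula Y S G l = None" if "i \<in> S1" "c1 i * trapezoid1 \<theta> \<in> {0, 1}" for i
  proof -
    have "F1 (c1 i * trapezoid1 \<theta>) = snd (tofib Y S1)" using that(2) loopsD(1,2)[OF F(1)] by auto
    then show ?thesis using base1[OF that(1)] fibre_coord_base[of i S1 u Y] that(1) u by simp
  qed
  have triv2: "J_formula Y S G l = None" if "i \<in> S2" "c2 i * trapezoid2 \<theta> \<in> {0, 1}" for i
  proof -
    have "F2 (c2 i * trapezoid2 \<theta>) = snd (tofib Y S2)" using that(2) loopsD(1,2)[OF F(2)] by auto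
    then show ?thesis using base2[OF that(1)] fibre_coord_base[of i S2 u Y] that(1) u by simp
  qed
  have "J_formula Y S G l = interp 1 F1 F2 \<theta> l"
  proof (cases "\<exists>R\<in>{S1, S2}. \<exists>x\<in>R. \<exists>y\<in>R. x \<noteq> y \<and> T l x y \<le> 1/3")
    case True
    then obtain R x y where R: "R = S1 \<or> R = S2" "x \<in> R" "y \<in> R" "x \<noteq> y" "T l x y \<le> 1/3" by blast
    have "interp 1 F1 F2 \<theta> l = None"
      by (rule interp_small[OF wt s1 F R(1-4)]) (use R in \<open>simp add: floor_dist_def\<close>)
    moreover have "J_formula Y S G l = None"
      using R(1)
    proof
      assume "R = S1"
      then show ?thesis
        by (intro base1[of x] fibre_coord_zero[of _ _ _ _ y] FF) (use R u in \<open>auto simp: u_def\<close>)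
    next
      assume "R = S2"
      then show ?thesis
        by (intro base2[of x] fibre_coord_zero[of _ _ _ _ y] FF) (use R u in \<open>auto simp: u_def\<close>)
    qed
    ultimately show ?thesis by simp
  next
    case False
    have same: "T l x y > 1/3" if "R = S1 \<or> R = S2" "x \<in> R" "y \<in> R" for R x y
    proof (cases "x = y")
      case True
      then show ?thesis using meet_dist_self[OF finS wt, of x] that by auto
    qed (use False that in force)
    show ?thesis
    proof (cases "cross_dist l \<ge> 1/3")
      case True
      obtain i1 h1 where c: "i1 \<in> S1" "h1 \<in> S2" "cross_dist l = T l i1 h1" by (rule cross_dist_attained)
      \<comment> \<open>One long cross distance forces all of them to be long, through the long distances within the sides.\<close>
      have far: "T l i h \<ge> 1/3" if "i \<in> S1" "h \<in> S2" for i h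
      proof -
        have "min (T l i i1) (T l i1 h) \<le> T l i h" "min (T l i1 h1) (T l h1 h) \<le> T l i1 h"
          by (rule meet_dist_ultrametric[OF finS wt])+
        then show ?thesis using same[of S1 i i1] same[of S2 h1 h] c that True by (simp add: min_def split: if_splits)
      qed
      have "c1 i0 = 1"
      proof -
        obtain k where "k \<in> S2" "min_coord S2 (T l i0) = T l i0 k" by (rule min_coord_attained[OF fin(2) ne(2)])
        then show ?thesis using far[of i0 k] ih0 by (simp add: c1_def)
      qed
      moreover have "c2 h0 = 1"
      proof -
        obtain k where "k \<in> S1" "min_coord S1 (T l h0) = T l h0 k" by (rule min_coord_attained[OF fin(1) ne(1)])
        then show ?thesis using far[of k h0] ih0 meet_dist_commute[of S l h0 k] by (simp add: c2_def)
      qed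
      ultimately have "J_formula Y S G l = None"
        using trapezoid_boundary[of \<theta>] triv1[OF ih0(1)] triv2[OF ih0(2)] by auto
      moreover have "box_side 1 l = 1" using True by (simp add: box_side_def)
      then have "interp 1 F1 F2 \<theta> l = None"
        unfolding interp_def by (rule interp_box_side_1[OF wt s1 F]) (use cut_dist_range[OF wt s1] in auto)
      ultimately show ?thesis by simp
    next
      case less: False
      then have sep: "separated l" using same unfolding separated_def by fastforce
      note cr = separated_cross[OF wt sep]
      have c1: "c1 i = box_side 1 l" if "i \<in> S1" for i
      proof -
        obtain k where "k \<in> S2" "min_coord S2 (T l i) = T l i k" by (rule min_coord_attained[OF fin(2) ne(2)])
        then show ?thesis using cr[OF that] by (simp add: c1_def box_side_def)
      qed
      have c2: "c2 i = box_side 1 l" if "i \<in> S2" for i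
      proof -
        obtain k where "k \<in> S1" "min_coord S1 (T l i) = T l i k" by (rule min_coord_attained[OF fin(1) ne(1)])
        then show ?thesis using cr[of k i] that meet_dist_commute[of S l i k] by (simp add: c2_def box_side_def)
      qed
      have fl: "floor_dist 1 l = 1/3" using less by (simp add: floor_dist_def)
      have cutu: "cut (floor_dist 1 l) (T l x y) = u x y" for x y
      proof -
        have "(T l x y - 1/3) / (1 - 1/3) = (3 * T l x y - 1) / 2" by (simp add: field_simps)
        then show ?thesis by (simp only: fl cut_def u_def)
      qed
      have I: "interp 1 F1 F2 \<theta> l = joint (F1 (box_side 1 l * bracket1 (shift_angle 1 \<theta>)))
          (F2 (box_side 1 l * bracket2 (shift_angle 1 \<theta>))) u"
        by (simp add: interp_def cutu)
      have "J_formula Y S G l = joint (F1 (box_side 1 l * trapezoid1 \<theta>)) (F2 (box_side 1 l * trapezoid2 \<theta>)) u"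
      proof -
        have "(\<lambda>i\<in>S. if i \<in> S1 then fibre_coord Y S1 (F1 (c1 i * trapezoid1 \<theta>)) u i
            else fibre_coord Y S2 (F2 (c2 i * trapezoid2 \<theta>)) u i) =
          (\<lambda>i\<in>S. if i \<in> S1 then fibre_coord Y S1 (F1 (box_side 1 l * trapezoid1 \<theta>)) u i
            else fibre_coord Y S2 (F2 (box_side 1 l * trapezoid2 \<theta>)) u i)"
          by (rule restrict_ext) (use c1 c2 in auto)
        then show ?thesis by (simp add: Jeq joint_def)
      qed
      moreover have "joint A B u = None" if "A = F1 0 \<or> B = F2 0" for A B
        by (rule joint_base) (use that loopsD(1)[OF F(1)] loopsD(1)[OF F(2)] u in auto)
      ultimately show ?thesis unfolding I using trapezoid_bracket[OF \<theta>] by auto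
    qed
  qed
  then show ?thesis by (simp add: G_def)
qed

text \<open>
  The nullhomotopy that is chosen over \<open>F2 = *\<close> moves \<open>F1\<close> only, so at a leaf of \<open>S2\<close> it sees the component of \<open>F1\<close> over the
  empty set, which is trivial; symmetrically for \<open>F1 = *\<close>.
\<close>

lemma samelson_null_trivial:
  assumes base: "F1 = snd (loops (tofib Y S1)) \<or> F2 = snd (loops (tofib Y S2))" and s: "s \<in> {0..1}"
    and wt: "weighted_tree S E l"
  shows "J_formula Y S (samelson_null Y S1 S2 (F1, F2) s \<theta>) l = None"
proof -
  note bd = meet_dist_bounds[OF finS wt]
  have par: "s * min 1 (3 * min_coord R t) * x \<in> {0..1}"
    if "finite R" "\<And>k. k \<in> R \<Longrightarrow> t k \<in> {0..1}" "x \<in> {0..1}" for R t x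
    by (intro unit_interval_mult s that(3)) (use min_coord_range[OF that(1,2)] in auto)
  obtain i h where ih: "i \<in> S1" "h \<in> S2" using ne by blast
  have NoneI: ?thesis if "j \<in> S" "samelson_null Y S1 S2 (F1, F2) s \<theta> {j} (\<lambda>h\<in>S - {j}. T l j h) = None" for j
    unfolding J_formula_fibre_coord
    by (rule smash_pt_NoneI[OF that(1)]) (use that in \<open>simp add: fibre_coord_def wedge_single_def\<close>)
  show ?thesis
  proof (cases "F2 = snd (loops (tofib Y S2))")
    case True
    define t where "t = (\<lambda>k\<in>S - {h}. T l h k)"
    have t: "t \<in> topspace (cube (S - {h}))" unfolding t_def by (rule restrict_in_cube) (use bd ih in auto)
    then have tk: "t k \<in> {0..1}" if "k \<in> S - {h}" for k using that by (rule cube_coord)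
    have h1: "h \<notin> S1" using ih dis by blast
    have g: "rescaled_loop S1 F1 {h} t x = None" if "x \<in> {0..1}" for x
    proof -
      have e: "{h} \<inter> S1 = {}" "S1 - {h} = S1" using h1 by auto
      have "rescale S1 t \<in> topspace (cube S1)" by (rule rescale_in_cube) (use tk h1 in blast)
      then show ?thesis
        unfolding rescaled_loop_def e using tofib_empty_wedge[OF loopsD(3)[OF F(1) that]] by blast
    qed
    have "samelson_null Y S1 S2 (F1, F2) s \<theta> {h} t =
        comm_null1 None (rescaled_loop S1 F1 {h} t) (s * min 1 (3 * min_coord (S2 - {h}) t)) \<theta>"
      using \<theta> ih t True by (simp add: samelson_null_def)
    also have "\<dots> = rescaled_loop S1 F1 {h} t (s * min 1 (3 * min_coord (S2 - {h}) t) * trapezoid1 \<theta>)"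
      by (rule comm_null1_trapezoid, rule g) simp
    also have "\<dots> = None"
      by (rule g, rule par) (use fin tk trapezoid_range[OF \<theta>] in auto)
    finally show ?thesis using NoneI[of h] ih unfolding t_def by blast
  next
    case False
    define t where "t = (\<lambda>k\<in>S - {i}. T l i k)"
    have t: "t \<in> topspace (cube (S - {i}))" unfolding t_def by (rule restrict_in_cube) (use bd ih in auto)
    then have tk: "t k \<in> {0..1}" if "k \<in> S - {i}" for k using that by (rule cube_coord)
    have i2: "i \<notin> S2" using ih dis by blast
    have g: "rescaled_loop S2 F2 {i} t x = None" if "x \<in> {0..1}" for x
    proof -
      have e: "{i} \<inter> S2 = {}" "S2 - {i} = S2" using i2 by auto
      have "rescale S2 t \<in> topspace (cube S2)" by (rule rescale_in_cube) (use tk i2 in blast)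
      then show ?thesis
        unfolding rescaled_loop_def e using tofib_empty_wedge[OF loopsD(3)[OF F(2) that]] by blast
    qed
    have "samelson_null Y S1 S2 (F1, F2) s \<theta> {i} t =
        comm_null2 None (rescaled_loop S2 F2 {i} t) (s * min 1 (3 * min_coord (S1 - {i}) t)) \<theta>"
      using \<theta> ih t False by (simp add: samelson_null_def)
    also have "\<dots> = rescaled_loop S2 F2 {i} t (s * min 1 (3 * min_coord (S1 - {i}) t) * trapezoid2 \<theta>)"
      by (rule comm_null2_trapezoid, rule g) simp
    also have "\<dots> = None"
      by (rule g, rule par) (use fin tk trapezoid_range[OF \<theta>] in auto)
    finally show ?thesis using NoneI[of i] ih unfolding t_def by blast
  qed
qed

end

end

section \<open>Base points and mapping cones\<close>

lemma based_space_tofib: "snd (tofib Y R) \<in> pts (tofib Y R)"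
proof -
  let ?b = "snd (tofib Y R)"
  have bw: "None \<in> pts (bwedge Y T)" for T by (simp add: bwedge_def topspace_collapse)
  have b: "?b = (\<lambda>T\<in>Pow R. \<lambda>p\<in>topspace (cube (R - T)). None)" by (simp add: tofib_def)
  have "continuous_map (cube (R - T)) (fst (bwedge Y T)) (\<lambda>p\<in>topspace (cube (R - T)). None)" for T
    by (rule continuous_map_eq[of _ _ "\<lambda>_. None"]) (use bw in auto)
  then have "?b \<in> (\<Pi>\<^sub>E T\<in>Pow R. topspace (map_space (cube (R - T)) (fst (bwedge Y T))))"
    unfolding b topspace_map_space by auto
  moreover have "?b T p = None" if "T \<subseteq> R" "p \<in> topspace (cube (R - T))" for T p
    using that by (simp add: b)
  moreover have "(\<lambda>k\<in>R - T. if k \<in> T' then 1 else p k) \<in> topspace (cube (R - T))"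
    if "T \<subseteq> T'" "T' \<subseteq> R" "p \<in> topspace (cube (R - T'))" for T T' and p :: "'a \<Rightarrow> real"
    by (rule restrict_in_cube) (use cube_coord[OF that(3)] in auto)
  ultimately show ?thesis
    by (auto simp: tofib_def wedge_collapse_def)
qed

lemma based_space_loops: "snd Z \<in> pts Z \<Longrightarrow> snd (loops Z) \<in> pts (loops Z)"
proof -
  assume Z: "snd Z \<in> pts Z"
  have "continuous_map unit_interval (fst Z) (\<lambda>\<theta>\<in>{0..1}. snd Z)"
    by (rule continuous_map_eq[of _ _ "\<lambda>_. snd Z"]) (use Z in auto)
  then show ?thesis by (auto simp: loops_def topspace_map_space)
qed

lemma based_space_maps:
  assumes "snd Z \<in> pts Z" "snd X \<in> pts X" shows "snd (based_maps X Z) \<in> pts (based_maps X Z)"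
proof -
  have "continuous_map (fst X) (fst Z) (\<lambda>x\<in>pts X. snd Z)"
    by (rule continuous_map_eq[of _ _ "\<lambda>_. snd Z"]) (use assms in auto)
  then show ?thesis using assms(2) by (auto simp: based_maps_def topspace_map_space)
qed

lemma pts_mapping_cone:
  assumes "z \<in> pts (mapping_cone A X f)" "\<And>a. a \<in> pts A \<Longrightarrow> f a \<in> pts X" "snd X \<in> pts X"
  shows "(\<exists>x\<in>pts X. z = Inl x) \<or> (\<exists>a\<in>pts A. \<exists>s. 0 < s \<and> s < 1 \<and> z = Inr (a, s))"
proof -
  obtain y where y: "y \<in> topspace (disjoint_sum (fst X) (prod_topology (fst A) unit_interval))"
    "z = cone_pt A X f y"
    using assms(1) by (auto simp: mapping_cone_def topspace_quotient_topology)
  show ?thesis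
  proof (cases y)
    case (Inl x)
    then show ?thesis using y by (auto simp: topspace_disjoint_sum)
  next
    case (Inr q)
    then obtain a s where q: "y = Inr (a, s)" "a \<in> pts A" "s \<in> {0..1}"
      using y(1) by (cases q) (auto simp: topspace_disjoint_sum)
    then show ?thesis using y(2) assms(2)[of a] assms(3) by (auto split: if_splits)
  qed
qed

lemma continuous_map_mapping_cone:
  assumes "continuous_map (fst X) Z (\<lambda>x. g (Inl x))" "z0 \<in> topspace Z"
    and "\<And>a s. a \<in> pts A \<Longrightarrow> s \<in> {0..1} \<Longrightarrow> g (cone_pt A X f (Inr (a, s))) = z0"
  shows "continuous_map (fst (mapping_cone A X f)) Z g"
proof -
  have "continuous_map (prod_topology (fst A) unit_interval) Z (\<lambda>q. g (cone_pt A X f (Inr q)))"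
    by (rule continuous_map_eq[of _ _ "\<lambda>_. z0"]) (use assms(2,3) in \<open>auto simp del: cone_pt.simps\<close>)
  then show ?thesis
    unfolding mapping_cone_def fst_conv continuous_map_quotient_topology continuous_map_disjoint_sum
    using assms(1) by simp
qed

section \<open>Assembling the homotopy\<close>

context two_blocks
begin

abbreviation maps_space :: "(('i tree_pt) \<Rightarrow> ('i \<Rightarrow> 'a) option) based" where
  "maps_space \<equiv> based_maps (tree_space S) (bsmash Y S)"

abbreviation const_loop :: "real \<Rightarrow> 'i tree_pt \<Rightarrow> ('i \<Rightarrow> 'a) option" where
  "const_loop \<equiv> snd (loops maps_space)"

definition bracket_path ::
  "(real \<Rightarrow> ('i, 'a) tofib_pt) \<Rightarrow> (real \<Rightarrow> ('i, 'a) tofib_pt) \<Rightarrow> real \<Rightarrow> real \<Rightarrow>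
   'i tree_pt \<Rightarrow> ('i \<Rightarrow> 'a) option" where
  "bracket_path F1 F2 s = (\<lambda>\<theta>\<in>{0..1}. \<lambda>\<tau>\<in>pts (tree_space S).
     case \<tau> of None \<Rightarrow> None | Some l \<Rightarrow> interp s F1 F2 \<theta> l)"

lemma const_loop_eq: "const_loop = (\<lambda>\<theta>\<in>{0..1}. \<lambda>\<tau>\<in>pts (tree_space S). None)"
  by (simp add: loops_def based_maps_def snd_bsmash)

lemma const_loop_in: "const_loop \<in> pts (loops maps_space)"
  by (intro based_space_loops based_space_maps) (simp_all add: snd_bsmash None_in_bsmash snd_tree_space pts_tree_space)

text \<open>
  At the ends of the angle one of the two loops is at time 0, so \<open>interp\<close> does give loops.
\<close>

lemma interp_endpoints:
  assumes wt: "weighted_tree S E l" and s: "s \<in> {0..1}"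
    and F: "F1 \<in> pts (loops (tofib Y S1))" "F2 \<in> pts (loops (tofib Y S2))" and "\<theta> = 0 \<or> \<theta> = 1"
  shows "interp s F1 F2 \<theta> l = None"
proof -
  have "bracket1 (shift_angle s \<theta>) = 0 \<or> bracket2 (shift_angle s \<theta>) = 0"
    using assms(5) s by (auto simp: shift_angle_def bracket1_def bracket2_def min_def max_def)
  then show ?thesis
    unfolding interp_def
    by (intro joint_base) (use loopsD(1)[OF F(1)] loopsD(1)[OF F(2)] cut_dist_range[OF wt s] in auto)
qed

lemma continuous_bracket_path:
  "continuous_map (prod_topology (prod_topology (fst (loops (tofib Y S1))) (fst (loops (tofib Y S2)))) unit_interval)
     (fst (loops maps_space)) (\<lambda>(F, s). bracket_path (fst F) (snd F) s)"
proof -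
  let ?A = "fst (loops (tofib Y S1))" and ?B = "fst (loops (tofib Y S2))"
  let ?Z = "prod_topology (prod_topology ?A ?B) unit_interval"
  let ?W = "prod_topology ?Z unit_interval"
  let ?K = "top_of_set {l. \<exists>E. weighted_tree S E l}"
  let ?X = "prod_topology ?W ?K"
  have f1: "continuous_map ?X ?W fst" by (rule continuous_map_fst)
  have f2: "continuous_map ?X ?Z (\<lambda>x. fst (fst x))"
    using continuous_map_compose[OF f1 continuous_map_fst] by (simp add: o_def)
  have f3: "continuous_map ?X (prod_topology ?A ?B) (\<lambda>x. fst (fst (fst x)))"
    using continuous_map_compose[OF f2 continuous_map_fst] by (simp add: o_def)
  have "continuous_map ?X ?A (\<lambda>x. fst (fst (fst (fst x))))" "continuous_map ?X ?B (\<lambda>x. snd (fst (fst (fst x))))"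
    "continuous_map ?X unit_interval (\<lambda>x. snd (fst (fst x)))" "continuous_map ?X unit_interval (\<lambda>x. snd (fst x))"
    using continuous_map_compose[OF f3 continuous_map_fst] continuous_map_compose[OF f3 continuous_map_snd]
      continuous_map_compose[OF f2 continuous_map_snd] continuous_map_compose[OF f1 continuous_map_snd]
    by (simp_all add: o_def)
  from continuous_interp[OF this continuous_map_snd]
  have "continuous_map ?X (fst (bsmash Y S))
      (\<lambda>(w, l). interp (snd (fst w)) (fst (fst (fst w))) (snd (fst (fst w))) (snd w) l)"
    by (simp add: case_prod_unfold)
  then have "continuous_map ?W (fst maps_space) (\<lambda>w. \<lambda>\<tau>\<in>pts (tree_space S). case \<tau> of None \<Rightarrow> snd (bsmash Y S)
      | Some l \<Rightarrow> interp (snd (fst w)) (fst (fst (fst w))) (snd (fst (fst w))) (snd w) l)"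
    by (rule continuous_map_into_tree_maps[OF finS])
      (auto simp: snd_bsmash None_in_bsmash intro!: interp_degenerate)
  then have "continuous_map ?W (fst maps_space) (\<lambda>(z, \<theta>). \<lambda>\<tau>\<in>pts (tree_space S). case \<tau> of None \<Rightarrow> None
      | Some l \<Rightarrow> interp (snd z) (fst (fst z)) (snd (fst z)) \<theta> l)"
    unfolding case_prod_unfold snd_bsmash .
  from continuous_map_curry[OF this]
  have "continuous_map ?Z (map_space unit_interval (fst maps_space)) (\<lambda>z. bracket_path (fst (fst z)) (snd (fst z)) (snd z))"
    by (simp add: bracket_path_def)
  moreover have "bracket_path (fst (fst z)) (snd (fst z)) (snd z) \<theta> = snd maps_space"
    if "z \<in> topspace ?Z" "\<theta> = 0 \<or> \<theta> = 1" for z \<theta>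
  proof -
    have "snd z \<in> {0..1}" "fst (fst z) \<in> pts (loops (tofib Y S1))" "snd (fst z) \<in> pts (loops (tofib Y S2))"
      using that(1) by auto
    then have "(case \<tau> of None \<Rightarrow> None | Some l \<Rightarrow> interp (snd z) (fst (fst z)) (snd (fst z)) \<theta> l) = None"
      if "\<tau> \<in> pts (tree_space S)" for \<tau>
      using that \<open>\<theta> = 0 \<or> \<theta> = 1\<close> interp_endpoints by (auto simp: pts_tree_space)
    then have "(\<lambda>\<tau>\<in>pts (tree_space S). case \<tau> of None \<Rightarrow> None
        | Some l \<Rightarrow> interp (snd z) (fst (fst z)) (snd (fst z)) \<theta> l) = (\<lambda>\<tau>\<in>pts (tree_space S). None)"
      by (rule restrict_ext)
    then show ?thesis
      using that(2) by (auto simp: bracket_path_def based_maps_def snd_bsmash)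
  qed
  ultimately have "continuous_map ?Z (fst (loops maps_space)) (\<lambda>z. bracket_path (fst (fst z)) (snd (fst z)) (snd z))"
    by (simp add: loops_def continuous_map_in_subtopology)
  then show ?thesis by (simp add: case_prod_unfold)
qed

lemma interp_wedge:
  assumes wt: "weighted_tree S E l" and s: "s \<in> {0..1}"
    and "F1 = snd (loops (tofib Y S1)) \<or> F2 = snd (loops (tofib Y S2))"
  shows "interp s F1 F2 \<theta> l = None"
proof -
  have "box_side s l * bracket1 (shift_angle s \<theta>) \<in> {0..1}" "box_side s l * bracket2 (shift_angle s \<theta>) \<in> {0..1}"
    by (rule product_range[OF wt s], rule bracket_range, rule shift_angle_range)+
  moreover have "snd (loops (tofib Y R)) x = snd (tofib Y R)" if "x \<in> {0..1}" for R x
    using that by (simp add: loops_def)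
  ultimately show ?thesis
    unfolding interp_def by (intro joint_base) (use assms(3) cut_dist_range[OF wt s] in auto)
qed

lemma bracket_path_wedge:
  assumes "s \<in> {0..1}" "F1 = snd (loops (tofib Y S1)) \<or> F2 = snd (loops (tofib Y S2))"
  shows "bracket_path F1 F2 s = const_loop"
proof -
  have "(\<lambda>\<tau>\<in>pts (tree_space S). case \<tau> of None \<Rightarrow> None | Some l \<Rightarrow> interp s F1 F2 \<theta> l) =
      (\<lambda>\<tau>\<in>pts (tree_space S). None)" for \<theta>
    by (rule restrict_ext) (use interp_wedge[OF _ assms] in \<open>auto simp: pts_tree_space\<close>)
  then show ?thesis by (simp add: bracket_path_def const_loop_eq)
qed

lemma bracket_path_0:
  assumes "F1 \<in> pts (loops (tofib Y S1))" "F2 \<in> pts (loops (tofib Y S2))"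
  shows "join_loops S1 S2 (graft_prod (bsmash Y S1) (bsmash Y S2) S1 S2
      (loops_map (J Y S1) F1, loops_map (J Y S2) F2)) = bracket_path F1 F2 0"
  unfolding join_loops_def loops_map_def[of _ "graft_prod _ _ _ _ _"] bracket_path_def
proof (intro restrict_ext)
  fix \<theta> \<tau> assume \<theta>: "\<theta> \<in> {0..1::real}" and \<tau>: "\<tau> \<in> pts (tree_space S)"
  show "smash_join S1 S2 (graft_prod (bsmash Y S1) (bsmash Y S2) S1 S2
      (loops_map (J Y S1) F1, loops_map (J Y S2) F2) \<theta> \<tau>) =
      (case \<tau> of None \<Rightarrow> None | Some l \<Rightarrow> interp 0 F1 F2 \<theta> l)"
  proof (cases \<tau>)
    case None
    then show ?thesis using \<theta> \<tau> by (simp add: graft_prod_def ungraft_def smash_join_def)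
  next
    case (Some l)
    then obtain E where "weighted_tree S E l" "\<not> degenerate S l" using \<tau> by (auto simp: pts_tree_space)
    then show ?thesis using interp_graft[OF assms \<theta>] Some by simp
  qed
qed

lemma bracket_path_1:
  assumes "F1 \<in> pts (loops (tofib Y S1))" "F2 \<in> pts (loops (tofib Y S2))"
  shows "loops_map (J Y S) (samelson_prod S1 S2 (F1, F2)) = bracket_path F1 F2 1"
  unfolding loops_map_def bracket_path_def J_def
proof (intro restrict_ext)
  fix \<theta> \<tau> assume \<theta>: "\<theta> \<in> {0..1::real}" and \<tau>: "\<tau> \<in> pts (tree_space S)"
  then show "(case \<tau> of None \<Rightarrow> None | Some l \<Rightarrow> J_formula Y S (samelson_prod S1 S2 (F1, F2) \<theta>) l) =
      (case \<tau> of None \<Rightarrow> None | Some l \<Rightarrow> interp 1 F1 F2 \<theta> l)"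
    using interp_samelson[OF assms \<theta>] by (auto simp: pts_tree_space)
qed

lemma samelson_null_const:
  assumes "F1 \<in> pts (loops (tofib Y S1))" "F2 \<in> pts (loops (tofib Y S2))"
    and "F1 = snd (loops (tofib Y S1)) \<or> F2 = snd (loops (tofib Y S2))" "s \<in> {0..1}"
  shows "loops_map (J Y S) (samelson_null Y S1 S2 (F1, F2) s) = const_loop"
  unfolding loops_map_def const_loop_eq J_def
proof (intro restrict_ext)
  fix \<theta> \<tau> assume \<theta>: "\<theta> \<in> {0..1::real}" and \<tau>: "\<tau> \<in> pts (tree_space S)"
  then show "(case \<tau> of None \<Rightarrow> None | Some l \<Rightarrow> J_formula Y S (samelson_null Y S1 S2 (F1, F2) s \<theta>) l) = None"
    using samelson_null_trivial[OF assms(1,2) \<theta> assms(3,4)] by (auto simp: pts_tree_space)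
qed

text \<open>
  It suffices to find a continuous map from the mapping cone to the paths of loops of maps: such a map is
  tested on the two pieces that are glued to the cone, and evaluation of paths is continuous. This
  avoids comparing the product of an interval with the quotient topology of the cone to a quotient of products.
\<close>

lemma graft_homotopic_samelson:
  fixes X M
  defines "X \<equiv> cone_smash (loops (tofib Y S1)) (loops (tofib Y S2))"
    and "M \<equiv> (\<lambda>S. loops (based_maps (tree_space S) (bsmash Y S)))"
  shows "homotopic_with (\<lambda>H. H (snd X) = snd (M S)) (fst X) (fst (M S))
    (join_loops S1 S2 \<circ> graft_bracket (bsmash Y S1) (bsmash Y S2) S1 S2 \<circ>
       cone_smash_map (M S1) (M S2) (loops_map (J Y S1)) (loops_map (J Y S2)))
    (loops_map (J Y S) \<circ> samelson_ext Y S1 S2)"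
proof -
  let ?A = "loops (tofib Y S1)" and ?B = "loops (tofib Y S2)"
  let ?left = "join_loops S1 S2 \<circ> graft_bracket (bsmash Y S1) (bsmash Y S2) S1 S2 \<circ>
       cone_smash_map (M S1) (M S2) (loops_map (J Y S1)) (loops_map (J Y S2))"
  let ?right = "loops_map (J Y S) \<circ> samelson_ext Y S1 S2"
  define h :: "real \<times> (real \<Rightarrow> ('i, 'a) tofib_pt, real \<Rightarrow> ('i, 'a) tofib_pt) cone_smash \<Rightarrow>
      real \<Rightarrow> 'i tree_pt \<Rightarrow> ('i \<Rightarrow> 'a) option"
    where "h = (\<lambda>(s, z). case z of Inl F \<Rightarrow> bracket_path (fst F) (snd F) s | Inr _ \<Rightarrow> const_loop)"
  have MS: "M S = loops maps_space" by (simp add: M_def)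
  have baseA: "snd ?A \<in> pts ?A" and baseB: "snd ?B \<in> pts ?B"
    by (intro based_space_loops based_space_tofib)+
  have snX: "snd X = Inl (snd ?A, snd ?B)" by (simp add: X_def cone_smash_def mapping_cone_def prod2_def)
  have snX': "snd X \<in> topspace (fst X)"
  proof -
    have "Inl (snd ?A, snd ?B) = cone_pt (wedge2 ?A ?B) (prod2 ?A ?B) (\<lambda>w. w) (Inl (snd ?A, snd ?B))" by simp
    moreover have "Inl (snd ?A, snd ?B) \<in> topspace (disjoint_sum (fst (prod2 ?A ?B))
        (prod_topology (fst (wedge2 ?A ?B)) unit_interval))"
      using baseA baseB by (simp add: topspace_disjoint_sum prod2_def InlI)
    ultimately show ?thesis
      unfolding snX by (simp only: X_def cone_smash_def mapping_cone_def fst_conv topspace_quotient_topology) (rule image_eqI)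
  qed
  have wedge: "a \<in> pts (wedge2 ?A ?B) \<longleftrightarrow> fst a \<in> pts ?A \<and> snd a \<in> pts ?B \<and> (fst a = snd ?A \<or> snd a = snd ?B)" for a
    by (cases a) (auto simp: wedge2_def)
  have points: thesis
    if z: "z \<in> topspace (fst X)"
      and whole: "\<And>F1 F2. F1 \<in> pts ?A \<Longrightarrow> F2 \<in> pts ?B \<Longrightarrow> z = Inl (F1, F2) \<Longrightarrow> thesis"
      and cone: "\<And>F1 F2 s. F1 \<in> pts ?A \<Longrightarrow> F2 \<in> pts ?B \<Longrightarrow> F1 = snd ?A \<or> F2 = snd ?B \<Longrightarrow>
        0 < s \<Longrightarrow> s < 1 \<Longrightarrow> z = Inr ((F1, F2), s) \<Longrightarrow> thesis"
    for z thesis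
  proof -
    have "(\<exists>x\<in>pts (prod2 ?A ?B). z = Inl x) \<or> (\<exists>a\<in>pts (wedge2 ?A ?B). \<exists>s. 0 < s \<and> s < 1 \<and> z = Inr (a, s))"
      by (rule pts_mapping_cone[of _ _ _ "\<lambda>w. w"])
        (use z baseA baseB in \<open>auto simp: X_def cone_smash_def wedge prod2_def\<close>)
    then show thesis
    proof
      assume "\<exists>x\<in>pts (prod2 ?A ?B). z = Inl x"
      then show thesis using whole by (auto simp: prod2_def)
    next
      assume "\<exists>a\<in>pts (wedge2 ?A ?B). \<exists>s. 0 < s \<and> s < 1 \<and> z = Inr (a, s)"
      then obtain a s where "a \<in> pts (wedge2 ?A ?B)" "0 < s" "s < 1" "z = Inr (a, s)" by blast
      then show thesis using cone[of "fst a" "snd a" s] unfolding wedge by simp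
    qed
  qed
  have hw: "h (s, Inl F) = const_loop" if "s \<in> {0..1}" "fst F = snd ?A \<or> snd F = snd ?B" for s F
    using bracket_path_wedge[OF that] by (simp add: h_def)
  have "continuous_map (fst X) (map_space unit_interval (fst (M S))) (\<lambda>z. \<lambda>s\<in>{0..1}. h (s, z))"
    unfolding X_def cone_smash_def
  proof (rule continuous_map_mapping_cone)
    show "continuous_map (fst (prod2 ?A ?B)) (map_space unit_interval (fst (M S))) (\<lambda>x. \<lambda>s\<in>{0..1}. h (s, Inl x))"
      using continuous_map_curry[OF continuous_bracket_path] by (simp add: h_def prod2_def MS)
    have "continuous_map unit_interval (fst (M S)) (\<lambda>s\<in>{0..1}. const_loop)"
      by (rule continuous_map_eq[of _ _ "\<lambda>_. const_loop"]) (use const_loop_in in \<open>auto simp: MS\<close>)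
    then show "(\<lambda>s\<in>{0..1}. const_loop) \<in> topspace (map_space unit_interval (fst (M S)))"
      by (simp add: topspace_map_space)
    show "(\<lambda>s\<in>{0..1}. h (s, cone_pt (wedge2 ?A ?B) (prod2 ?A ?B) (\<lambda>w. w) (Inr (a, t)))) = (\<lambda>s\<in>{0..1}. const_loop)"
      if a: "a \<in> pts (wedge2 ?A ?B)" and "t \<in> {0..1}" for a t
    proof (rule restrict_ext)
      fix s :: real assume s: "s \<in> {0..1}"
      have "h (s, Inl a) = const_loop" using hw[OF s] a wedge by blast
      moreover have "h (s, Inl (snd ?A, snd ?B)) = const_loop" using hw[OF s] by simp
      moreover have "h (s, Inr q) = const_loop" for q by (simp add: h_def)
      ultimately show "h (s, cone_pt (wedge2 ?A ?B) (prod2 ?A ?B) (\<lambda>w. w) (Inr (a, t))) = const_loop"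
        by (simp add: prod2_def)
    qed
  qed
  then have "continuous_map (prod_topology unit_interval (fst X)) (map_space unit_interval (fst (M S)))
      (\<lambda>q. \<lambda>s\<in>{0..1}. h (s, snd q))"
    using continuous_map_compose[OF continuous_map_snd] by (fastforce simp: o_def)
  then have "continuous_map (prod_topology unit_interval (fst X))
      (prod_topology (map_space unit_interval (fst (M S))) unit_interval) (\<lambda>q. (\<lambda>s\<in>{0..1}. h (s, snd q), fst q))"
    by (simp add: continuous_map_pairedI continuous_map_fst)
  from continuous_map_compose[OF this continuous_map_eval[OF compact_Hausdorff_unit_interval]]
  have "continuous_map (prod_topology unit_interval (fst X)) (fst (M S)) (\<lambda>q. (\<lambda>s\<in>{0..1}. h (s, snd q)) (fst q))"
    by (simp add: o_def)
  then have cont: "continuous_map (prod_topology unit_interval (fst X)) (fst (M S)) h"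
    by (rule continuous_map_eq) auto
  have left: "h (0, z) = ?left z" if "z \<in> topspace (fst X)" for z
  proof (rule points[OF that], goal_cases)
    case (1 F1 F2)
    note F = 1(1,2) and z = 1(3)
    show ?thesis
      using bracket_path_0[OF F] by (simp add: z h_def cone_smash_map_def graft_bracket_def from_cone_smash_def)
  next
    case (2 F1 F2 s)
    note F = 2(1,2) and w = 2(3) and s = 2(4,5) and z = 2(6)
    let ?\<psi> = "(loops_map (J Y S1) F1, loops_map (J Y S2) F2)"
    have whole: "join_loops S1 S2 (graft_prod (bsmash Y S1) (bsmash Y S2) S1 S2 ?\<psi>) = const_loop"
      using bracket_path_0[OF F] bracket_path_wedge[OF _ w, of 0] by simp
    have cone: "join_loops S1 S2 (\<lambda>\<theta>\<in>{0..1}. \<lambda>\<tau>\<in>pts (tree_space S). None) = const_loop"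
      unfolding join_loops_def loops_map_def const_loop_eq
      by (intro restrict_ext) (simp add: smash_join_def)
    \<comment> \<open>The image of a cone point is a cone point again, or the basepoint if both loops become trivial.\<close>
    have "cone_smash_map (M S1) (M S2) (loops_map (J Y S1)) (loops_map (J Y S2)) z \<in> {Inl ?\<psi>, Inr (?\<psi>, s)}"
      using s by (simp add: z cone_smash_map_def wedge2_def prod2_def)
    then have "?left z = const_loop"
      using whole cone by (auto simp: graft_bracket_def from_cone_smash_def)
    then show ?thesis by (simp add: h_def z)
  qed
  have right: "h (1, z) = ?right z" if "z \<in> topspace (fst X)" for z
  proof (rule points[OF that], goal_cases)
    case (1 F1 F2)
    note F = 1(1,2) and z = 1(3)
    show ?thesis using bracket_path_1[OF F] by (simp add: z h_def samelson_ext_def from_cone_smash_def)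
  next
    case (2 F1 F2 s)
    note F = 2(1,2) and w = 2(3) and s = 2(4,5) and z = 2(6)
    show ?thesis
      using samelson_null_const[OF F w, of s] s by (simp add: z h_def samelson_ext_def from_cone_smash_def)
  qed
  have based: "h (t, snd X) = snd (M S)" if "t \<in> {0..1}" for t
    unfolding snX MS using hw[OF that, of "(snd ?A, snd ?B)"] by simp
  show ?thesis
    by (subst homotopic_with) (use snX' cont left right based in \<open>auto intro!: exI[of _ h]\<close>)
qed

end

theorem theorem4p1:
  fixes n :: nat and Y :: "nat \<Rightarrow> 'a based"
  assumes "n \<ge> 1" and "\<And>i. i \<in> {1..n} \<Longrightarrow> based_space (Y i)"
  shows "(\<forall>F\<in>pts (tofib Y {1..n}). \<forall>E l. weighted_tree {1..n} E l \<longrightarrow>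
            J Y {1..n} F (tree_class {1..n} l) = J_formula Y {1..n} F l) \<and>
         based_map (tofib Y {1..n}) (based_maps (tree_space {1..n}) (bsmash Y {1..n}))
           (J Y {1..n}) \<and>
         (\<forall>\<sigma> F \<tau>. \<sigma> permutes {1..n} \<and> F \<in> pts (tofib Y {1..n}) \<and> \<tau> \<in> pts (tree_space {1..n}) \<longrightarrow>
            J (perm_family \<sigma> Y) {1..n} (perm_tofib \<sigma> {1..n} F) (perm_tree \<sigma> \<tau>) =
            perm_smash \<sigma> (J Y {1..n} F \<tau>)) \<and>
         (\<forall>S1 S2. S1 \<noteq> {} \<and> S2 \<noteq> {} \<and> S1 \<inter> S2 = {} \<and> S1 \<union> S2 = {1..n} \<longrightarrow>
            (let X = cone_smash (loops (tofib Y S1)) (loops (tofib Y S2));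
                 M = (\<lambda>S. loops (based_maps (tree_space S) (bsmash Y S)))
             in homotopic_with (\<lambda>H. H (snd X) = snd (M {1..n})) (fst X) (fst (M {1..n}))
                  (join_loops S1 S2 \<circ> graft_bracket (bsmash Y S1) (bsmash Y S2) S1 S2 \<circ>
                     cone_smash_map (M S1) (M S2) (loops_map (J Y S1)) (loops_map (J Y S2)))
                  (loops_map (J Y {1..n}) \<circ> samelson_ext Y S1 S2)))"
proof (intro conjI ballI allI impI)
  show "J Y {1..n} F (tree_class {1..n} l) = J_formula Y {1..n} F l"
    if "F \<in> pts (tofib Y {1..n})" "weighted_tree {1..n} E l" for F E l
    using J_tree_class that by blast
  show "based_map (tofib Y {1..n}) (based_maps (tree_space {1..n}) (bsmash Y {1..n})) (J Y {1..n})"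
    by (rule J_based_map) (use assms in auto)
  show "J (perm_family \<sigma> Y) {1..n} (perm_tofib \<sigma> {1..n} F) (perm_tree \<sigma> \<tau>) = perm_smash \<sigma> (J Y {1..n} F \<tau>)"
    if "\<sigma> permutes {1..n} \<and> F \<in> pts (tofib Y {1..n}) \<and> \<tau> \<in> pts (tree_space {1..n})" for \<sigma> F \<tau>
    by (rule J_equivariant) (use that in auto)
next
  fix S1 S2 assume S: "S1 \<noteq> {} \<and> S2 \<noteq> {} \<and> S1 \<inter> S2 = {} \<and> S1 \<union> S2 = {1..n}"
  then have eq: "S1 \<union> S2 = {1..n}" by blast
  have "finite S1" "finite S2" using eq by (metis finite_Un finite_atLeastAtMost)+
  then interpret two_blocks Y S1 S2
    using S assms(2) by unfold_locales auto
  show "let X = cone_smash (loops (tofib Y S1)) (loops (tofib Y S2));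
            M = (\<lambda>S. loops (based_maps (tree_space S) (bsmash Y S)))
        in homotopic_with (\<lambda>H. H (snd X) = snd (M {1..n})) (fst X) (fst (M {1..n}))
             (join_loops S1 S2 \<circ> graft_bracket (bsmash Y S1) (bsmash Y S2) S1 S2 \<circ>
                cone_smash_map (M S1) (M S2) (loops_map (J Y S1)) (loops_map (J Y S2)))
             (loops_map (J Y {1..n}) \<circ> samelson_ext Y S1 S2)"
    using graft_homotopic_samelson unfolding eq Let_def .
qed

end
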